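(* Let $n\ge 2$ be an integer, let $\mathbb{S}^{4n-1}\subset\mathbb{H}^n\simeq\mathbb{R}^{4n}$ be the quaternionic unit sphere, and let $\mu\in M(\mathbb{S}^{4n-1})$ be a finite (complex-valued) Borel measure on it. For $(h,m)\in I_{\mathbb{H}}=\{(h,m)\in\mathbb{N}^2: 2m\le h\}$ let $\pi_{h,m}\mu$ denote the projection of $\mu$ onto the space $\mathcal{H}_{h,m}$ of quaternionic spherical harmonics, and for $\epsilon>0$ let $$C(\epsilon)=\Big\{(h,m)\in I_{\mathbb{H}}:\ h\ge 1,\ \Big|\frac{m}{h}-\frac12\Big|<\epsilon\Big\}.$$ Suppose that for some $\epsilon>0$ the set $$C(\epsilon)\cap\{(h,m)\in I_{\mathbb{H}}:\ \pi_{h,m}\mu\not\equiv 0\}$$ is finite. Then $$\dim_{\mathcal{H}}(\mu)\ \ge\ 4n-4,$$ where $\dim_{\mathcal{H}}(\mu)$ is the lower Hausdorff dimension of $\mu$.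
   Context: **Conventions.** $\mathbb{N}$ includes $0$. $\mathbb{H}$ denotes the quaternions with imaginary units $\mathbf{i},\mathbf{j},\mathbf{k}$; for $x=a+b\mathbf{i}+c\mathbf{j}+d\mathbf{k}$ with $a,b,c,d\in\mathbb{R}$ the conjugate is $\bar x=a-b\mathbf{i}-c\mathbf{j}-d\mathbf{k}$. On $\mathbb{H}^n$ the quaternionic inner product is $\langle x,y\rangle=\sum_{i=1}^n x_i\overline{y_i}$, with norm $\|x\|=\langle x,x\rangle^{1/2}$, and $\mathbb{S}^{4n-1}=\{x\in\mathbb{H}^n:\|x\|=1\}$. The sphere carries the Riemannian metric inherited from $\mathbb{R}^{4n}$, and $L^2(\mathbb{S}^{4n-1})$ (complex-valued functions) is taken with respect to the rotation-invariant measure. **Operators.** $\Delta_{\mathbb{S}^{4n-1}}$ is the Laplace–Beltrami operator on the sphere, with the sign making it nonnegative. For smooth $f$ on $\mathbb{S}^{4n-1}$ put $T_i f(x)=\frac{d}{dt}\big|_{t=0} f(\exp(-\mathbf{i}t)\,x)$, where the unit quaternion $\exp(-\mathbf{i}t)$ multiplies each coordinate of $x$ from the left, and define $T_j,T_k$ analogously with $\mathbf{j},\mathbf{k}$. Put $\Gamma=-(T_i^2+T_j^2+T_k^2)$. **Quaternionic spherical harmonics.** For $(h,m)\in I_{\mathbb{H}}$, $\mathcal{H}_{h,m}\subset L^2(\mathbb{S}^{4n-1})$ is the joint eigenspace $$\mathcal{H}_{h,m}=\{f\in C^\infty(\mathbb{S}^{4n-1}):\ \Delta_{\mathbb{S}^{4n-1}}f=h(h+4n-2)f,\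 \ \Gamma f=(h-2m)(h-2m+2)f\}.$$ It is known that these spaces are finite dimensional and pairwise orthogonal, and that $L^2(\mathbb{S}^{4n-1})$ is the Hilbert-space direct sum of the $\mathcal{H}_{h,m}$ over $(h,m)\in I_{\mathbb{H}}$. **Projections of measures.** $\pi_{h,m}:L^2(\mathbb{S}^{4n-1})\to\mathcal{H}_{h,m}$ is the orthogonal projection. It is an integral operator with continuous kernel $K_{h,m}(x,y)=\sum_l e_l(x)\overline{e_l(y)}$, where $(e_l)$ is any orthonormal basis of $\mathcal{H}_{h,m}$. It is extended to finite measures by $\pi_{h,m}\mu(x)=\int_{\mathbb{S}^{4n-1}}K_{h,m}(x,y)\,d\mu(y)$. **Lower Hausdorff dimension.** For $\mu\in M(\mathbb{S}^{4n-1})$, the space of finite complex-valued Borel measures, $$\dim_{\mathcal{H}}(\mu)=\inf\{\dim_{\mathcal{H}}(F):\ F\subset\mathbb{S}^{4n-1}\text{ Borel},\ \mu(F)\ne 0\},$$ where $\dim_{\mathcal{H}}(F)$ is the usual Hausdorff dimension of the set $F$ (and the infimum of the empty set is $+\infty$, so the inequality is trivial for $\mu=0$). *)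

theory Defs
  imports "HOL-Analysis.Analysis"
begin

section \<open>Quaternions\<close>

datatype quat = Quat (qRe: real) (qI: real) (qJ: real) (qK: real)

lemma quat_eq_iff: "x = y \<longleftrightarrow> qRe x = qRe y \<and> qI x = qI y \<and> qJ x = qJ y \<and> qK x = qK y"
  by (cases x; cases y) auto

instantiation quat :: ring_1
begin

definition zero_quat :: quat where
  "0 = Quat 0 0 0 0"

definition one_quat :: quat where
  "1 = Quat 1 0 0 0"

definition plus_quat :: "quat \<Rightarrow> quat \<Rightarrow> quat" where
  "x + y = Quat (qRe x + qRe y) (qI x + qI y) (qJ x + qJ y) (qK x + qK y)"

definition uminus_quat :: "quat \<Rightarrow> quat" where
  "- x = Quat (- qRe x) (- qI x) (- qJ x) (- qK x)"

definition minus_quat :: "quat \<Rightarrow> quat \<Rightarrow> quat" where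
  "x - y = Quat (qRe x - qRe y) (qI x - qI y) (qJ x - qJ y) (qK x - qK y)"

definition times_quat :: "quat \<Rightarrow> quat \<Rightarrow> quat" where
  "x * y = Quat
     (qRe x * qRe y - qI x * qI y - qJ x * qJ y - qK x * qK y)
     (qRe x * qI y + qI x * qRe y + qJ x * qK y - qK x * qJ y)
     (qRe x * qJ y - qI x * qK y + qJ x * qRe y + qK x * qI y)
     (qRe x * qK y + qI x * qJ y - qJ x * qI y + qK x * qRe y)"

instance
  by standard
    (simp_all add: quat_eq_iff zero_quat_def one_quat_def plus_quat_def uminus_quat_def
      minus_quat_def times_quat_def algebra_simps)

end

instantiation quat :: real_algebra_1
begin

definition scaleR_quat :: "real \<Rightarrow> quat \<Rightarrow> quat" where
  "r *\<^sub>R x = Quat (r * qRe x) (r * qI x) (r * qJ x) (r * qK x)"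

instance
  by standard
    (simp_all add: quat_eq_iff plus_quat_def times_quat_def scaleR_quat_def algebra_simps)

end

instantiation quat :: real_inner
begin

definition inner_quat :: "quat \<Rightarrow> quat \<Rightarrow> real" where
  "x \<bullet> y = qRe x * qRe y + qI x * qI y + qJ x * qJ y + qK x * qK y"

definition norm_quat :: "quat \<Rightarrow> real" where
  "norm x = sqrt ((qRe x)\<^sup>2 + (qI x)\<^sup>2 + (qJ x)\<^sup>2 + (qK x)\<^sup>2)"

definition sgn_quat :: "quat \<Rightarrow> quat" where
  "sgn (x :: quat) = x /\<^sub>R norm x"

definition dist_quat :: "quat \<Rightarrow> quat \<Rightarrow> real" where
  "dist (x :: quat) y = norm (x - y)"

definition uniformity_quat :: "(quat \<times> quat) filter" where
  "(uniformity :: (quat \<times> quat) filter) = (INF e\<in>{0<..}. principal {(x, y). dist x y < e})"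

definition open_quat :: "quat set \<Rightarrow> bool" where
  "open (U :: quat set) \<longleftrightarrow>
     (\<forall>x\<in>U. eventually (\<lambda>(x', y). x' = x \<longrightarrow> y \<in> U) uniformity)"

instance
proof
  fix x y z :: quat and r :: real and U :: "quat set"
  show "sgn x = x /\<^sub>R norm x" by (rule sgn_quat_def)
  show "dist x y = norm (x - y)" by (rule dist_quat_def)
  show "(uniformity :: (quat \<times> quat) filter)
          = (INF e\<in>{0<..}. principal {(x, y). dist x y < e})"
    by (rule uniformity_quat_def)
  show "open U \<longleftrightarrow> (\<forall>x\<in>U. eventually (\<lambda>(x', y). x' = x \<longrightarrow> y \<in> U) uniformity)"
    by (rule open_quat_def)
  show "x \<bullet> y = y \<bullet> x"
    by (simp add: inner_quat_def mult.commute)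
  show "(x + y) \<bullet> z = x \<bullet> z + y \<bullet> z"
    by (simp add: inner_quat_def plus_quat_def algebra_simps)
  show "(r *\<^sub>R x) \<bullet> y = r * (x \<bullet> y)"
    by (simp add: inner_quat_def scaleR_quat_def algebra_simps)
  show "0 \<le> x \<bullet> x"
    by (simp add: inner_quat_def)
  show "x \<bullet> x = 0 \<longleftrightarrow> x = 0"
    by (simp add: inner_quat_def quat_eq_iff zero_quat_def add_nonneg_eq_0_iff)
  show "norm x = sqrt (x \<bullet> x)"
    by (simp add: inner_quat_def norm_quat_def power2_eq_square)
qed

end

instance quat :: real_normed_algebra_1
proof
  fix x y :: quat
  have "norm (x * y) = norm x * norm y"
    unfolding norm_quat_def times_quat_def real_sqrt_mult [symmetric] quat.sel
    by (rule arg_cong [where f = sqrt]) (simp add: power2_eq_square algebra_simps)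
  then show "norm (x * y) \<le> norm x * norm y" by simp
  show "norm (1 :: quat) = 1"
    by (simp add: norm_quat_def one_quat_def)
qed

definition quat_i :: quat where "quat_i = Quat 0 1 0 0"
definition quat_j :: quat where "quat_j = Quat 0 0 1 0"
definition quat_k :: quat where "quat_k = Quat 0 0 0 1"

instantiation quat :: euclidean_space
begin

definition Basis_quat :: "quat set" where
  "Basis = {1, quat_i, quat_j, quat_k}"

instance
proof
  show "(Basis :: quat set) \<noteq> {}" "finite (Basis :: quat set)"
    by (simp_all add: Basis_quat_def)
  fix u v :: quat
  assume "u \<in> Basis" "v \<in> Basis"
  then show "u \<bullet> v = (if u = v then 1 else 0)"
    unfolding Basis_quat_def one_quat_def quat_i_def quat_j_def quat_k_def
    by (elim insertE emptyE) (simp_all add: inner_quat_def)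
next
  fix x :: quat
  show "(\<forall>u\<in>Basis. x \<bullet> u = 0) \<longleftrightarrow> x = 0"
    unfolding Basis_quat_def one_quat_def quat_i_def quat_j_def quat_k_def inner_quat_def
      zero_quat_def ball_simps
    by (cases x) simp
qed

end

definition quat_cnj :: "quat \<Rightarrow> quat" where
  "quat_cnj x = Quat (qRe x) (- qI x) (- qJ x) (- qK x)"

definition quat_inner :: "quat ^ 'n \<Rightarrow> quat ^ 'n \<Rightarrow> quat" where
  "quat_inner x y = (\<Sum>l\<in>UNIV. x $ l * quat_cnj (y $ l))"

text \<open>The library norm on \<^typ>\<open>quat ^ 'n\<close>, hence also \<^term>\<open>sphere 0 1\<close>, is the one given by the
  quaternionic inner product; as a real inner product space \<^typ>\<open>quat ^ 'n\<close> is Euclidean space of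
  dimension four times the number of coordinates.\<close>

lemma quat_inner_self: "quat_inner x x = of_real ((norm (x :: quat ^ 'n))\<^sup>2)"
proof -
  have "y * quat_cnj y = of_real ((norm y)\<^sup>2)" for y :: quat
    by (simp add: of_real_def quat_eq_iff times_quat_def quat_cnj_def scaleR_quat_def
        one_quat_def norm_quat_def power2_eq_square)
  moreover have "(norm x)\<^sup>2 = (\<Sum>l\<in>UNIV. (norm (x $ l))\<^sup>2)"
    by (simp add: norm_vec_def L2_set_def sum_nonneg)
  ultimately show ?thesis
    by (simp add: quat_inner_def)
qed

lemma DIM_quat_vec: "DIM(quat ^ 'n) = 4 * CARD('n)"
  by (simp add: Basis_quat_def one_quat_def quat_i_def quat_j_def quat_k_def)


section \<open>Smooth functions, rotation-invariant measure and Laplace--Beltrami operator on spheres\<close>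

fun Ck_on :: "nat \<Rightarrow> 'a::euclidean_space set \<Rightarrow> ('a \<Rightarrow> 'b::real_normed_vector) \<Rightarrow> bool" where
  "Ck_on 0 U f \<longleftrightarrow> continuous_on U f"
| "Ck_on (Suc k) U f \<longleftrightarrow>
     (\<forall>x\<in>U. f differentiable (at x)) \<and> (\<forall>v. Ck_on k U (\<lambda>x. frechet_derivative f (at x) v))"

definition smooth_on_sphere :: "('a::euclidean_space \<Rightarrow> complex) \<Rightarrow> bool" where
  "smooth_on_sphere f \<longleftrightarrow>
     (\<exists>U g. open U \<and> sphere 0 1 \<subseteq> U \<and> (\<forall>k. Ck_on k U g) \<and> (\<forall>x\<in>sphere 0 1. f x = g x))"

text \<open>The rotation-invariant measure is normalised to total mass one and realised as a Borel
  measure on the ambient space that is concentrated on the unit sphere: it is the image of the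
  uniform distribution on the unit ball under \<open>x \<mapsto> x / \<parallel>x\<parallel>\<close>. Rescaling it multiplies
  reproducing kernels by a positive constant.\<close>

definition sphere_measure :: "'a::euclidean_space measure" where
  "sphere_measure = distr (uniform_measure lborel (ball 0 1)) borel sgn"

definition L2_inner :: "('a::euclidean_space \<Rightarrow> complex) \<Rightarrow> ('a \<Rightarrow> complex) \<Rightarrow> complex" where
  "L2_inner f g = (\<integral>x. f x * cnj (g x) \<partial>sphere_measure)"

text \<open>The Riemannian Hessian on a unit tangent vector \<open>v\<close> at \<open>x\<close>: the second derivative along the
  unit speed geodesic (great circle) through \<open>x\<close> with velocity \<open>v\<close>.\<close>

definition sphere_hessian :: "('a::euclidean_space \<Rightarrow> complex) \<Rightarrow> 'a \<Rightarrow> 'a \<Rightarrow> complex" where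
  "sphere_hessian f x v =
     vector_derivative
       (\<lambda>t. vector_derivative (\<lambda>s. f (cos s *\<^sub>R x + sin s *\<^sub>R v)) (at t)) (at 0)"

definition tangent_onb :: "'a::euclidean_space \<Rightarrow> 'a set \<Rightarrow> bool" where
  "tangent_onb x B \<longleftrightarrow>
     pairwise orthogonal B \<and> (\<forall>v\<in>B. norm v = 1) \<and> span B = {v. v \<bullet> x = 0}"

text \<open>Minus the trace of the Hessian; for smooth functions the choice of basis is immaterial.\<close>

definition laplace_beltrami :: "('a::euclidean_space \<Rightarrow> complex) \<Rightarrow> 'a \<Rightarrow> complex" where
  "laplace_beltrami f x = - (\<Sum>v\<in>(SOME B. tangent_onb x B). sphere_hessian f x v)"


section \<open>Quaternionic spherical harmonics\<close>

text \<open>Here \<open>*s\<close> multiplies every coordinate from the left.\<close>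

definition T_op :: "quat \<Rightarrow> (quat ^ 'n \<Rightarrow> complex) \<Rightarrow> quat ^ 'n \<Rightarrow> complex" where
  "T_op u f x = vector_derivative (\<lambda>t. f (exp (- (t *\<^sub>R u)) *s x)) (at 0)"

definition Gamma_op :: "(quat ^ 'n \<Rightarrow> complex) \<Rightarrow> quat ^ 'n \<Rightarrow> complex" where
  "Gamma_op f x = - (T_op quat_i (T_op quat_i f) x + T_op quat_j (T_op quat_j f) x
                      + T_op quat_k (T_op quat_k f) x)"

definition index_set :: "(nat \<times> nat) set" where
  "index_set = {(h, m). 2 * m \<le> h}"

text \<open>Functions on the sphere are represented by functions on the ambient space that vanish off
  the sphere, so that equality of functions on the sphere is equality in HOL.\<close>

definition harmonics :: "nat \<Rightarrow> nat \<Rightarrow> (quat ^ 'n \<Rightarrow> complex) set" where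
  "harmonics h m = {f. smooth_on_sphere f \<and> (\<forall>x. x \<notin> sphere 0 1 \<longrightarrow> f x = 0) \<and>
     (\<forall>x\<in>sphere 0 1.
        laplace_beltrami f x = of_real (real h * (real h + 4 * real CARD('n) - 2)) * f x \<and>
        Gamma_op f x
          = of_real ((real h - 2 * real m) * (real h - 2 * real m + 2)) * f x)}"

definition orthonormal_basis ::
  "('a::euclidean_space \<Rightarrow> complex) set \<Rightarrow> ('a \<Rightarrow> complex) set \<Rightarrow> bool" where
  "orthonormal_basis H B \<longleftrightarrow> finite B \<and> B \<subseteq> H \<and>
     (\<forall>e\<in>B. \<forall>e'\<in>B. L2_inner e e' = (if e = e' then 1 else 0)) \<and>
     (\<forall>f\<in>H. \<exists>c. \<forall>x. f x = (\<Sum>e\<in>B. c e * e x))"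

text \<open>The kernel does not depend on the chosen orthonormal basis.\<close>

definition proj_kernel :: "nat \<Rightarrow> nat \<Rightarrow> quat ^ 'n \<Rightarrow> quat ^ 'n \<Rightarrow> complex" where
  "proj_kernel h m x y =
     (\<Sum>e\<in>(SOME B. orthonormal_basis (harmonics h m) B). e x * cnj (e y))"


section \<open>Complex measures\<close>

text \<open>A complex measure is a set function of which only the values on \<^term>\<open>sets M\<close> matter.
  Summability for all disjoint sequences forces the value zero on the empty set.\<close>

definition complex_measure :: "'a measure \<Rightarrow> ('a set \<Rightarrow> complex) \<Rightarrow> bool" where
  "complex_measure M \<mu> \<longleftrightarrow>
     (\<forall>A :: nat \<Rightarrow> 'a set. range A \<subseteq> sets M \<longrightarrow> disjoint_family A \<longrightarrow>
        (\<lambda>i. \<mu> (A i)) sums \<mu> (\<Union>i. A i))"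

text \<open>Upper variation \<open>\<nu>\<^sup>+\<close> of a real signed measure \<open>\<nu>\<close>. Negative values of \<open>\<nu>\<close> are
  truncated to zero, which is harmless because the empty set takes part in the supremum.\<close>

definition upper_variation :: "'a measure \<Rightarrow> ('a set \<Rightarrow> real) \<Rightarrow> 'a measure" where
  "upper_variation M \<nu> =
     measure_of (space M) (sets M) (\<lambda>A. SUP B\<in>{B \<in> sets M. B \<subseteq> A}. ennreal (\<nu> B))"

text \<open>Integration by Jordan decomposition of the real and imaginary part.\<close>

definition signed_integral ::
  "'a measure \<Rightarrow> ('a set \<Rightarrow> real) \<Rightarrow> ('a \<Rightarrow> complex) \<Rightarrow> complex" where
  "signed_integral M \<nu> f =
     (\<integral>x. f x \<partial>upper_variation M \<nu>) - (\<integral>x. f x \<partial>upper_variation M (\<lambda>A. - \<nu> A))"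

definition complex_integral ::
  "'a measure \<Rightarrow> ('a set \<Rightarrow> complex) \<Rightarrow> ('a \<Rightarrow> complex) \<Rightarrow> complex" where
  "complex_integral M \<mu> f =
     signed_integral M (\<lambda>A. Re (\<mu> A)) f + \<i> * signed_integral M (\<lambda>A. Im (\<mu> A)) f"

definition sphere_borel :: "'a::euclidean_space measure" where
  "sphere_borel = restrict_space borel (sphere 0 1)"

definition proj_measure ::
  "nat \<Rightarrow> nat \<Rightarrow> ((quat ^ 'n) set \<Rightarrow> complex) \<Rightarrow> quat ^ 'n \<Rightarrow> complex" where
  "proj_measure h m \<mu> x = complex_integral sphere_borel \<mu> (\<lambda>y. proj_kernel h m x y)"


section \<open>Hausdorff dimension\<close>

text \<open>Boundedness is required because \<^const>\<open>diameter\<close> is unspecified on unbounded sets.\<close>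

definition hausdorff_premeasure :: "real \<Rightarrow> real \<Rightarrow> 'a::metric_space set \<Rightarrow> ennreal" where
  "hausdorff_premeasure s \<delta> F =
     (INF A\<in>{A :: nat \<Rightarrow> 'a set. F \<subseteq> (\<Union>i. A i) \<and> (\<forall>i. bounded (A i) \<and> diameter (A i) \<le> \<delta>)}.
        \<Sum>i. ennreal (diameter (A i) powr s))"

definition hausdorff_measure :: "real \<Rightarrow> 'a::metric_space set \<Rightarrow> ennreal" where
  "hausdorff_measure s F = (SUP \<delta>\<in>{0<..}. hausdorff_premeasure s \<delta> F)"

text \<open>Only \<open>s > 0\<close> is used, which avoids the convention for the zeroth power of a zero
  diameter and does not change the infimum.\<close>

definition hausdorff_dim :: "'a::metric_space set \<Rightarrow> ereal" where
  "hausdorff_dim F = (INF s\<in>{s. 0 < s \<and> hausdorff_measure s F = 0}. ereal s)"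

definition lower_hausdorff_dim :: "'a::metric_space measure \<Rightarrow> ('a set \<Rightarrow> complex) \<Rightarrow> ereal" where
  "lower_hausdorff_dim M \<mu> = (INF F\<in>{F \<in> sets M. \<mu> F \<noteq> 0}. hausdorff_dim F)"


section \<open>The cone of indices\<close>

definition index_cone :: "real \<Rightarrow> (nat \<times> nat) set" where
  "index_cone \<epsilon> =
     {(h, m) \<in> index_set. 1 \<le> h \<and> \<bar>real m / real h - 1 / 2\<bar> < \<epsilon>}"

end

theory Submission
  imports Defs "HOL-Library.Function_Algebras"
begin

text \<open>The unit quaternions act on the sphere by left multiplication. The orbit of \<open>x\<close> is determined by the
  products of the conjugate of \<open>x\<^sub>i\<close> with \<open>x\<^sub>j\<close>, and every polynomial \<open>f\<close> in these products is annihilated by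
  the three operators \<open>T\<^sub>u\<close>. If \<open>g\<close> is a homogeneous polynomial with \<open>\<Gamma> g = k (k + 2) g\<close>, then so is \<open>f g\<close>
  for the same \<open>k\<close>, hence its spherical harmonic components lie in spaces with \<open>h - 2 m = k\<close>. Indices of this
  kind with large \<open>h\<close> belong to the cone and are not exceptional, so that only finitely many degrees
  contribute to the integral of \<open>f g\<close> against \<open>\<mu>\<close>, which is therefore at most a constant (depending on \<open>g\<close>)
  times the \<open>L\<^sup>1\<close> norm of \<open>f\<close> for the rotation-invariant measure. Letting \<open>f\<close> tend to the indicator function of a
  compact null set \<open>E\<close> that is a union of orbits, and \<open>g\<close> to that of a compact \<open>K \<subseteq> E\<close>, one gets
  \<open>\<mu> K = 0\<close>. Finally, if \<open>K\<close> is null for the Hausdorff measure of dimension at most \<open>4 n - 4\<close>, then the union \<open>E\<close>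
  of the orbits through \<open>K\<close> is null, because an orbit has dimension three.

  The projection kernels are meaningful since smooth eigenfunctions of the Laplace--Beltrami operator are
  harmonic polynomials: the operator is a sum of squares of generators of rotations, hence symmetric, and
  polynomials are dense.\<close>

section \<open>Jordan decomposition of complex measures\<close>

text \<open>The cone enters because \<open>h - 2 m = k\<close> gives
  \<open>m / h = 1/2 - k / (2 h)\<close>: on each such line of indices the ratio tends to 1/2, so
  all but finitely many of them lie in any given cone. Multiplication by an invariant
  \<open>f\<close> spreads \<open>g\<close> over many degrees but never leaves the line of
  \<open>g\<close>. A general test polynomial is not an eigenvector of \<Gamma>. It is split into
  finitely many eigenvectors by multiplying up one linear form at a time, as in the Clebsch--Gordan
  rule for tensoring with spin one half. The two limits cannot be merged, since there is no control
  over the constant in the bound as \<open>g\<close> varies: \<open>g\<close> stays fixed while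
  \<open>f\<close> tends to the indicator of \<open>E\<close>, and only the resulting identity,
  which is free of constants, is passed to the limit in \<open>g\<close>. The number 4n - 4 is the
  dimension of the quotient of the sphere by the action, the quaternionic projective space. An
  obstacle of its own is that \<open>proj_kernel\<close> selects an orthonormal basis by choice. The
  hypothesis on \<mu> says nothing before each space is known to have a finite basis, which is why
  eigenfunctions are first identified with polynomials.\<close>

definition signed_measure :: "'a measure \<Rightarrow> ('a set \<Rightarrow> real) \<Rightarrow> bool" where
  "signed_measure M \<nu> \<longleftrightarrow>
     (\<forall>A :: nat \<Rightarrow> 'a set. range A \<subseteq> sets M \<longrightarrow> disjoint_family A \<longrightarrow>
        (\<lambda>i. \<nu> (A i)) sums \<nu> (\<Union>i. A i))"

lemma signed_measure_sums:
  "signed_measure M \<nu> \<Longrightarrow> range A \<subseteq> sets M \<Longrightarrow> disjoint_family A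
    \<Longrightarrow> (\<lambda>i. \<nu> (A i)) sums \<nu> (\<Union>i. A i)"
  by (simp add: signed_measure_def)

lemma signed_measure_uminus: "signed_measure M \<nu> \<Longrightarrow> signed_measure M (\<lambda>A. - \<nu> A)"
  by (auto simp: signed_measure_def intro: sums_minus)

lemma signed_measure_empty:
  assumes "signed_measure M \<nu>" shows "\<nu> {} = 0"
proof -
  have "(\<lambda>i::nat. \<nu> {}) sums \<nu> (\<Union>i::nat. {})"
    by (rule signed_measure_sums[OF assms]) (auto simp: disjoint_family_on_def)
  then show ?thesis
    using sums_summable summable_const_iff by metis
qed

lemma signed_measure_Un:
  assumes "signed_measure M \<nu>" "A \<in> sets M" "B \<in> sets M" "A \<inter> B = {}"
  shows "\<nu> (A \<union> B) = \<nu> A + \<nu> B"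
proof -
  have "(\<lambda>i. \<nu> (binaryset A B i)) sums \<nu> (\<Union>i. binaryset A B i)"
    using assms by (intro signed_measure_sums[OF assms(1)])
      (auto simp: range_binaryset_eq disjoint_family_on_def binaryset_def)
  moreover have "(\<lambda>i. \<nu> (binaryset A B i)) sums (\<nu> A + \<nu> B)"
    unfolding sums_def by (rule LIMSEQ_binaryset) (rule signed_measure_empty[OF assms(1)])
  ultimately show ?thesis
    by (simp add: UN_binaryset_eq sums_iff)
qed

lemma signed_measure_Diff:
  assumes "signed_measure M \<nu>" "A \<in> sets M" "B \<in> sets M" "B \<subseteq> A"
  shows "\<nu> (A - B) = \<nu> A - \<nu> B"
proof -
  have "(A - B) \<inter> B = {}" "A - B \<union> B = A" using assms by auto
  then show ?thesis
    using signed_measure_Un[OF assms(1), of "A - B" B] assms by auto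
qed

text \<open>Coercion to \<open>ennreal\<close> cuts negative terms off at zero, which can only
  enlarge the partial sums.\<close>

lemma ennreal_sums_le:
  fixes f :: "nat \<Rightarrow> real"
  assumes "f sums s" shows "ennreal s \<le> (\<Sum>i. ennreal (f i))"
proof (rule LIMSEQ_le_const2)
  show "(\<lambda>n. ennreal (\<Sum>i<n. f i)) \<longlonglongrightarrow> ennreal s"
    using assms by (auto simp: sums_def intro: tendsto_ennrealI)
  have "ennreal (\<Sum>i<n. f i) \<le> (\<Sum>i<n. ennreal (f i))" for n
  proof -
    have "ennreal (\<Sum>i<n. f i) \<le> ennreal (\<Sum>i<n. max 0 (f i))"
      by (intro ennreal_leI sum_mono) auto
    also have "\<dots> = (\<Sum>i<n. ennreal (max 0 (f i)))"
      by (subst sum_ennreal) auto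
    also have "\<dots> = (\<Sum>i<n. ennreal (f i))"
      by (intro sum.cong) (auto simp: max_def ennreal_neg)
    finally show ?thesis .
  qed
  then show "\<exists>N. \<forall>n\<ge>N. ennreal (\<Sum>i<n. f i) \<le> (\<Sum>i. ennreal (f i))"
    by (meson order_trans sum_le_suminf[OF summableI] finite_lessThan zero_le)
qed

context
  fixes M :: "'a measure" and \<nu> :: "'a set \<Rightarrow> real"
  assumes sm: "signed_measure M \<nu>"
begin

text \<open>The set function behind \<open>upper_variation\<close>. Since \<open>measure_of\<close>
  falls back to the zero measure unless its argument is positive and countably additive, both
  properties are established before any value is computed.\<close>

private definition V where "V A = (SUP B\<in>{B \<in> sets M. B \<subseteq> A}. ennreal (\<nu> B))"

private lemma V_upper: "B \<in> sets M \<Longrightarrow> B \<subseteq> A \<Longrightarrow> ennreal (\<nu> B) \<le> V A"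
  unfolding V_def by (rule SUP_upper) auto

private lemma V_mono: "A \<subseteq> A' \<Longrightarrow> V A \<le> V A'"
  unfolding V_def by (rule SUP_subset_mono) auto

text \<open>Competitors in \<open>A\<close> and in \<open>A'\<close> are disjoint, so their values
  add up; a negative value counts as zero and leaves only the other one.\<close>

private lemma V_super:
  assumes "A \<inter> A' = {}" shows "V A + V A' \<le> V (A \<union> A')"
proof -
  have "ennreal (\<nu> B) + ennreal (\<nu> B') \<le> V (A \<union> A')"
    if "B \<in> sets M" "B \<subseteq> A" "B' \<in> sets M" "B' \<subseteq> A'" for B B'
  proof (cases "\<nu> B \<ge> 0 \<and> \<nu> B' \<ge> 0")
    case True
    moreover have "B \<inter> B' = {}" using that assms by auto
    ultimately have "ennreal (\<nu> B) + ennreal (\<nu> B') = ennreal (\<nu> (B \<union> B'))"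
      using that signed_measure_Un[OF sm, of B B'] by (subst ennreal_plus[symmetric]) auto
    also have "\<dots> \<le> V (A \<union> A')" using that by (intro V_upper) auto
    finally show ?thesis .
  next
    case False
    then have "ennreal (\<nu> B) = 0 \<or> ennreal (\<nu> B') = 0" by (auto simp: ennreal_neg)
    moreover have "ennreal (\<nu> B) \<le> V (A \<union> A')" "ennreal (\<nu> B') \<le> V (A \<union> A')"
      using that by (auto intro!: V_upper)
    ultimately show ?thesis by auto
  qed
  then have "ennreal (\<nu> B) + V A' \<le> V (A \<union> A')" if "B \<in> sets M" "B \<subseteq> A" for B
    using that unfolding V_def[of A']
    by (subst ennreal_SUP_add_right) (auto intro!: SUP_least)
  then show ?thesis unfolding V_def[of A]
    by (subst ennreal_SUP_add_left[symmetric]) (auto intro!: SUP_least)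
qed

private lemma V_sum_le:
  assumes "disjoint_family A"
  shows "(\<Sum>i<n. V (A i)) \<le> V (\<Union>i<(n::nat). A i)"
proof (induction n)
  case (Suc n)
  have "(\<Union>i<n. A i) \<inter> A n = {}"
    using assms by (auto simp: disjoint_family_on_def disjoint_iff) (metis less_irrefl)
  from V_super[OF this] have *: "V (\<Union>i<n. A i) + V (A n) \<le> V (\<Union>i<Suc n. A i)"
    by (simp add: lessThan_Suc Un_commute)
  have "(\<Sum>i<Suc n. V (A i)) \<le> V (\<Union>i<n. A i) + V (A n)"
    using Suc by (simp add: add_right_mono)
  also note *
  finally show ?case .
qed simp

text \<open>Superadditivity on finite unions bounds the sum by \<open>V\<close> of the union.
  Conversely, a competitor \<open>B\<close> splits into the pieces \<open>B \<inter> A i\<close>,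
  over which \<nu> is countably additive.\<close>

private lemma V_countably_additive: "countably_additive (sets M) V"
  unfolding countably_additive_def
proof (intro allI impI antisym)
  fix A :: "nat \<Rightarrow> 'a set"
  assume A: "range A \<subseteq> sets M" "disjoint_family A" "(\<Union>i. A i) \<in> sets M"
  show "(\<Sum>i. V (A i)) \<le> V (\<Union>i. A i)"
  proof (rule suminf_le_const[OF summableI])
    fix n show "(\<Sum>i<n. V (A i)) \<le> V (\<Union>i. A i)"
      using V_sum_le[OF A(2), of n] by (rule order_trans) (auto intro: V_mono)
  qed
  show "V (\<Union>i. A i) \<le> (\<Sum>i. V (A i))"
    unfolding V_def[of "\<Union>i. A i"]
  proof (rule SUP_least, clarify)
    fix B assume B: "B \<in> sets M" "B \<subseteq> (\<Union>i. A i)"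
    have "(\<lambda>i. \<nu> (B \<inter> A i)) sums \<nu> (\<Union>i. B \<inter> A i)"
      using A B by (intro signed_measure_sums[OF sm]) (auto simp: disjoint_family_on_def)
    then have "ennreal (\<nu> B) \<le> (\<Sum>i. ennreal (\<nu> (B \<inter> A i)))"
      using B by (auto dest!: ennreal_sums_le simp: Int_UN_distrib[symmetric] Int_absorb2)
    also have "\<dots> \<le> (\<Sum>i. V (A i))"
      using A B by (intro suminf_le summableI V_upper) auto
    finally show "ennreal (\<nu> B) \<le> (\<Sum>i. V (A i))" .
  qed
qed

lemma sets_upper_variation [simp]: "sets (upper_variation M \<nu>) = sets M"
  by (simp add: upper_variation_def)

lemma emeasure_upper_variation:
  assumes "A \<in> sets M"
  shows "emeasure (upper_variation M \<nu>) A = (SUP B\<in>{B \<in> sets M. B \<subseteq> A}. ennreal (\<nu> B))"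
proof -
  have "V {} = 0"
  proof -
    have "{B \<in> sets M. B \<subseteq> {}} = {{}}" by auto
    then show ?thesis using signed_measure_empty[OF sm] by (simp add: V_def)
  qed
  then have "positive (sets M) V" by (simp add: positive_def)
  then show ?thesis
    unfolding upper_variation_def
    using emeasure_measure_of_sigma[OF sets.sigma_algebra_axioms _ V_countably_additive assms]
    by (simp add: V_def[abs_def])
qed

lemma signed_le_upper_variation:
  assumes "A \<in> sets M" "B \<in> sets M" "B \<subseteq> A"
  shows "ennreal (\<nu> B) \<le> emeasure (upper_variation M \<nu>) A"
  using assms by (auto simp: emeasure_upper_variation intro!: SUP_upper)

text \<open>A subset \<open>B\<close> with very large \<nu> is cut off. One of \<open>B\<close> and
  \<open>A - B\<close> keeps infinite variation, and the other one is discarded.\<close>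

private lemma infinite_split:
  assumes A: "A \<in> sets M" "emeasure (upper_variation M \<nu>) A = \<infinity>"
  shows "\<exists>A'. A' \<in> sets M \<and> emeasure (upper_variation M \<nu>) A' = \<infinity> \<and> A' \<subseteq> A \<and> \<bar>\<nu> (A - A')\<bar> \<ge> 1"
proof -
  \<comment> \<open>This threshold forces both \<nu> of \<open>B\<close> and \<nu> of
    \<open>A - B\<close> to be at least 1 in absolute value, whichever is discarded.\<close>
  have "ennreal (\<bar>\<nu> A\<bar> + 1) < emeasure (upper_variation M \<nu>) A"
    using A by simp
  then obtain B where B: "B \<in> sets M" "B \<subseteq> A" "ennreal (\<bar>\<nu> A\<bar> + 1) < ennreal (\<nu> B)"
    unfolding emeasure_upper_variation[OF A(1)] less_SUP_iff by blast
  then have *: "\<nu> B > \<bar>\<nu> A\<bar> + 1"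
    by (subst (asm) ennreal_less_iff) auto
  have d: "\<nu> (A - B) = \<nu> A - \<nu> B" by (rule signed_measure_Diff[OF sm A(1) B(1,2)])
  have "emeasure (upper_variation M \<nu>) A
      = emeasure (upper_variation M \<nu>) B + emeasure (upper_variation M \<nu>) (A - B)"
    using A B by (subst plus_emeasure) (auto simp: Un_absorb1)
  then have "emeasure (upper_variation M \<nu>) B = \<infinity> \<or> emeasure (upper_variation M \<nu>) (A - B) = \<infinity>"
    using A by (metis ennreal_add_eq_top infinity_ennreal_def)
  then show ?thesis
  proof
    assume "emeasure (upper_variation M \<nu>) B = \<infinity>"
    then show ?thesis using B * d by (intro exI[of _ B]) auto
  next
    assume "emeasure (upper_variation M \<nu>) (A - B) = \<infinity>"
    moreover have "A - (A - B) = B" using B by auto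
    ultimately show ?thesis using A B * by (intro exI[of _ "A - B"]) auto
  qed
qed

text \<open>Otherwise \<open>infinite_split\<close> iterates to a decreasing sequence whose
  successive differences are disjoint and have \<nu> of absolute value at least 1, although \<nu> is
  summable over them.\<close>

lemma finite_measure_upper_variation: "finite_measure (upper_variation M \<nu>)"
proof (rule ccontr)
  let ?P = "\<lambda>A. A \<in> sets M \<and> emeasure (upper_variation M \<nu>) A = \<infinity>"
  have sp: "space (upper_variation M \<nu>) = space M"
    by (rule sets_eq_imp_space_eq) simp
  assume "\<not> ?thesis"
  then have "?P (space M)"
    using finite_measureI[of "upper_variation M \<nu>"] sp by (auto simp: infinity_ennreal_def)
  then have "\<exists>A. \<forall>n. ?P (A n) \<and> (A (Suc n) \<subseteq> A n \<and> \<bar>\<nu> (A n - A (Suc n))\<bar> \<ge> 1)"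
    by (intro dependent_nat_choice[of "\<lambda>_. ?P" "\<lambda>_ A A'. A' \<subseteq> A \<and> \<bar>\<nu> (A - A')\<bar> \<ge> 1"])
      (use infinite_split in blast)+
  then obtain A where A: "\<And>n. ?P (A n)" "\<And>n. A (Suc n) \<subseteq> A n \<and> \<bar>\<nu> (A n - A (Suc n))\<bar> \<ge> 1"
    by auto
  have dec: "A n \<subseteq> A m" if "m \<le> n" for m n
    using lift_Suc_antimono_le[of A m n] A(2) that by blast
  have disj: "(A m - A (Suc m)) \<inter> (A n - A (Suc n)) = {}" if "m < n" for m n
    using dec[of "Suc m" n] that by auto
  have "disjoint_family (\<lambda>n. A n - A (Suc n))"
    unfolding disjoint_family_on_def
  proof (intro ballI impI)
    fix m n :: nat assume "m \<noteq> n"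
    then show "(A m - A (Suc m)) \<inter> (A n - A (Suc n)) = {}"
      using disj[of m n] disj[of n m] by (cases m n rule: linorder_cases) auto
  qed
  then have "(\<lambda>n. \<nu> (A n - A (Suc n))) sums \<nu> (\<Union>n. A n - A (Suc n))"
    using A by (intro signed_measure_sums[OF sm]) auto
  then have "(\<lambda>n. \<nu> (A n - A (Suc n))) \<longlonglongrightarrow> 0"
    by (auto intro: summable_LIMSEQ_zero sums_summable)
  from tendstoD[OF this, of 1] have "eventually (\<lambda>n. \<bar>\<nu> (A n - A (Suc n))\<bar> < 1) sequentially"
    by (simp add: dist_real_def)
  then obtain n where "\<bar>\<nu> (A n - A (Suc n))\<bar> < 1"
    by (auto simp: eventually_sequentially)
  then show False using A(2)[of n] by simp
qed

end

text \<open>For a competitor \<open>B\<close> the value is \<nu> of \<open>A\<close> minus \<nu> of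
  \<open>A - B\<close>, and the latter is controlled by the variation of the negated measure. Used
  for \<nu> and for its negative, this gives the Jordan decomposition.\<close>

lemma upper_variation_le:
  assumes sm: "signed_measure M \<nu>" and A: "A \<in> sets M"
  shows "measure (upper_variation M \<nu>) A \<le> \<nu> A + measure (upper_variation M (\<lambda>A. - \<nu> A)) A"
proof -
  let ?v = "measure (upper_variation M (\<lambda>A. - \<nu> A)) A"
  interpret U: finite_measure "upper_variation M \<nu>"
    by (rule finite_measure_upper_variation[OF sm])
  interpret U': finite_measure "upper_variation M (\<lambda>A. - \<nu> A)"
    by (rule finite_measure_upper_variation[OF signed_measure_uminus[OF sm]])
  have *: "\<nu> B \<le> \<nu> A + ?v" if "B \<in> sets M" "B \<subseteq> A" for B
  proof -
    have "ennreal (- \<nu> (A - B)) \<le> ennreal ?v"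
      using signed_le_upper_variation[OF signed_measure_uminus[OF sm] A, of "A - B"] that A
      by (auto simp: U'.emeasure_eq_measure)
    then have "- \<nu> (A - B) \<le> ?v" by (subst (asm) ennreal_le_iff) auto
    then show ?thesis using signed_measure_Diff[OF sm A that] by simp
  qed
  have "emeasure (upper_variation M \<nu>) A \<le> ennreal (\<nu> A + ?v)"
    unfolding emeasure_upper_variation[OF sm A]
    by (rule SUP_least) (auto intro!: ennreal_leI *)
  moreover have "0 \<le> \<nu> A + ?v"
    using *[of "{}"] signed_measure_empty[OF sm] by auto
  ultimately show ?thesis by (simp add: U.emeasure_eq_measure)
qed

lemma Jordan_decomposition:
  assumes sm: "signed_measure M \<nu>" and A: "A \<in> sets M"
  shows "\<nu> A = measure (upper_variation M \<nu>) A - measure (upper_variation M (\<lambda>A. - \<nu> A)) A"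
  using upper_variation_le[OF sm A] upper_variation_le[OF signed_measure_uminus[OF sm] A] by simp

lemma complex_measure_parts:
  assumes "complex_measure M \<mu>"
  shows "signed_measure M (\<lambda>A. Re (\<mu> A))" "signed_measure M (\<lambda>A. Im (\<mu> A))"
  using assms by (auto simp: complex_measure_def signed_measure_def intro: sums_Re sums_Im)

section \<open>Rotation invariance of the measure on the sphere\<close>

lemma nn_integral_lborel_reflect_translate:
  fixes f :: "'a::euclidean_space \<Rightarrow> ennreal"
  assumes f: "f \<in> borel_measurable borel" and c: "\<bar>c\<bar> = 1"
  shows "(\<integral>\<^sup>+x. f (t + c *\<^sub>R x) \<partial>lborel) = (\<integral>\<^sup>+x. f x \<partial>lborel)"
proof -
  have "c \<noteq> 0" using c by auto
  from lborel_affine[OF this, of t] c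
  have "(lborel :: 'a measure) = distr lborel borel (\<lambda>x. t + c *\<^sub>R x)"
    by (simp add: density_1)
  then have "(\<integral>\<^sup>+x. f x \<partial>lborel) = (\<integral>\<^sup>+x. f x \<partial>distr lborel borel (\<lambda>x. t + c *\<^sub>R x))"
    by simp
  also have "\<dots> = (\<integral>\<^sup>+x. f (t + c *\<^sub>R x) \<partial>lborel)"
    using f by (subst nn_integral_distr) auto
  finally show ?thesis by simp
qed

text \<open>Uniqueness of Haar measure: both sides equal the integral of \<open>1\<^sub>A x * 1\<^sub>B (x + y)\<close>.\<close>

lemma translation_invariant_measure_swap:
  fixes M :: "'a::euclidean_space measure"
  assumes sets: "sets M = sets borel" and sf: "sigma_finite_measure M"
    and inv: "\<And>c. distr M borel ((+) c) = M"
    and A: "A \<in> sets borel" and B: "B \<in> sets borel"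
  shows "emeasure M A * emeasure lborel B = emeasure M B * emeasure lborel A"
proof -
  interpret M: sigma_finite_measure M by fact
  interpret pair_sigma_finite M lborel ..
  note [measurable_cong] = sets
  have [measurable]: "A \<in> sets borel" "B \<in> sets borel" by fact+
  have M_trans: "(\<integral>\<^sup>+x. f (c + x) \<partial>M) = (\<integral>\<^sup>+x. f x \<partial>M)"
    if "f \<in> borel_measurable borel" for f :: "'a \<Rightarrow> ennreal" and c
    using nn_integral_distr[of "(+) c" M borel f] that inv[of c] by simp
  have "emeasure M A * emeasure lborel B
      = (\<integral>\<^sup>+x. indicator A x * emeasure lborel B \<partial>M)"
    by (simp add: nn_integral_multc sets)
  also have "\<dots> = (\<integral>\<^sup>+x. \<integral>\<^sup>+y. indicator A x * indicator B (x + y) \<partial>lborel \<partial>M)"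
  proof (rule nn_integral_cong)
    fix x
    have "emeasure lborel B = (\<integral>\<^sup>+y. indicator B (x + y) \<partial>lborel)"
      using nn_integral_lborel_reflect_translate[of "indicator B" 1 x] by simp
    then show "indicator A x * emeasure lborel B
        = (\<integral>\<^sup>+y. indicator A x * indicator B (x + y) \<partial>lborel)"
      by (subst nn_integral_cmult) auto
  qed
  also have "\<dots> = (\<integral>\<^sup>+y. \<integral>\<^sup>+x. indicator A x * indicator B (x + y) \<partial>M \<partial>lborel)"
    by (rule Fubini'[symmetric]) measurable
  also have "\<dots> = (\<integral>\<^sup>+y. \<integral>\<^sup>+x. indicator A (x - y) * indicator B x \<partial>M \<partial>lborel)"
  proof (rule nn_integral_cong)
    fix y
    show "(\<integral>\<^sup>+x. indicator A x * indicator B (x + y) \<partial>M)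
        = (\<integral>\<^sup>+x. indicator A (x - y) * indicator B x \<partial>M)"
      using M_trans[of "\<lambda>x. indicator A x * indicator B (x + y)" "- y"] by simp
  qed
  also have "\<dots> = (\<integral>\<^sup>+x. \<integral>\<^sup>+y. indicator A (x - y) * indicator B x \<partial>lborel \<partial>M)"
    by (rule Fubini') measurable
  also have "\<dots> = (\<integral>\<^sup>+x. emeasure lborel A * indicator B x \<partial>M)"
  proof (rule nn_integral_cong)
    fix x
    have "emeasure lborel A = (\<integral>\<^sup>+y. indicator A (x - y) \<partial>lborel)"
      using nn_integral_lborel_reflect_translate[of "indicator A" "-1" x] by simp
    then show "(\<integral>\<^sup>+y. indicator A (x - y) * indicator B x \<partial>lborel) = emeasure lborel A * indicator B x"
      by (subst nn_integral_multc) auto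
  qed
  also have "\<dots> = emeasure M B * emeasure lborel A"
    by (subst nn_integral_cmult) (auto simp: sets mult.commute)
  finally show ?thesis .
qed

definition isometry_lin :: "('a::euclidean_space \<Rightarrow> 'a) \<Rightarrow> bool" where
  "isometry_lin R \<longleftrightarrow> linear R \<and> (\<forall>x. norm (R x) = norm x)"

lemma isometry_linD:
  assumes "isometry_lin R"
  shows "linear R" "norm (R x) = norm x" "R \<in> borel_measurable borel" "bij R"
proof -
  show lin: "linear R" and "norm (R x) = norm x" using assms by (auto simp: isometry_lin_def)
  show "R \<in> borel_measurable borel"
    using lin by (intro borel_measurable_continuous_onI linear_continuous_on)
      (simp add: linear_conv_bounded_linear)
  have "orthogonal_transformation R"
    using assms by (simp add: isometry_lin_def orthogonal_transformation)
  then show "bij R" by (rule orthogonal_transformation_bij)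
qed

lemma emeasure_lborel_unit_ball:
  "emeasure lborel (ball (0::'a::euclidean_space) 1) \<noteq> 0"
  "emeasure lborel (ball (0::'a::euclidean_space) 1) \<noteq> \<infinity>"
proof -
  have "emeasure lborel (ball (0::'a) 1) = ennreal (measure lborel (ball (0::'a) 1))"
    using emeasure_lborel_ball_finite[of "0::'a" 1] by (subst emeasure_eq_ennreal_measure) auto
  then show "emeasure lborel (ball (0::'a::euclidean_space) 1) \<noteq> 0"
    using content_ball_pos[of 1 "0::'a"] by simp
qed (use emeasure_lborel_ball_finite[of "0::'a" 1] in auto)

text \<open>The image measure is again translation invariant, hence proportional to Lebesgue
  measure; the factor is 1 because \<open>R\<close> preserves the unit ball.\<close>

lemma lborel_isometry:
  fixes R :: "'a::euclidean_space \<Rightarrow> 'a"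
  assumes R: "isometry_lin R"
  shows "distr lborel borel R = lborel"
proof -
  note [measurable] = isometry_linD(3)[OF R]
  let ?M = "distr lborel borel R"
  have vball: "R -` ball 0 r = ball 0 r" for r
    by (auto simp: isometry_linD(2)[OF R])
  have Mball: "emeasure ?M (ball 0 r) = emeasure lborel (ball (0::'a) r)" for r
    by (subst emeasure_distr) (auto simp: vball)
  have sf: "sigma_finite_measure ?M"
  proof
    show "\<exists>A. countable A \<and> A \<subseteq> sets ?M \<and> \<Union> A = space ?M \<and> (\<forall>a\<in>A. emeasure ?M a \<noteq> \<infinity>)"
    proof (intro exI conjI ballI)
      show "countable (range (\<lambda>n. ball (0::'a) (real n)))" by simp
      show "range (\<lambda>n. ball (0::'a) (real n)) \<subseteq> sets ?M" by auto
      show "\<Union> (range (\<lambda>n. ball (0::'a) (real n))) = space ?M"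
        by (auto simp: reals_Archimedean2)
      fix a assume "a \<in> range (\<lambda>n. ball (0::'a) (real n))"
      then show "emeasure ?M a \<noteq> \<infinity>"
        using emeasure_lborel_ball_finite[of "0::'a"] by (auto simp: Mball less_top)
    qed
  qed
  have inv: "distr ?M borel ((+) c) = ?M" for c
  proof -
    obtain d where d: "R d = c" using isometry_linD(4)[OF R] by (metis bij_pointE)
    have "distr ?M borel ((+) c) = distr lborel borel (\<lambda>x. R (d + x))"
      using d by (simp add: distr_distr comp_def linear_add[OF isometry_linD(1)[OF R]])
    also have "\<dots> = distr (distr lborel borel ((+) d)) borel R"
      by (subst distr_distr) (auto simp: comp_def)
    finally show ?thesis by (simp add: lborel_distr_plus)
  qed
  show ?thesis
  proof (rule measure_eqI)
    fix A assume "A \<in> sets ?M"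
    then have "emeasure ?M A * emeasure lborel (ball (0::'a) 1)
        = emeasure lborel A * emeasure lborel (ball (0::'a) 1)"
      using translation_invariant_measure_swap[OF _ sf inv, of A "ball 0 1"]
      by (simp add: Mball mult.commute)
    then show "emeasure ?M A = emeasure lborel A"
      using emeasure_lborel_unit_ball[where 'a='a]
      by (metis ennreal_mult_cancel_left infinity_ennreal_def mult.commute)
  qed simp
qed

lemma sets_sphere_measure [simp, measurable_cong]: "sets sphere_measure = sets borel"
  and space_sphere_measure [simp]: "space sphere_measure = UNIV"
  by (auto simp: sphere_measure_def)

lemma borel_measurable_sgn_euclidean [measurable]:
  "sgn \<in> borel_measurable (borel :: 'a::euclidean_space measure)"
  unfolding sgn_div_norm[abs_def] by measurable

lemma emeasure_sphere_measure:
  fixes A :: "'a::euclidean_space set"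
  assumes [measurable]: "A \<in> sets borel"
  shows "emeasure sphere_measure A
      = emeasure lborel (ball 0 1 \<inter> sgn -` A) / emeasure lborel (ball (0::'a) 1)"
proof -
  have m: "sgn -` A \<in> sets (borel :: 'a measure)"
    using measurable_sets[OF borel_measurable_sgn_euclidean assms] by simp
  have "emeasure sphere_measure A = emeasure (uniform_measure lborel (ball 0 1)) (sgn -` A)"
    unfolding sphere_measure_def by (subst emeasure_distr) auto
  also have "\<dots> = emeasure lborel (ball 0 1 \<inter> sgn -` A) / emeasure lborel (ball (0::'a) 1)"
    using m by (subst emeasure_uniform_measure) auto
  finally show ?thesis .
qed

lemma finite_measure_sphere_measure: "finite_measure (sphere_measure :: 'a::euclidean_space measure)"
  by (rule finite_measureI) (use emeasure_lborel_unit_ball[where 'a='a] in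
      \<open>simp add: emeasure_sphere_measure ennreal_divide_self less_top[symmetric]\<close>)

lemma AE_sphere_measure: "AE x in sphere_measure. x \<in> sphere (0::'a::euclidean_space) 1"
proof (rule AE_I)
  show "emeasure sphere_measure (- sphere (0::'a) 1) = 0"
  proof -
    \<comment> \<open>\<open>sgn 0 = 0\<close> is the only value of \<open>sgn\<close> off the
      sphere.\<close>
    have "ball (0::'a) 1 \<inter> sgn -` (- sphere 0 1) = {0}"
      by (auto simp: norm_sgn split: if_splits)
    then show ?thesis by (subst emeasure_sphere_measure) auto
  qed
qed auto

lemma sphere_measure_isometry:
  fixes R :: "'a::euclidean_space \<Rightarrow> 'a"
  assumes R: "isometry_lin R"
  shows "distr sphere_measure borel R = sphere_measure"
proof (rule measure_eqI)
  note [measurable] = isometry_linD(3)[OF R]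
  fix A assume "A \<in> sets (distr sphere_measure borel R)"
  then have A [measurable]: "A \<in> sets borel" by simp
  have RA: "R -` A \<in> sets borel" using measurable_sets[OF isometry_linD(3)[OF R] A] by simp
  have sgnA: "sgn -` A \<in> sets (borel :: 'a measure)"
    using measurable_sets[OF borel_measurable_sgn_euclidean A] by simp
  have sgnR: "sgn (R x) = R (sgn x)" for x
    by (simp add: sgn_div_norm isometry_linD(2)[OF R] linear_scale[OF isometry_linD(1)[OF R]])
  have eq: "ball 0 1 \<inter> sgn -` (R -` A) = R -` (ball 0 1 \<inter> sgn -` A)"
    by (auto simp: sgnR isometry_linD(2)[OF R])
  have "emeasure (distr sphere_measure borel R) A = emeasure sphere_measure (R -` A)"
    by (subst emeasure_distr) auto
  also have "\<dots> = emeasure lborel (R -` (ball 0 1 \<inter> sgn -` A)) / emeasure lborel (ball (0::'a) 1)"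
    using RA by (simp add: emeasure_sphere_measure eq)
  also have "emeasure lborel (R -` (ball 0 1 \<inter> sgn -` A))
      = emeasure (distr lborel borel R) (ball 0 1 \<inter> sgn -` A)"
    using sgnA by (subst emeasure_distr) auto
  also have "\<dots> = emeasure lborel (ball 0 1 \<inter> sgn -` A)"
    by (simp add: lborel_isometry[OF R])
  finally show "emeasure (distr sphere_measure borel R) A = emeasure sphere_measure A"
    by (simp add: emeasure_sphere_measure)
qed simp

lemma integral_sphere_measure_isometry:
  fixes f :: "'a::euclidean_space \<Rightarrow> 'b::{banach,second_countable_topology}"
  assumes R: "isometry_lin R" and f: "f \<in> borel_measurable borel"
  shows "(\<integral>x. f (R x) \<partial>sphere_measure) = (\<integral>x. f x \<partial>sphere_measure)"
  using integral_distr[of R sphere_measure borel f] f isometry_linD(3)[OF R]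
  by (simp add: sphere_measure_isometry[OF R] measurable_cong_sets[OF sets_sphere_measure refl])

text \<open>The cone over a small cap contains a ball around \<open>x /\<^sub>R 2\<close>. Full
  support of the measure is what makes \<open>L2_inner\<close> definite on continuous
  functions.\<close>

lemma emeasure_sphere_measure_ball:
  fixes x :: "'a::euclidean_space"
  assumes x: "norm x = 1" and r: "r > 0"
  shows "emeasure sphere_measure (ball x r) \<noteq> 0"
proof
  assume 0: "emeasure sphere_measure (ball x r) = 0"
  let ?U = "ball (0::'a) 1 \<inter> sgn -` ball x r"
  have sgnA: "sgn -` ball x r \<in> sets (borel :: 'a measure)"
    using measurable_sets[OF borel_measurable_sgn_euclidean borel_open[OF open_ball]] by simp
  have null: "emeasure lborel ?U = 0"
    using 0 emeasure_lborel_unit_ball[where 'a='a]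
    by (auto simp: emeasure_sphere_measure ennreal_divide_eq_0_iff)
  \<comment> \<open>The midpoint lies inside the unit ball and away from the origin, where
    \<open>sgn\<close> is discontinuous.\<close>
  have "isCont sgn (x /\<^sub>R 2)" using x by (intro isCont_sgn) auto
  moreover have "sgn (x /\<^sub>R 2) = x" using x by (simp add: sgn_div_norm)
  ultimately obtain d where d: "d > 0" "\<And>y. dist y (x /\<^sub>R 2) < d \<Longrightarrow> dist (sgn y) x < r"
    using r unfolding continuous_at_eps_delta by metis
  have "ball (x /\<^sub>R 2) (min d (1/2)) \<subseteq> ?U"
  proof
    fix y assume y: "y \<in> ball (x /\<^sub>R 2) (min d (1/2))"
    then have "norm (y - x /\<^sub>R 2) < 1/2" by (simp add: dist_norm norm_minus_commute)
    then have "norm y < 1" using x norm_triangle_ineq[of "y - x /\<^sub>R 2" "x /\<^sub>R 2"] by simp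
    then show "y \<in> ?U" using y d(2)[of y] by (simp add: dist_commute)
  qed
  then have "emeasure lborel (ball (x /\<^sub>R 2) (min d (1/2))) \<le> emeasure lborel ?U"
    using sgnA by (intro emeasure_mono) auto
  then have "emeasure lborel (ball (x /\<^sub>R 2) (min d (1/2))) = 0" using null by simp
  moreover have "measure lborel (ball (x /\<^sub>R 2) (min d (1/2))) > 0" using d by (intro content_ball_pos) auto
  ultimately show False by (simp add: measure_def)
qed

section \<open>Square-integrable functions on the sphere\<close>

text \<open>Vanishing off the sphere follows the convention of \<open>harmonics\<close> and makes
  these functions Borel measurable on the whole space.\<close>

definition sphere_cont :: "('a::euclidean_space \<Rightarrow> complex) \<Rightarrow> bool" where
  "sphere_cont f \<longleftrightarrow> continuous_on (sphere 0 1) f \<and> (\<forall>x. x \<notin> sphere 0 1 \<longrightarrow> f x = 0)"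

definition restr :: "('a::euclidean_space \<Rightarrow> complex) \<Rightarrow> 'a \<Rightarrow> complex" where
  "restr p = (\<lambda>x. if x \<in> sphere 0 1 then p x else 0)"

lemma restr_on: "x \<in> sphere 0 1 \<Longrightarrow> restr p x = p x"
  and restr_off: "x \<notin> sphere 0 1 \<Longrightarrow> restr p x = 0"
  by (simp_all add: restr_def)

lemma sphere_cont_restr: "continuous_on (sphere 0 1) p \<Longrightarrow> sphere_cont (restr p)"
  unfolding sphere_cont_def restr_def
  by (auto intro: continuous_on_eq)

lemma sphere_cont_0: "sphere_cont (\<lambda>x. 0)"
  and sphere_cont_add: "sphere_cont f \<Longrightarrow> sphere_cont g \<Longrightarrow> sphere_cont (\<lambda>x. f x + g x)"
  and sphere_cont_diff: "sphere_cont f \<Longrightarrow> sphere_cont g \<Longrightarrow> sphere_cont (\<lambda>x. f x - g x)"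
  and sphere_cont_cmult: "sphere_cont f \<Longrightarrow> sphere_cont (\<lambda>x. c * f x)"
  and sphere_cont_mult: "sphere_cont f \<Longrightarrow> sphere_cont g \<Longrightarrow> sphere_cont (\<lambda>x. f x * g x)"
  and sphere_cont_cnj: "sphere_cont f \<Longrightarrow> sphere_cont (\<lambda>x. cnj (f x))"
  by (auto simp: sphere_cont_def intro!: continuous_intros)

lemma sphere_cont_sum: "(\<And>i. i \<in> I \<Longrightarrow> sphere_cont (f i)) \<Longrightarrow> sphere_cont (\<lambda>x. \<Sum>i\<in>I. f i x)"
  by (induction I rule: infinite_finite_induct) (auto intro: sphere_cont_0 sphere_cont_add)

lemma sphere_cont_measurable:
  fixes f :: "'a::euclidean_space \<Rightarrow> complex"
  assumes "sphere_cont f" shows "f \<in> borel_measurable borel"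
proof -
  have "(\<lambda>x. indicator (sphere 0 1) x *\<^sub>R f x) \<in> borel_measurable borel"
    using assms by (intro borel_measurable_continuous_on_indicator) (auto simp: sphere_cont_def)
  moreover have "(\<lambda>x. indicator (sphere 0 1) x *\<^sub>R f x) = f"
    using assms by (auto simp: sphere_cont_def fun_eq_iff indicator_def)
  ultimately show ?thesis by simp
qed

lemma sphere_cont_bounded:
  fixes f :: "'a::euclidean_space \<Rightarrow> complex"
  assumes "sphere_cont f" obtains C where "C \<ge> 0" "\<And>x. norm (f x) \<le> C"
proof -
  have "compact (f ` sphere 0 1)"
    using assms by (intro compact_continuous_image) (auto simp: sphere_cont_def)
  then obtain C where C: "\<And>x. x \<in> sphere 0 1 \<Longrightarrow> norm (f x) \<le> C"
    using compact_imp_bounded[THEN iffD1[OF bounded_iff]] by (metis image_eqI)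
  have "norm (f x) \<le> max C 0" for x
    using C[of x] assms by (cases "x \<in> sphere 0 1") (auto simp: sphere_cont_def)
  then show ?thesis using that[of "max C 0"] by auto
qed

lemma integrable_sphere_cont:
  assumes "sphere_cont f" shows "integrable sphere_measure f"
proof -
  interpret finite_measure "sphere_measure :: 'a measure" by (rule finite_measure_sphere_measure)
  obtain C where "\<And>x. norm (f x) \<le> C" using sphere_cont_bounded[OF assms] by blast
  then show ?thesis
    using sphere_cont_measurable[OF assms] by (intro integrable_const_bound[of _ C]) auto
qed

lemma L2_inner_integrable:
  assumes "sphere_cont f" "sphere_cont g"
  shows "integrable sphere_measure (\<lambda>x. f x * cnj (g x))"
  using assms by (intro integrable_sphere_cont sphere_cont_mult sphere_cont_cnj)

lemma L2_inner_add_left: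
  assumes "sphere_cont f" "sphere_cont g" "sphere_cont h"
  shows "L2_inner (\<lambda>x. f x + g x) h = L2_inner f h + L2_inner g h"
  using assms by (simp add: L2_inner_def ring_distribs L2_inner_integrable)

lemma L2_inner_diff_left:
  assumes "sphere_cont f" "sphere_cont g" "sphere_cont h"
  shows "L2_inner (\<lambda>x. f x - g x) h = L2_inner f h - L2_inner g h"
  using assms by (simp add: L2_inner_def ring_distribs L2_inner_integrable)

lemma L2_inner_cmult_left: "L2_inner (\<lambda>x. c * f x) h = c * L2_inner f h"
  by (simp add: L2_inner_def mult.assoc)

lemma L2_inner_cnj: "L2_inner g f = cnj (L2_inner f g)"
proof -
  have "cnj (L2_inner f g) = (\<integral>x. cnj (f x * cnj (g x)) \<partial>sphere_measure)"
    unfolding L2_inner_def by (rule Bochner_Integration.integral_cnj[symmetric])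
  then show ?thesis by (simp add: L2_inner_def mult.commute)
qed

lemma L2_inner_0_left: "L2_inner (\<lambda>x. 0) h = 0"
  by (simp add: L2_inner_def)

lemma L2_inner_sum_left:
  assumes "\<And>i. i \<in> I \<Longrightarrow> sphere_cont (f i)" "sphere_cont h"
  shows "L2_inner (\<lambda>x. \<Sum>i\<in>I. f i x) h = (\<Sum>i\<in>I. L2_inner (f i) h)"
  using assms
  by (induction I rule: infinite_finite_induct)
    (auto simp: L2_inner_0_left L2_inner_add_left sphere_cont_sum)

lemma L2_inner_self: "L2_inner f f = of_real (\<integral>x. (norm (f x))\<^sup>2 \<partial>sphere_measure)"
  unfolding L2_inner_def integral_complex_of_real[symmetric]
  by (simp only: complex_norm_square[symmetric])

text \<open>By continuity a nonzero value would persist on a cap, and caps have positive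
  measure.\<close>

lemma L2_inner_self_eq_0:
  fixes f :: "'a::euclidean_space \<Rightarrow> complex"
  assumes f: "sphere_cont f" and 0: "L2_inner f f = 0"
  shows "f x = 0"
proof (rule ccontr)
  assume x: "f x \<noteq> 0"
  then have xS: "x \<in> sphere 0 1" using f by (auto simp: sphere_cont_def)
  have "(\<lambda>x. of_real ((norm (f x))\<^sup>2) :: complex) = (\<lambda>x. f x * cnj (f x))"
    by (rule ext) (rule complex_norm_square)
  with L2_inner_integrable[OF f f]
  have "integrable sphere_measure (\<lambda>x. of_real ((norm (f x))\<^sup>2) :: complex)"
    by simp
  then have int: "integrable sphere_measure (\<lambda>x. (norm (f x))\<^sup>2)"
    using integrable_Re by fastforce
  have "(\<integral>x. (norm (f x))\<^sup>2 \<partial>sphere_measure) = 0"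
    using 0 by (simp add: L2_inner_self)
  then have "AE y in sphere_measure. (norm (f y))\<^sup>2 = 0"
    using integral_nonneg_eq_0_iff_AE[OF int] by simp
  then have ae: "AE y in sphere_measure. y \<notin> sphere 0 1 \<inter> {y. f y \<noteq> 0}"
    by eventually_elim auto

  obtain r where r: "r > 0" "\<And>y. y \<in> sphere 0 1 \<Longrightarrow> dist y x < r \<Longrightarrow> f y \<noteq> 0"
  proof -
    have "continuous (at x within sphere 0 1) f"
      using f xS by (auto simp: sphere_cont_def continuous_on_eq_continuous_within)
    then obtain r where "r > 0" "\<And>y. y \<in> sphere 0 1 \<Longrightarrow> dist y x < r \<Longrightarrow> dist (f y) (f x) < norm (f x)"
      using x unfolding continuous_within_eps_delta by (metis zero_less_norm_iff)
    then show ?thesis using that[of r] by (metis dist_0_norm dist_commute less_irrefl)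
  qed
  from ae AE_sphere_measure have "AE y in sphere_measure. y \<notin> ball x r"
    by eventually_elim (use r in \<open>auto simp: dist_commute\<close>)
  then have "emeasure sphere_measure (ball x r) = 0"
    by (subst (asm) AE_iff_measurable[of "ball x r"]) auto
  then show False using emeasure_sphere_measure_ball[of x r] r xS by auto
qed

section \<open>Orthonormal bases of finite-dimensional spaces of functions\<close>

definition fun_subspace :: "('a \<Rightarrow> complex) set \<Rightarrow> bool" where
  "fun_subspace X \<longleftrightarrow> (\<lambda>x. 0) \<in> X \<and> (\<forall>f\<in>X. \<forall>g\<in>X. (\<lambda>x. f x + g x) \<in> X)
     \<and> (\<forall>f\<in>X. \<forall>c. (\<lambda>x. c * f x) \<in> X)"

lemma fun_subspace_add: "fun_subspace X \<Longrightarrow> f \<in> X \<Longrightarrow> g \<in> X \<Longrightarrow> (\<lambda>x. f x + g x) \<in> X"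
  and fun_subspace_scale: "fun_subspace X \<Longrightarrow> f \<in> X \<Longrightarrow> (\<lambda>x. c * f x) \<in> X"
  by (auto simp: fun_subspace_def)

lemma fun_subspace_sum:
  assumes "fun_subspace X" "\<And>i. i \<in> I \<Longrightarrow> f i \<in> X"
  shows "(\<lambda>x. \<Sum>i\<in>I. c i * f i x) \<in> X"
  using assms(2)
  by (induction I rule: infinite_finite_induct)
    (use assms(1) in \<open>auto simp: fun_subspace_def\<close>)

definition orthonormal_on :: "('a::euclidean_space \<Rightarrow> complex) set \<Rightarrow> bool" where
  "orthonormal_on B \<longleftrightarrow> (\<forall>e\<in>B. \<forall>e'\<in>B. L2_inner e e' = (if e = e' then 1 else 0))"

lemma L2_inner_orthonormal_sum:
  assumes "finite B" "orthonormal_on B" "\<And>e. e \<in> B \<Longrightarrow> sphere_cont e" "e' \<in> B"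
  shows "L2_inner (\<lambda>x. \<Sum>e\<in>B. c e * e x) e' = c e'"
proof -
  have "L2_inner (\<lambda>x. \<Sum>e\<in>B. c e * e x) e' = (\<Sum>e\<in>B. c e * L2_inner e e')"
    using assms by (subst L2_inner_sum_left) (auto intro: sphere_cont_cmult simp: L2_inner_cmult_left)
  also have "\<dots> = (\<Sum>e\<in>B. if e = e' then c e else 0)"
    using assms by (intro sum.cong) (auto simp: orthonormal_on_def)
  also have "\<dots> = c e'" using assms by simp
  finally show ?thesis .
qed

lemma sum_fun_apply: "(\<Sum>i\<in>I. f i) x = (\<Sum>i\<in>I. f i x)"
  for f :: "'i \<Rightarrow> 'a \<Rightarrow> complex"
  by (induction I rule: infinite_finite_induct) auto

lemma fun_vector_space: "vector_space (\<lambda>(c::complex) (f::'a \<Rightarrow> complex) x. c * f x)"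
  by unfold_locales (auto simp: fun_eq_iff algebra_simps)

text \<open>Orthonormal functions are linearly independent, so a generating set bounds their number.
  This makes a largest orthonormal set available below.\<close>

lemma card_orthonormal_le:
  fixes B G :: "('a::euclidean_space \<Rightarrow> complex) set"
  assumes B: "finite B" "orthonormal_on B" "\<And>e. e \<in> B \<Longrightarrow> sphere_cont e"
    and G: "finite G" "\<And>e. e \<in> B \<Longrightarrow> \<exists>c. e = (\<lambda>x. \<Sum>g\<in>G. c g * g x)"
  shows "card B \<le> card G"
proof -
  interpret vs: vector_space "\<lambda>(c::complex) (f::'a \<Rightarrow> complex) x. c * f x"
    by (rule fun_vector_space)
  have "vs.independent B"
  proof (rule ccontr)
    assume "\<not> vs.independent B"
    then obtain u e where u: "e \<in> B" "u e \<noteq> 0" "(\<Sum>v\<in>B. (\<lambda>x. u v * v x)) = 0"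
      using vs.dependent_finite[OF B(1)] by auto
    have "(\<lambda>x. \<Sum>v\<in>B. u v * v x) = (\<lambda>x. 0)"
      using u(3) by (auto simp: fun_eq_iff sum_fun_apply)
    then have "u e = 0"
      using L2_inner_orthonormal_sum[OF B, of e u] u(1) by (simp add: L2_inner_0_left)
    then show False using u by simp
  qed
  moreover have "B \<subseteq> vs.span G"
  proof
    fix e assume "e \<in> B"
    then obtain c where "e = (\<lambda>x. \<Sum>g\<in>G. c g * g x)" using G(2) by blast
    then have "e = (\<Sum>g\<in>G. (\<lambda>x. c g * g x))" by (simp add: fun_eq_iff sum_fun_apply)
    moreover have "(\<Sum>g\<in>G. (\<lambda>x. c g * g x)) \<in> vs.span G"
      by (intro vs.span_sum vs.span_scale vs.span_base)
    ultimately show "e \<in> vs.span G" by simp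
  qed
  ultimately show ?thesis using vs.independent_span_bound[OF G(1)] by blast
qed

text \<open>A largest orthonormal subset of \<open>X\<close> must span \<open>X\<close>: the
  normalised remainder of a function outside its span would enlarge it. The generators
  \<open>G\<close> may lie outside \<open>X\<close>, so that those of a larger space serve its
  subspaces.\<close>

lemma orthonormal_basis_exists:
  fixes X G :: "('a::euclidean_space \<Rightarrow> complex) set"
  assumes X: "fun_subspace X" "\<And>f. f \<in> X \<Longrightarrow> sphere_cont f"
    and G: "finite G" "\<And>f. f \<in> X \<Longrightarrow> \<exists>c. f = (\<lambda>x. \<Sum>g\<in>G. c g * g x)"
  shows "\<exists>B. orthonormal_basis X B"
proof -
  let ?P = "\<lambda>B. finite B \<and> B \<subseteq> X \<and> orthonormal_on B"
  have P0: "?P {}" by (simp add: orthonormal_on_def)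
  have bound: "card B \<le> card G" if "?P B" for B
    using that X(2) G by (intro card_orthonormal_le) auto
  obtain B where B: "?P B" "\<And>B'. ?P B' \<Longrightarrow> card B' \<le> card B"
    using ex_has_greatest_nat[of ?P "{}" card "Suc (card G)", OF P0] bound
    by (auto simp: less_Suc_eq_le)
  have contB: "sphere_cont e" if "e \<in> B" for e using that B(1) X(2) by auto
  have "\<exists>c. \<forall>x. f x = (\<Sum>e\<in>B. c e * e x)" if f: "f \<in> X" for f
  proof (rule ccontr)
    assume no: "\<not> ?thesis"
    define c where "c e = L2_inner f e" for e
    define r where "r = (\<lambda>x. f x - (\<Sum>e\<in>B. c e * e x))"
    have cont_sum: "sphere_cont (\<lambda>x. \<Sum>e\<in>B. c e * e x)"
      using contB by (intro sphere_cont_sum sphere_cont_cmult)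
    have rX: "r \<in> X"
    proof -
      have "(\<lambda>x. (-1) * (\<Sum>e\<in>B. c e * e x)) \<in> X"
      proof -
        have "(\<lambda>x. \<Sum>e\<in>B. c e * e x) \<in> X"
          by (rule fun_subspace_sum[OF X(1)]) (use B(1) in blast)
        from fun_subspace_scale[OF X(1) this] show ?thesis .
      qed
      from fun_subspace_add[OF X(1) f this]
      have "(\<lambda>x. f x + (-1) * (\<Sum>e\<in>B. c e * e x)) \<in> X" .
      then show ?thesis by (simp add: r_def)
    qed
    have contr: "sphere_cont r" by (rule X(2)[OF rX])
    have orth: "L2_inner r e = 0" if "e \<in> B" for e
      using that L2_inner_orthonormal_sum[OF _ _ contB that, of c] B(1) contB X(2)[OF f] cont_sum
      by (simp add: r_def L2_inner_diff_left c_def)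
    define s where "s = (\<integral>x. (norm (r x))\<^sup>2 \<partial>sphere_measure)"
    have s: "L2_inner r r = of_real s" by (simp add: s_def L2_inner_self)
    have "s \<ge> 0" by (simp add: s_def)
    have "s \<noteq> 0"
    proof
      assume "s = 0"
      then have "\<forall>x. r x = 0" using L2_inner_self_eq_0[OF contr] s by simp
      then show False using no by (auto simp: r_def)
    qed
    with \<open>s \<ge> 0\<close> have "s > 0" by simp
    define e0 where "e0 = (\<lambda>x. of_real (1 / sqrt s) * r x)"
    have "e0 \<in> X" unfolding e0_def by (rule fun_subspace_scale[OF X(1) rX])
    have e0B: "L2_inner e0 e = 0" "L2_inner e e0 = 0" if "e \<in> B" for e
    proof -
      show "L2_inner e0 e = 0"
        unfolding e0_def by (subst L2_inner_cmult_left) (simp add: orth that)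
      then show "L2_inner e e0 = 0" by (simp add: L2_inner_cnj[of e e0])
    qed
    have e00: "L2_inner e0 e0 = 1"
    proof -
      have "L2_inner e0 e0 = of_real (1 / sqrt s) * L2_inner r e0"
        unfolding e0_def by (subst L2_inner_cmult_left) simp
      also have "L2_inner r e0 = cnj (of_real (1 / sqrt s) * L2_inner r r)"
        unfolding e0_def by (subst L2_inner_cnj, subst L2_inner_cmult_left) simp
      also have "of_real (1 / sqrt s) * cnj (of_real (1 / sqrt s) * L2_inner r r)
          = complex_of_real (1 / sqrt s * (1 / sqrt s * s))"
        by (simp only: s complex_cnj_mult complex_cnj_complex_of_real of_real_mult)
      also have "1 / sqrt s * (1 / sqrt s * s) = 1"
        using \<open>s > 0\<close> by (simp add: field_simps)
      finally show ?thesis by simp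
    qed
    have "e0 \<notin> B" using e0B(1)[of e0] e00 by auto
    have "orthonormal_on (insert e0 B)"
      using B(1) e0B e00 \<open>e0 \<notin> B\<close> unfolding orthonormal_on_def by auto
    then have "card (insert e0 B) \<le> card B"
      using B \<open>e0 \<in> X\<close> by auto
    then show False using B(1) \<open>e0 \<notin> B\<close> by simp
  qed
  then have "orthonormal_basis X B"
    using B(1) by (simp add: orthonormal_basis_def orthonormal_on_def)
  then show ?thesis ..
qed

section \<open>Integration by parts along isometric flows\<close>

definition flow_deriv :: "(real \<Rightarrow> 'a::euclidean_space \<Rightarrow> 'a) \<Rightarrow> ('a \<Rightarrow> complex) \<Rightarrow> ('a \<Rightarrow> complex) \<Rightarrow> bool" where
  "flow_deriv R u u' \<longleftrightarrow>
     (\<forall>x\<in>sphere 0 1. \<forall>t. ((\<lambda>t. u (R t x)) has_vector_derivative u' (R t x)) (at t))"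

text \<open>Dominated convergence is about sequences, hence the difference quotients at the times
  \<open>1 / Suc n\<close>.\<close>

lemma has_vector_derivative_LIMSEQ:
  assumes "(f has_vector_derivative D) (at 0)"
  shows "(\<lambda>n. real (Suc n) *\<^sub>R (f (1 / real (Suc n)) - f 0)) \<longlonglongrightarrow> D"
proof -
  have "(\<lambda>h. norm (f (0 + h) - f 0 - h *\<^sub>R D) / norm h) \<midarrow>0\<rightarrow> 0"
    using assms unfolding has_vector_derivative_def has_derivative_at by simp
  moreover have "filterlim (\<lambda>n. 1 / real (Suc n)) (at 0) sequentially"
    using LIMSEQ_Suc[OF lim_1_over_n[where 'a=real]] by (auto simp: filterlim_at)
  ultimately have "(\<lambda>n. norm (f (0 + 1 / real (Suc n)) - f 0 - (1 / real (Suc n)) *\<^sub>R D)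
      / norm (1 / real (Suc n))) \<longlonglongrightarrow> 0"
    by (rule filterlim_compose)
  moreover have "norm (f (0 + 1 / real (Suc n)) - f 0 - (1 / real (Suc n)) *\<^sub>R D) / norm (1 / real (Suc n))
      = norm (real (Suc n) *\<^sub>R (f (1 / real (Suc n)) - f 0) - D)" for n
  proof -
    have "real (Suc n) *\<^sub>R (f (1 / real (Suc n)) - f 0) - D
        = real (Suc n) *\<^sub>R (f (0 + 1 / real (Suc n)) - f 0 - (1 / real (Suc n)) *\<^sub>R D)"
      by (simp add: algebra_simps)
    then show ?thesis by (simp only: norm_scaleR) (simp add: field_simps)
  qed
  ultimately show ?thesis by (simp add: tendsto_norm_zero_iff LIM_zero_iff)
qed

text \<open>By invariance of the measure every difference quotient along the flow has integral zero,
  and the quotients converge boundedly to \<open>p'\<close>.\<close>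

lemma integral_flow_deriv:
  fixes R :: "real \<Rightarrow> 'a::euclidean_space \<Rightarrow> 'a"
  assumes R: "\<And>t. isometry_lin (R t)" "\<And>x. R 0 x = x"
    and p: "sphere_cont p" "sphere_cont p'" "flow_deriv R p p'"
  shows "(\<integral>x. p' x \<partial>sphere_measure) = 0"
proof -
  let ?\<sigma> = "sphere_measure :: 'a measure"
  interpret finite_measure ?\<sigma> by (rule finite_measure_sphere_measure)
  have [measurable]: "p \<in> borel_measurable borel" "p' \<in> borel_measurable borel"
    using p sphere_cont_measurable by auto
  have [measurable]: "R t \<in> borel_measurable borel" for t by (rule isometry_linD(3)[OF R(1)])
  have nR: "R t x \<in> sphere 0 1 \<longleftrightarrow> x \<in> sphere 0 1" for t x
    using isometry_linD(2)[OF R(1), of t x] by simp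
  obtain C where C: "C \<ge> 0" "\<And>x. norm (p' x) \<le> C" using sphere_cont_bounded[OF p(2)] by blast
  define q where "q n x = of_nat (Suc n) * (p (R (1 / real (Suc n)) x) - p x)" for n x
  have "(\<lambda>n. \<integral>x. q n x \<partial>?\<sigma>) \<longlonglongrightarrow> (\<integral>x. p' x \<partial>?\<sigma>)"
  proof (rule integral_dominated_convergence[where w = "\<lambda>_. C"])
    show "AE x in ?\<sigma>. (\<lambda>n. q n x) \<longlonglongrightarrow> p' x"
    proof (rule AE_mp[OF AE_sphere_measure AE_I2], rule impI)
      fix x :: 'a assume x: "x \<in> sphere 0 1"
      have "((\<lambda>t. p (R t x)) has_vector_derivative p' x) (at 0)"
        using p(3) x R(2) unfolding flow_deriv_def by metis
      from has_vector_derivative_LIMSEQ[OF this]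
      have "(\<lambda>n. real (Suc n) *\<^sub>R (p (R (1 / real (Suc n)) x) - p x)) \<longlonglongrightarrow> p' x"
        by (simp only: R(2))
      then show "(\<lambda>n. q n x) \<longlonglongrightarrow> p' x" by (simp only: q_def scaleR_conv_of_real of_real_of_nat_eq)
    qed
    fix n
    show "AE x in ?\<sigma>. norm (q n x) \<le> C"
    proof (rule AE_mp[OF AE_sphere_measure AE_I2], rule impI)
      fix x :: 'a assume x: "x \<in> sphere 0 1"
      let ?t = "1 / real (Suc n)"
      \<comment> \<open>Since \<open>flow_deriv\<close> gives the derivative at every time, the
        bound \<open>C\<close> of \<open>p'\<close> is a Lipschitz constant along the orbit and
        dominates all difference quotients.\<close>
      have "norm (p (R ?t x) - p (R 0 x)) \<le> C * norm (?t - 0)"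
      proof (rule differentiable_bound[where S = UNIV and f' = "\<lambda>t h. h *\<^sub>R p' (R t x)"])
        fix t :: real
        show "((\<lambda>t. p (R t x)) has_derivative (\<lambda>h. h *\<^sub>R p' (R t x))) (at t within UNIV)"
          using p(3) x by (auto simp: flow_deriv_def has_vector_derivative_def)
        show "onorm (\<lambda>h. h *\<^sub>R p' (R t x)) \<le> C"
          by (rule onorm_le) (use C in \<open>simp add: mult.commute[of C] mult_left_mono\<close>)
      qed auto
      moreover have "norm (q n x) = real (Suc n) * norm (p (R ?t x) - p x)"
        unfolding q_def norm_mult norm_of_nat ..
      ultimately show "norm (q n x) \<le> C"
        by (simp add: R(2) field_simps)
    qed
  qed (auto simp: q_def[abs_def])
  moreover have "(\<integral>x. q n x \<partial>?\<sigma>) = 0" for n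
  proof -
    have "sphere_cont (\<lambda>x. p (R (1 / real (Suc n)) x))"
      unfolding sphere_cont_def
    proof (intro conjI allI impI)
      have "continuous_on (sphere 0 1) (R (1 / real (Suc n)))"
        using isometry_linD(1)[OF R(1)] by (simp add: linear_conv_bounded_linear linear_continuous_on)
      then show "continuous_on (sphere 0 1) (\<lambda>x. p (R (1 / real (Suc n)) x))"
        using p(1) nR
        by (intro continuous_on_compose2[of "sphere 0 1" p "sphere 0 1" "R (1 / real (Suc n))"])
          (auto simp: sphere_cont_def simp del: of_nat_Suc)
      show "p (R (1 / real (Suc n)) x) = 0" if "x \<notin> sphere 0 1" for x
        using p(1) nR that unfolding sphere_cont_def by blast
    qed
    then have "(\<integral>x. q n x \<partial>?\<sigma>) = of_nat (Suc n) * ((\<integral>x. p (R (1 / real (Suc n)) x) \<partial>?\<sigma>) - (\<integral>x. p x \<partial>?\<sigma>))"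
      unfolding q_def using p(1)
      by (subst integral_mult_right_zero, subst Bochner_Integration.integral_diff)
        (auto intro: integrable_sphere_cont)
    then show ?thesis
      by (subst (asm) integral_sphere_measure_isometry[OF R(1)]) auto
  qed
  ultimately have "(\<lambda>n::nat. 0) \<longlonglongrightarrow> (\<integral>x. p' x \<partial>?\<sigma>)" by (simp only:)
  then show ?thesis by (simp add: LIMSEQ_const_iff)
qed

lemma flow_integration_by_parts:
  fixes R :: "real \<Rightarrow> 'a::euclidean_space \<Rightarrow> 'a"
  assumes R: "\<And>t. isometry_lin (R t)" "\<And>x. R 0 x = x"
    and u: "sphere_cont u" "sphere_cont u'" "flow_deriv R u u'"
    and w: "sphere_cont w" "sphere_cont w'" "flow_deriv R w w'"
  shows "(\<integral>x. u' x * w x \<partial>sphere_measure) = - (\<integral>x. u x * w' x \<partial>sphere_measure)"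
proof -
  have fd: "flow_deriv R (\<lambda>x. u x * w x) (\<lambda>x. u x * w' x + u' x * w x)"
    using u(3) w(3) unfolding flow_deriv_def by (auto intro: has_vector_derivative_mult)
  have "(\<integral>x. u x * w' x + u' x * w x \<partial>sphere_measure) = 0"
    by (rule integral_flow_deriv[OF R _ _ fd]) (intro sphere_cont_mult sphere_cont_add u w)+
  then have "(\<integral>x. u x * w' x \<partial>sphere_measure) + (\<integral>x. u' x * w x \<partial>sphere_measure) = 0"
    using u w by (subst (asm) Bochner_Integration.integral_add)
      (auto intro!: integrable_sphere_cont sphere_cont_mult)
  then show ?thesis by (simp add: eq_neg_iff_add_eq_0 add.commute)
qed

section \<open>Homogeneous polynomials\<close>

text \<open>Built up by one linear form at a time, so that multiplication by a linear form is the
  only substantial case of every induction. The zero function has all degrees, which makes truncated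
  subtraction of degrees safe.\<close>

inductive hpoly :: "nat \<Rightarrow> ('a::euclidean_space \<Rightarrow> complex) \<Rightarrow> bool" where
  hpoly_const: "hpoly 0 (\<lambda>x. c)"
| hpoly_add: "hpoly d p \<Longrightarrow> hpoly d q \<Longrightarrow> hpoly d (\<lambda>x. p x + q x)"
| hpoly_mult: "hpoly d p \<Longrightarrow> hpoly (Suc d) (\<lambda>x. of_real (x \<bullet> b) * p x)"

lemma hpoly_0: "hpoly d (\<lambda>x. 0)"
proof (induction d)
  case 0 show ?case by (rule hpoly_const)
next
  case (Suc d)
  from hpoly_mult[OF this, of 0] show ?case by simp
qed

lemma hpoly_cmult: "hpoly d p \<Longrightarrow> hpoly d (\<lambda>x. c * p x)"
proof (induction rule: hpoly.induct)
  case (hpoly_const k) show ?case by (rule hpoly.hpoly_const)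
next
  case (hpoly_add d p q)
  from hpoly.hpoly_add[OF hpoly_add.IH] show ?case by (simp add: ring_distribs)
next
  case (hpoly_mult d p b)
  from hpoly.hpoly_mult[OF hpoly_mult.IH, of b] show ?case by (simp add: mult_ac)
qed

lemma hpoly_sum: "(\<And>i. i \<in> I \<Longrightarrow> hpoly d (f i)) \<Longrightarrow> hpoly d (\<lambda>x. \<Sum>i\<in>I. f i x)"
  by (induction I rule: infinite_finite_induct) (auto intro: hpoly_0 hpoly_add)

lemma hpoly_times:
  assumes "hpoly d p" "hpoly e q" shows "hpoly (d + e) (\<lambda>x. p x * q x)"
  using assms(1)
proof (induction rule: hpoly.induct)
  case (hpoly_const k) then show ?case using hpoly_cmult[OF assms(2), of k] by simp
next
  case (hpoly_add d p p')
  from hpoly.hpoly_add[OF hpoly_add.IH] show ?case by (simp add: ring_distribs)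
next
  case (hpoly_mult d p b)
  from hpoly.hpoly_mult[OF hpoly_mult.IH, of b] show ?case by (simp add: mult_ac)
qed

lemma hpoly_inner: "hpoly (Suc 0) (\<lambda>x. of_real (x \<bullet> b))"
  using hpoly_mult[OF hpoly_const[of 1], of b] by simp

lemma hpoly_linear:
  fixes l :: "'a::euclidean_space \<Rightarrow> complex"
  assumes "linear l" shows "hpoly (Suc 0) l"
proof -
  have "l = (\<lambda>x. \<Sum>b\<in>Basis. l b * of_real (x \<bullet> b))"
  proof
    fix x
    have "l x = l (\<Sum>b\<in>Basis. (x \<bullet> b) *\<^sub>R b)" by (simp add: euclidean_representation)
    also have "\<dots> = (\<Sum>b\<in>Basis. l b * of_real (x \<bullet> b))"
      using assms by (simp add: linear_sum linear_scale scaleR_conv_of_real mult.commute)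
    finally show "l x = (\<Sum>b\<in>Basis. l b * of_real (x \<bullet> b))" .
  qed
  moreover have "hpoly (Suc 0) (\<lambda>x. \<Sum>b\<in>Basis. l b * of_real (x \<bullet> b))"
    by (intro hpoly_sum hpoly_cmult hpoly_inner)
  ultimately show ?thesis by simp
qed

lemma hpoly_bilinear:
  fixes B :: "'a::euclidean_space \<Rightarrow> 'a \<Rightarrow> complex"
  assumes "\<And>x. linear (B x)" "\<And>y. linear (\<lambda>x. B x y)"
  shows "hpoly (Suc (Suc 0)) (\<lambda>x. B x x)"
proof -
  have "(\<lambda>x. B x x) = (\<lambda>x. \<Sum>b\<in>Basis. of_real (x \<bullet> b) * B x b)"
  proof
    fix x
    have "B x x = B x (\<Sum>b\<in>Basis. (x \<bullet> b) *\<^sub>R b)" by (simp add: euclidean_representation)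
    also have "\<dots> = (\<Sum>b\<in>Basis. of_real (x \<bullet> b) * B x b)"
      using assms(1)[of x] by (simp only: linear_sum linear_scale scaleR_conv_of_real)
    finally show "B x x = (\<Sum>b\<in>Basis. of_real (x \<bullet> b) * B x b)" .
  qed
  moreover have "hpoly (Suc (Suc 0)) (\<lambda>x. \<Sum>b\<in>Basis. of_real (x \<bullet> b) * B x b)"
    by (intro hpoly_sum hpoly_mult hpoly_linear assms)
  ultimately show ?thesis by simp
qed

lemma hpoly_cnj: "hpoly d p \<Longrightarrow> hpoly d (\<lambda>x. cnj (p x))"
  by (induction rule: hpoly.induct) (simp_all add: hpoly.intros)

lemma hpoly_homogeneous: "hpoly d p \<Longrightarrow> p (r *\<^sub>R x) = of_real r ^ d * p x"
  by (induction rule: hpoly.induct) (simp_all add: algebra_simps)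

text \<open>Homogeneity determines both functions away from the origin. Identities obtained on the
  sphere, for instance for \<open>Gamma_op\<close>, thus become identities of polynomials.\<close>

lemma hpoly_eqI_sphere:
  assumes "hpoly d p" "hpoly d q" and eq: "\<And>x. x \<in> sphere 0 1 \<Longrightarrow> p x = q x"
  shows "p = q"
proof
  fix x :: 'a
  have *: "p y = q y" if "y \<noteq> 0" for y
  proof -
    have "y = norm y *\<^sub>R sgn y" using that by (simp add: sgn_div_norm)
    then show ?thesis
      using hpoly_homogeneous[OF assms(1), of "norm y" "sgn y"]
        hpoly_homogeneous[OF assms(2), of "norm y" "sgn y"] eq[of "sgn y"] that
      by (simp add: norm_sgn)
  qed
  show "p x = q x"
  proof (cases "x = 0")
    case True
    obtain b :: 'a where "b \<in> Basis" using nonempty_Basis by blast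
    then have "b \<noteq> 0" by auto
    \<comment> \<open>The power is 1 for \<open>d = 0\<close> and 0 otherwise, which covers
      constants and positive degrees at once.\<close>
    have "p 0 = of_real 0 ^ d * p b" "q 0 = of_real 0 ^ d * q b"
      using hpoly_homogeneous[OF assms(1), of 0 b] hpoly_homogeneous[OF assms(2), of 0 b] by simp_all
    then show ?thesis using True *[OF \<open>b \<noteq> 0\<close>] by simp
  qed (rule *)
qed

section \<open>Differential operators on homogeneous polynomials\<close>

definition dd :: "'a::euclidean_space \<Rightarrow> ('a \<Rightarrow> complex) \<Rightarrow> 'a \<Rightarrow> complex" where
  "dd v p = (\<lambda>x. frechet_derivative p (at x) v)"

text \<open>Differentiation along the linear vector field \<open>A\<close>, that is, the
  infinitesimal action of the flow generated by \<open>A\<close>.\<close>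

definition LD :: "('a::euclidean_space \<Rightarrow> 'a) \<Rightarrow> ('a \<Rightarrow> complex) \<Rightarrow> 'a \<Rightarrow> complex" where
  "LD A p = (\<lambda>x. dd (A x) p x)"

text \<open>The Euclidean Laplacian with the analytic sign, opposite to that of
  \<open>laplace_beltrami\<close>.\<close>

definition Lap :: "('a::euclidean_space \<Rightarrow> complex) \<Rightarrow> 'a \<Rightarrow> complex" where
  "Lap p = (\<lambda>x. \<Sum>b\<in>Basis. dd b (dd b p) x)"

lemma hpoly_differentiable: "hpoly d p \<Longrightarrow> p differentiable (at x)"
proof (induction rule: hpoly.induct)
  case (hpoly_mult d p b)
  have "(\<lambda>x. complex_of_real (x \<bullet> b)) differentiable (at x)"
    by (intro differentiableI[of _ "\<lambda>v. of_real (v \<bullet> b)"]) (auto intro!: derivative_eq_intros)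
  then show ?case using hpoly_mult by (intro differentiable_mult)
qed auto

lemma hpoly_continuous: "hpoly d p \<Longrightarrow> continuous_on S p"
  by (meson continuous_at_imp_continuous_on differentiable_imp_continuous_within hpoly_differentiable)

lemma hpoly_has_derivative: "hpoly d p \<Longrightarrow> (p has_derivative (\<lambda>v. dd v p x)) (at x)"
  using hpoly_differentiable[of d p x] by (simp add: dd_def frechet_derivative_works)

lemma ddI: "(p has_derivative p') (at x) \<Longrightarrow> dd v p x = p' v"
  by (simp add: dd_def frechet_derivative_at[symmetric])

lemma dd_const [simp]: "dd v (\<lambda>x. c) = (\<lambda>x. 0)"
  by (rule ext, rule ddI) (auto intro!: derivative_eq_intros)

lemma dd_add: "hpoly d p \<Longrightarrow> hpoly e q \<Longrightarrow> dd v (\<lambda>x. p x + q x) = (\<lambda>x. dd v p x + dd v q x)"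
  by (rule ext, rule ddI) (auto intro!: has_derivative_add hpoly_has_derivative)

lemma dd_times:
  "hpoly d p \<Longrightarrow> hpoly e q \<Longrightarrow> dd v (\<lambda>x. p x * q x) = (\<lambda>x. p x * dd v q x + dd v p x * q x)"
  by (rule ext, rule ddI) (auto intro!: has_derivative_mult hpoly_has_derivative)

lemma dd_inner: "dd v (\<lambda>x. of_real (x \<bullet> b)) = (\<lambda>x. of_real (v \<bullet> b))"
  by (rule ext, rule ddI) (auto intro!: derivative_eq_intros)

lemma dd_mult:
  "hpoly d p \<Longrightarrow> dd v (\<lambda>x. of_real (x \<bullet> b) * p x)
    = (\<lambda>x. of_real (v \<bullet> b) * p x + of_real (x \<bullet> b) * dd v p x)"
  by (subst dd_times[OF hpoly_inner]) (auto simp: dd_inner fun_eq_iff)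

lemma dd_cmult: "hpoly d p \<Longrightarrow> dd v (\<lambda>x. c * p x) = (\<lambda>x. c * dd v p x)"
  by (subst dd_times[OF hpoly_const]) auto

lemma linear_dd: "hpoly d p \<Longrightarrow> linear (\<lambda>v. dd v p x)"
  using has_derivative_linear[OF hpoly_has_derivative] .

lemma hpoly_dd_0: "hpoly d p \<Longrightarrow> d = 0 \<Longrightarrow> dd v p = (\<lambda>x. 0)"
proof (induction rule: hpoly.induct)
  case (hpoly_add d p q)
  then show ?case by (simp add: dd_add[OF hpoly_add.hyps])
qed auto

lemma hpoly_dd: "hpoly d p \<Longrightarrow> hpoly (d - 1) (dd v p)"
proof (induction rule: hpoly.induct)
  case (hpoly_const c) then show ?case by (simp add: hpoly_0)
next
  case (hpoly_add d p q)
  then show ?case by (simp add: dd_add[OF hpoly_add.hyps] hpoly.hpoly_add)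
next
  case (hpoly_mult d p b)
  \<comment> \<open>For \<open>d = 0\<close> the degrees do not add up, but then the derivative of
    \<open>p\<close> vanishes.\<close>
  have 1: "hpoly d (\<lambda>x. of_real (x \<bullet> b) * dd v p x)"
  proof (cases d)
    case 0 then show ?thesis using hpoly_mult hpoly_dd_0[of d p v] by (simp add: hpoly_0)
  next
    case (Suc e) then show ?thesis using hpoly.hpoly_mult[OF hpoly_mult.IH, of b] by simp
  qed
  then show ?case
    using hpoly.hpoly_add[OF hpoly_cmult[OF hpoly_mult.hyps, of "of_real (v \<bullet> b)"] 1]
    by (simp add: dd_mult[OF hpoly_mult.hyps])
qed

lemma dd_commute: "hpoly d p \<Longrightarrow> dd u (dd v p) = dd v (dd u p)"
proof (induction rule: hpoly.induct)
  case (hpoly_add d p q)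
  then show ?case
    by (simp add: dd_add[OF hpoly_add.hyps] dd_add[OF hpoly_dd hpoly_dd, OF hpoly_add.hyps])
next
  case (hpoly_mult d p b)
  note h = hpoly_mult.hyps
  have "dd u (dd v (\<lambda>x. of_real (x \<bullet> b) * p x))
      = (\<lambda>x. of_real (v \<bullet> b) * dd u p x + (of_real (u \<bullet> b) * dd v p x + of_real (x \<bullet> b) * dd u (dd v p) x))" for u v
    unfolding dd_mult[OF h]
    by (subst dd_add[OF hpoly_cmult[OF h] hpoly.hpoly_mult[OF hpoly_dd[OF h]]])
      (simp add: dd_cmult[OF h] dd_mult[OF hpoly_dd[OF h]])
  then show ?case by (simp add: hpoly_mult.IH fun_eq_iff)
qed auto

lemma Euler_identity: "hpoly d p \<Longrightarrow> dd x p x = of_nat d * p x"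
proof (induction rule: hpoly.induct)
  case (hpoly_add d p q)
  then show ?case by (simp add: dd_add[OF hpoly_add.hyps] ring_distribs)
next
  case (hpoly_mult d p b)
  then show ?case by (simp only: dd_mult[OF hpoly_mult.hyps]) (simp add: algebra_simps)
qed auto

lemma dd_basis_expand:
  assumes "hpoly d p" shows "dd v p x = (\<Sum>b\<in>Basis. of_real (v \<bullet> b) * dd b p x)"
proof -
  have "dd v p x = dd (\<Sum>b\<in>Basis. (v \<bullet> b) *\<^sub>R b) p x" by (simp add: euclidean_representation)
  also have "\<dots> = (\<Sum>b\<in>Basis. of_real (v \<bullet> b) * dd b p x)"
    using linear_dd[OF assms, of x] by (simp only: linear_sum[of "\<lambda>v. dd v p x"]
        linear_scale[of "\<lambda>v. dd v p x"] scaleR_conv_of_real)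
  finally show ?thesis .
qed

lemma Lap_const [simp]: "Lap (\<lambda>x. c) = (\<lambda>x. 0)"
  by (simp add: Lap_def)

lemma Lap_add: "hpoly d p \<Longrightarrow> hpoly e q \<Longrightarrow> Lap (\<lambda>x. p x + q x) = (\<lambda>x. Lap p x + Lap q x)"
  by (simp add: Lap_def dd_add[OF hpoly_dd hpoly_dd] dd_add sum.distrib)

lemma Lap_cmult: "hpoly d p \<Longrightarrow> Lap (\<lambda>x. c * p x) = (\<lambda>x. c * Lap p x)"
  by (simp add: Lap_def dd_cmult[OF hpoly_dd] dd_cmult sum_distrib_left)

lemma Lap_sum:
  assumes "\<And>i. i \<in> I \<Longrightarrow> hpoly d (f i)"
  shows "Lap (\<lambda>x. \<Sum>i\<in>I. f i x) = (\<lambda>x. \<Sum>i\<in>I. Lap (f i) x)"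
  using assms
proof (induction I rule: infinite_finite_induct)
  case (insert i I)
  then have "hpoly d (\<lambda>x. \<Sum>i\<in>I. f i x)" by (intro hpoly_sum) auto
  with insert show ?case by (simp add: Lap_add[of d "f i" d])
qed auto

lemma hpoly_Lap: "hpoly d p \<Longrightarrow> hpoly (d - 2) (Lap p)"
  unfolding Lap_def by (intro hpoly_sum) (use hpoly_dd[OF hpoly_dd] in \<open>fastforce simp: numeral_2_eq_2\<close>)

lemma Lap_low_degree: "hpoly d p \<Longrightarrow> d < 2 \<Longrightarrow> Lap p = (\<lambda>x. 0)"
proof -
  assume "hpoly d p" "d < 2"
  then have "dd b (dd b p) = (\<lambda>x. 0)" for b
    by (intro hpoly_dd_0[OF hpoly_dd]) auto
  then show ?thesis by (simp add: Lap_def)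
qed

lemma Lap_mult:
  assumes h: "hpoly d p"
  shows "Lap (\<lambda>x. of_real (x \<bullet> b) * p x) = (\<lambda>x. of_real (x \<bullet> b) * Lap p x + 2 * dd b p x)"
proof
  fix x
  have "dd c (dd c (\<lambda>x. of_real (x \<bullet> b) * p x)) x
      = of_real (x \<bullet> b) * dd c (dd c p) x + 2 * (of_real (b \<bullet> c) * dd c p x)" for c
    unfolding dd_mult[OF h]
    by (subst dd_add[OF hpoly_cmult[OF h] hpoly_mult[OF hpoly_dd[OF h]]])
      (simp add: dd_cmult[OF h] dd_mult[OF hpoly_dd[OF h]] inner_commute)
  then show "Lap (\<lambda>x. of_real (x \<bullet> b) * p x) x = of_real (x \<bullet> b) * Lap p x + 2 * dd b p x"
    by (simp add: Lap_def sum.distrib sum_distrib_left[symmetric] dd_basis_expand[OF h, of b])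
qed

lemma hpoly_LD:
  assumes "hpoly d p" "linear A" shows "hpoly d (LD A p)"
proof (cases d)
  case 0
  then show ?thesis using hpoly_dd_0[OF assms(1)] by (simp add: LD_def hpoly_0)
next
  case (Suc e)
  have "LD A p = (\<lambda>x. \<Sum>b\<in>Basis. of_real (A x \<bullet> b) * dd b p x)"
    unfolding LD_def by (rule ext, rule dd_basis_expand[OF assms(1)])
  moreover have "linear (\<lambda>x. complex_of_real (A x \<bullet> b))" for b
    using assms(2) by (auto intro!: linearI simp: linear_add linear_scale inner_add_left scaleR_conv_of_real)
  then have "hpoly (Suc 0 + e) (\<lambda>x. \<Sum>b\<in>Basis. of_real (A x \<bullet> b) * dd b p x)"
    using hpoly_dd[OF assms(1)] Suc by (intro hpoly_sum hpoly_times hpoly_linear) auto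
  ultimately show ?thesis using Suc by simp
qed

lemma LD_const [simp]: "LD A (\<lambda>x. c) = (\<lambda>x. 0)"
  by (simp add: LD_def)

lemma LD_add: "hpoly d p \<Longrightarrow> hpoly e q \<Longrightarrow> LD A (\<lambda>x. p x + q x) = (\<lambda>x. LD A p x + LD A q x)"
  by (simp add: LD_def dd_add)

lemma LD_cmult: "hpoly d p \<Longrightarrow> LD A (\<lambda>x. c * p x) = (\<lambda>x. c * LD A p x)"
  by (simp add: LD_def dd_cmult)

lemma LD_times:
  "hpoly d p \<Longrightarrow> hpoly e q \<Longrightarrow> LD A (\<lambda>x. p x * q x) = (\<lambda>x. p x * LD A q x + LD A p x * q x)"
  by (simp add: LD_def dd_times)

definition skew :: "('a::euclidean_space \<Rightarrow> 'a) \<Rightarrow> bool" where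
  "skew A \<longleftrightarrow> linear A \<and> (\<forall>x y. A x \<bullet> y = - (x \<bullet> A y))"

lemma LD_inner: "skew A \<Longrightarrow> LD A (\<lambda>x. of_real (x \<bullet> b)) = (\<lambda>x. of_real (x \<bullet> - A b))"
  by (simp add: LD_def dd_inner skew_def)

lemma LD_mult:
  "skew A \<Longrightarrow> hpoly d p \<Longrightarrow> LD A (\<lambda>x. of_real (x \<bullet> b) * p x)
    = (\<lambda>x. of_real (x \<bullet> - A b) * p x + of_real (x \<bullet> b) * LD A p x)"
  by (subst LD_times[OF hpoly_inner]) (auto simp: LD_inner fun_eq_iff)

text \<open>The commutator of the constant field \<open>b\<close> with the linear field
  \<open>A\<close> is the constant field \<open>A b\<close>.\<close>

lemma dd_LD:
  assumes A: "skew A" and h: "hpoly d p"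
  shows "dd b (LD A p) = (\<lambda>x. LD A (dd b p) x + dd (A b) p x)"
  using h
proof (induction arbitrary: b rule: hpoly.induct)
  case (hpoly_add d p q)
  have lin: "linear A" using A by (simp add: skew_def)
  show ?case
    using hpoly_add.IH hpoly_add.hyps
    by (simp add: LD_add[OF hpoly_add.hyps] dd_add[OF hpoly_add.hyps] LD_add[OF hpoly_dd hpoly_dd]
        dd_add[OF hpoly_LD[OF hpoly_add.hyps(1) lin] hpoly_LD[OF hpoly_add.hyps(2) lin]] fun_eq_iff
        add_ac)
next
  case (hpoly_mult d p c)
  note h = hpoly_mult.hyps
  have lin: "linear A" using A by (simp add: skew_def)
  have bc: "b \<bullet> - A c = A b \<bullet> c" using A by (simp add: skew_def)
  have "dd b (LD A (\<lambda>x. of_real (x \<bullet> c) * p x))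
      = (\<lambda>x. (of_real (b \<bullet> - A c) * p x + of_real (x \<bullet> - A c) * dd b p x)
        + (of_real (b \<bullet> c) * LD A p x + of_real (x \<bullet> c) * (LD A (dd b p) x + dd (A b) p x)))"
    unfolding LD_mult[OF A h]
    by (subst dd_add[OF hpoly.hpoly_mult[OF h] hpoly.hpoly_mult[OF hpoly_LD[OF h lin]]])
      (simp only: dd_mult[OF h] dd_mult[OF hpoly_LD[OF h lin]] hpoly_mult.IH)
  moreover have "LD A (dd b (\<lambda>x. of_real (x \<bullet> c) * p x))
      = (\<lambda>x. of_real (b \<bullet> c) * LD A p x
        + (of_real (x \<bullet> - A c) * dd b p x + of_real (x \<bullet> c) * LD A (dd b p) x))"
    unfolding dd_mult[OF h]
    by (subst LD_add[OF hpoly_cmult[OF h] hpoly.hpoly_mult[OF hpoly_dd[OF h]]])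
      (simp only: LD_cmult[OF h] LD_mult[OF A hpoly_dd[OF h]])
  ultimately show ?case
    by (simp only: dd_mult[OF h] bc fun_eq_iff) (simp add: algebra_simps)
qed auto

text \<open>Infinitesimal rotations preserve the Laplacian: in the product case the terms with
  \<open>dd (A b) p\<close> and \<open>dd (- A b) p\<close> cancel.\<close>

lemma Lap_LD:
  assumes A: "skew A" and h: "hpoly d p"
  shows "Lap (LD A p) = LD A (Lap p)"
  using h
proof (induction rule: hpoly.induct)
  case (hpoly_add d p q)
  have lin: "linear A" using A by (simp add: skew_def)
  show ?case
    using hpoly_add
    by (simp add: LD_add[OF hpoly_add.hyps] Lap_add[OF hpoly_add.hyps] LD_add[OF hpoly_Lap hpoly_Lap]
        Lap_add[OF hpoly_LD[OF hpoly_add.hyps(1) lin] hpoly_LD[OF hpoly_add.hyps(2) lin]])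
next
  case (hpoly_mult d p b)
  note h = hpoly_mult.hyps
  have lin: "linear A" using A by (simp add: skew_def)
  have neg: "dd (- A b) p x = - dd (A b) p x" for x
    using linear_neg[OF linear_dd[OF h]] .
  have "Lap (LD A (\<lambda>x. of_real (x \<bullet> b) * p x))
      = (\<lambda>x. (of_real (x \<bullet> - A b) * Lap p x + 2 * dd (- A b) p x)
        + (of_real (x \<bullet> b) * LD A (Lap p) x + 2 * (LD A (dd b p) x + dd (A b) p x)))"
    unfolding LD_mult[OF A h]
    by (subst Lap_add[OF hpoly.hpoly_mult[OF h] hpoly.hpoly_mult[OF hpoly_LD[OF h lin]]])
      (simp only: Lap_mult[OF h] Lap_mult[OF hpoly_LD[OF h lin]] dd_LD[OF A h] hpoly_mult.IH)
  moreover have "LD A (Lap (\<lambda>x. of_real (x \<bullet> b) * p x))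
      = (\<lambda>x. (of_real (x \<bullet> - A b) * Lap p x + of_real (x \<bullet> b) * LD A (Lap p) x)
         + 2 * LD A (dd b p) x)"
    unfolding Lap_mult[OF h]
    by (subst LD_add[OF hpoly.hpoly_mult[OF hpoly_Lap[OF h]] hpoly_cmult[OF hpoly_dd[OF h]]])
      (simp only: LD_cmult[OF hpoly_dd[OF h]] LD_mult[OF A hpoly_Lap[OF h]])
  ultimately show ?case
    by (simp only: neg fun_eq_iff) (simp add: algebra_simps)
qed auto

lemma Ck_on_hpoly: "hpoly d p \<Longrightarrow> Ck_on k UNIV p"
proof (induction k arbitrary: d p)
  case (Suc k)
  then show ?case
    using hpoly_dd[OF Suc.prems] hpoly_differentiable[OF Suc.prems] by (auto simp: dd_def)
qed (simp add: hpoly_continuous)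

section \<open>Decomposition into harmonic polynomials\<close>

definition nx2 :: "'a::euclidean_space \<Rightarrow> complex" where "nx2 x = of_real (x \<bullet> x)"

lemma hpoly_nx2: "hpoly 2 (nx2 :: 'a::euclidean_space \<Rightarrow> complex)"
proof -
  have "hpoly (Suc (Suc 0)) (\<lambda>x::'a. complex_of_real (x \<bullet> x))"
    by (rule hpoly_bilinear) (auto intro!: linearI simp: inner_add_left inner_add_right scaleR_conv_of_real)
  then show ?thesis by (simp add: nx2_def[abs_def] numeral_2_eq_2)
qed

lemma hpoly_nx2_power: "hpoly (2 * i) (\<lambda>x. nx2 x ^ i)"
proof (induction i)
  case 0 show ?case using hpoly_const[of 1] by simp
next
  case (Suc i)
  from hpoly_times[OF hpoly_nx2 Suc] show ?case by simp
qed

lemma dd_nx2: "dd v nx2 = (\<lambda>x. 2 * of_real (x \<bullet> v))"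
  unfolding nx2_def[abs_def]
  by (rule ext, rule ddI) (auto intro!: derivative_eq_intros simp: inner_commute)

lemma LD_nx2: "skew A \<Longrightarrow> LD A nx2 = (\<lambda>x. 0)"
proof -
  assume "skew A"
  then have "x \<bullet> A x = 0" for x
    by (metis add.inverse_neutral equal_neg_zero inner_commute skew_def)
  then show ?thesis by (simp add: LD_def dd_nx2)
qed

lemma LD_nx2_mult: "skew A \<Longrightarrow> hpoly d p \<Longrightarrow> LD A (\<lambda>x. nx2 x * p x) = (\<lambda>x. nx2 x * LD A p x)"
  by (simp add: LD_times[OF hpoly_nx2] LD_nx2)

text \<open>The Laplacian of the squared norm is \<open>2 * DIM('a)\<close>, and the cross term is
  four times the radial derivative, to which Euler's identity applies.\<close>

lemma Lap_nx2_mult: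
  fixes p :: "'a::euclidean_space \<Rightarrow> complex"
  assumes h: "hpoly d p"
  shows "Lap (\<lambda>x. nx2 x * p x)
    = (\<lambda>x. (2 * of_nat DIM('a) + 4 * of_nat d) * p x + nx2 x * Lap p x)"
proof
  fix x :: 'a
  have 1: "hpoly (Suc d) (\<lambda>x. 2 * (of_real (x \<bullet> b) * p x))" for b
    by (intro hpoly_cmult hpoly_mult h)
  have 2: "hpoly (2 + (d - 1)) (\<lambda>x. nx2 x * dd b p x)" for b
    by (intro hpoly_times hpoly_nx2 hpoly_dd h)
  have "dd b (\<lambda>x. nx2 x * p x) = (\<lambda>x. 2 * (of_real (x \<bullet> b) * p x) + nx2 x * dd b p x)" for b
    by (subst dd_times[OF hpoly_nx2 h]) (auto simp: dd_nx2 fun_eq_iff)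
  then have "dd b (dd b (\<lambda>x. nx2 x * p x)) x
      = 2 * of_real (b \<bullet> b) * p x + 4 * (of_real (x \<bullet> b) * dd b p x) + nx2 x * dd b (dd b p) x" for b
    by (simp only: dd_add[OF 1 2] dd_cmult[OF hpoly_mult[OF h]] dd_mult[OF h] dd_nx2
        dd_times[OF hpoly_nx2 hpoly_dd[OF h]]) (simp add: algebra_simps)
  then have "Lap (\<lambda>x. nx2 x * p x) x
      = (\<Sum>b\<in>(Basis::'a set). 2 * p x) + 4 * (\<Sum>b\<in>Basis. of_real (x \<bullet> b) * dd b p x)
        + nx2 x * Lap p x"
    by (simp add: Lap_def sum.distrib sum_distrib_left inner_Basis)
  also have "(\<Sum>b\<in>Basis. of_real (x \<bullet> b) * dd b p x) = of_nat d * p x"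
    using dd_basis_expand[OF h, of x x] Euler_identity[OF h, of x] by simp
  finally show "Lap (\<lambda>x. nx2 x * p x) x
      = (2 * of_nat DIM('a) + 4 * of_nat d) * p x + nx2 x * Lap p x"
    by (simp add: algebra_simps)
qed

text \<open>Each further factor \<open>nx2\<close> adds the contribution of
  \<open>Lap_nx2_mult\<close> at the current degree. The resulting coefficient is positive, so the
  Laplacian can be inverted on such terms.\<close>

lemma Lap_nx2_power_mult:
  fixes p :: "'a::euclidean_space \<Rightarrow> complex"
  assumes h: "hpoly d p" and harm: "Lap p = (\<lambda>x. 0)"
  shows "Lap (\<lambda>x. nx2 x ^ Suc j * p x)
    = (\<lambda>x. of_nat (2 * Suc j * (DIM('a) + 2 * d + 2 * j)) * (nx2 x ^ j * p x))"
proof (induction j)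
  case 0
  show ?case using Lap_nx2_mult[OF h] by (simp add: harm algebra_simps)
next
  case (Suc j)
  have "hpoly (2 * Suc j + d) (\<lambda>x. nx2 x ^ Suc j * p x)"
    by (intro hpoly_times hpoly_nx2_power h)
  note eq = Lap_nx2_mult[OF this]
  have "(\<lambda>x. nx2 x ^ Suc (Suc j) * p x) = (\<lambda>x. nx2 x * (nx2 x ^ Suc j * p x))"
    by (simp add: mult_ac)
  then show ?case
    by (simp only: eq Suc) (simp add: algebra_simps fun_eq_iff)
qed

text \<open>The decomposition of \<open>Lap p\<close>, known by induction, is inverted term by term
  to a polynomial \<open>s\<close> with the same Laplacian, and \<open>p - s\<close> is harmonic.
  The predicate \<open>Q\<close> transports a property to all components; later it is the eigenvalue
  equation for \<open>Gam\<close>.\<close>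

lemma harmonic_decomposition:
  fixes p :: "'a::euclidean_space \<Rightarrow> complex"
  assumes Q_add: "\<And>d p q. hpoly d p \<Longrightarrow> hpoly d q \<Longrightarrow> Q p \<Longrightarrow> Q q \<Longrightarrow> Q (\<lambda>x. p x + q x)"
    and Q_cmult: "\<And>d p c. hpoly d p \<Longrightarrow> Q p \<Longrightarrow> Q (\<lambda>x. c * p x)"
    and Q_nx2: "\<And>d p. hpoly d p \<Longrightarrow> Q p \<Longrightarrow> Q (\<lambda>x. nx2 x * p x)"
    and Q_Lap: "\<And>d p. hpoly d p \<Longrightarrow> Q p \<Longrightarrow> Q (Lap p)"
    and p: "hpoly d p" "Q p"
  shows "\<exists>\<psi>. (\<forall>i\<le>d div 2. hpoly (d - 2 * i) (\<psi> i) \<and> Lap (\<psi> i) = (\<lambda>x. 0) \<and> Q (\<psi> i))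
    \<and> p = (\<lambda>x. \<Sum>i\<le>d div 2. nx2 x ^ i * \<psi> i x)"
  using p
proof (induction d arbitrary: p rule: less_induct)
  case (less d)
  note p = less.prems
  show ?case
  proof (cases "d < 2")
    case True
    then show ?thesis
      using p Lap_low_degree[OF p(1)] by (intro exI[of _ "\<lambda>_. p"]) auto
  next
    case False
    define m where "m = (d - 2) div 2"
    have m: "d div 2 = Suc m" using False by (simp add: m_def div_if)
    obtain \<eta> where \<eta>: "\<And>i. i \<le> m \<Longrightarrow> hpoly (d - 2 - 2 * i) (\<eta> i)"
        "\<And>i. i \<le> m \<Longrightarrow> Lap (\<eta> i) = (\<lambda>x. 0)" "\<And>i. i \<le> m \<Longrightarrow> Q (\<eta> i)"
        "Lap p = (\<lambda>x. \<Sum>i\<le>m. nx2 x ^ i * \<eta> i x)"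
      using less.IH[of "d - 2" "Lap p"] hpoly_Lap[OF p(1)] Q_Lap[OF p] False
      unfolding m_def by fastforce
    \<comment> \<open>The coefficient of \<open>Lap_nx2_power_mult\<close> for the harmonic
      component \<open>\<eta> i\<close>, which has degree \<open>d - 2 - 2 * i\<close>.\<close>
    define c :: "nat \<Rightarrow> complex" where
      "c i = of_nat (2 * Suc i * (DIM('a) + 2 * (d - 2 - 2 * i) + 2 * i))" for i
    have c: "c i \<noteq> 0" for i
      using DIM_positive[where 'a='a] unfolding c_def of_nat_eq_0_iff by simp
    define \<phi> where "\<phi> i = (\<lambda>x. (1 / c i) * \<eta> i x)" for i
    have \<phi>: "hpoly (d - 2 - 2 * i) (\<phi> i)" "Lap (\<phi> i) = (\<lambda>x. 0)" "Q (\<phi> i)" if "i \<le> m" for i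
      unfolding \<phi>_def
      by (rule hpoly_cmult[OF \<eta>(1)[OF that]])
        (subst Lap_cmult[OF \<eta>(1)[OF that]], simp add: \<eta>(2)[OF that],
          rule Q_cmult[OF \<eta>(1,3)[OF that]])
    have Q_pow: "Q (\<lambda>x. nx2 x ^ j * q x)" if "hpoly e q" "Q q" for e q j
    proof (induction j)
      case 0 then show ?case using that by simp
    next
      case (Suc j)
      have "hpoly (2 * j + e) (\<lambda>x. nx2 x ^ j * q x)"
        by (intro hpoly_times hpoly_nx2_power that)
      from Q_nx2[OF this Suc] show ?case by (simp add: mult_ac)
    qed
    have deg: "2 * Suc i + (d - 2 - 2 * i) = d" if "i \<le> m" for i
      using that False by (auto simp: m_def)
    have trm: "hpoly d (\<lambda>x. nx2 x ^ Suc i * \<phi> i x)" "Q (\<lambda>x. nx2 x ^ Suc i * \<phi> i x)"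
        "Lap (\<lambda>x. nx2 x ^ Suc i * \<phi> i x) = (\<lambda>x. nx2 x ^ i * \<eta> i x)" if "i \<le> m" for i
    proof -
      show "hpoly d (\<lambda>x. nx2 x ^ Suc i * \<phi> i x)"
        using hpoly_times[OF hpoly_nx2_power[of "Suc i"] \<phi>(1)[OF that]] unfolding deg[OF that] .
      show "Q (\<lambda>x. nx2 x ^ Suc i * \<phi> i x)" by (rule Q_pow[OF \<phi>(1,3)[OF that]])
      have "Lap (\<lambda>x. nx2 x ^ Suc i * \<phi> i x) = (\<lambda>x. c i * (nx2 x ^ i * \<phi> i x))"
        unfolding c_def by (rule Lap_nx2_power_mult[OF \<phi>(1,2)[OF that]])
      then show "Lap (\<lambda>x. nx2 x ^ Suc i * \<phi> i x) = (\<lambda>x. nx2 x ^ i * \<eta> i x)"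
        using c[of i] by (simp add: \<phi>_def)
    qed
    define s where "s = (\<lambda>x. \<Sum>i\<le>m. nx2 x ^ Suc i * \<phi> i x)"
    have s: "hpoly d s" unfolding s_def by (intro hpoly_sum trm(1)) simp
    have Qs': "Q (\<lambda>x. \<Sum>i\<in>I. nx2 x ^ Suc i * \<phi> i x)" if "finite I" "I \<subseteq> {..m}" for I
      using that
    proof (induction I)
      case empty
      \<comment> \<open>The zero function inherits \<open>Q\<close> as the multiple
        \<open>0 * p\<close>.\<close>
      from Q_cmult[OF p, of 0] show ?case by simp
    next
      case (insert i I)
      have "hpoly d (\<lambda>x. \<Sum>i\<in>I. nx2 x ^ Suc i * \<phi> i x)"
        using insert.prems by (intro hpoly_sum trm(1)) auto
      from Q_add[OF trm(1) this trm(2)] insert show ?case by simp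
    qed
    have Qs: "Q s" unfolding s_def by (rule Qs') auto
    have "Lap s = Lap p"
      unfolding s_def \<eta>(4) by (subst Lap_sum[of _ d]) (auto intro!: trm(1) sum.cong simp: fun_eq_iff trm(3) simp del: power_Suc)
    define \<psi>0 where "\<psi>0 = (\<lambda>x. p x + (-1) * s x)"
    have \<psi>0: "hpoly d \<psi>0" "Q \<psi>0" "Lap \<psi>0 = (\<lambda>x. 0)"
    proof -
      note ms = hpoly_cmult[OF s, of "-1"] Q_cmult[OF s Qs, of "-1"]
      show "hpoly d \<psi>0" "Q \<psi>0"
        unfolding \<psi>0_def by (rule hpoly_add[OF p(1) ms(1)], rule Q_add[OF p(1) ms(1) p(2) ms(2)])
      show "Lap \<psi>0 = (\<lambda>x. 0)"
        unfolding \<psi>0_def Lap_add[OF p(1) ms(1)] Lap_cmult[OF s] \<open>Lap s = Lap p\<close> by simp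
    qed
    define \<psi> where "\<psi> i = (case i of 0 \<Rightarrow> \<psi>0 | Suc j \<Rightarrow> \<phi> j)" for i
    show ?thesis
    proof (intro exI[of _ \<psi>] conjI allI impI)
      fix i assume "i \<le> d div 2"
      then show "hpoly (d - 2 * i) (\<psi> i)" "Lap (\<psi> i) = (\<lambda>x. 0)" "Q (\<psi> i)"
        using \<psi>0 \<phi>[of "i - 1"] m by (auto simp: \<psi>_def split: nat.split)
    next
      show "p = (\<lambda>x. \<Sum>i\<le>d div 2. nx2 x ^ i * \<psi> i x)"
        unfolding m sum.atMost_Suc_shift by (simp add: \<psi>_def \<psi>0_def s_def)
    qed
  qed
qed

text \<open>Multiplying generators of degree \<open>d\<close> by the coordinates of
  \<open>Basis\<close> generates degree \<open>Suc d\<close>, because an arbitrary linear form is a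
  combination of coordinates.\<close>

lemma hpoly_finite_generators:
  "\<exists>G. finite G \<and> (\<forall>g\<in>G. hpoly d g) \<and>
    (\<forall>p :: 'a::euclidean_space \<Rightarrow> complex. hpoly d p \<longrightarrow> (\<exists>c. p = (\<lambda>x. \<Sum>g\<in>G. c g * g x)))"
proof -
  interpret vs: vector_space "\<lambda>(c::complex) (f::'a \<Rightarrow> complex) x. c * f x"
    by (rule fun_vector_space)
  have "\<exists>G. finite G \<and> (\<forall>g\<in>G. hpoly d g) \<and> (\<forall>p :: 'a \<Rightarrow> complex. hpoly d p \<longrightarrow> p \<in> vs.span G)"
  proof (induction d)
    case 0
    have "p \<in> vs.span {\<lambda>x. 1}" if "hpoly 0 p" for p :: "'a \<Rightarrow> complex"
      using that
    proof (induction "0::nat" p rule: hpoly.induct)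
      case (hpoly_const c)
      have "(\<lambda>x::'a. c * (\<lambda>x. 1) x) \<in> vs.span {\<lambda>x. 1}"
        by (intro vs.span_scale vs.span_base) simp
      then show ?case by simp
    next
      case (hpoly_add p q)
      then show ?case using vs.span_add[of p "{\<lambda>x. 1}" q] by (simp add: plus_fun_def)
    qed
    then show ?case using hpoly_const by (intro exI[of _ "{\<lambda>x. 1}"]) auto
  next
    case (Suc d)
    then obtain G where G: "finite G" "\<forall>g\<in>G. hpoly d g"
      "\<And>p :: 'a \<Rightarrow> complex. hpoly d p \<Longrightarrow> p \<in> vs.span G" by blast
    let ?G = "(\<lambda>(b, g) x. of_real (x \<bullet> b) * g x) ` (Basis \<times> G) :: ('a \<Rightarrow> complex) set"
    have *: "(\<lambda>x. of_real (x \<bullet> b) * p x) \<in> vs.span ?G" if "p \<in> vs.span G" "b \<in> Basis" for p b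
      using that(1)
    proof (induction rule: vs.span_induct_alt)
      case base
      have "(\<lambda>x::'a. of_real (x \<bullet> b) * (0 :: 'a \<Rightarrow> complex) x) = 0" by (simp add: fun_eq_iff)
      then show ?case by (simp only: vs.span_zero)
    next
      case (step c g p)
      have "(\<lambda>x. c * (\<lambda>x. of_real (x \<bullet> b) * g x) x) \<in> vs.span ?G"
        using step that(2) by (intro vs.span_scale vs.span_base) force
      from vs.span_add[OF this step(2)] show ?case
        by (simp add: plus_fun_def algebra_simps)
    qed
    have "p \<in> vs.span ?G" if "hpoly (Suc d) p" for p
      using that
    proof (induction "Suc d" p rule: hpoly.induct)
      case (hpoly_add p q)
      then show ?case using vs.span_add[of p ?G q] by (simp add: plus_fun_def)
    next
      case (hpoly_mult p b)
      have "(\<lambda>x. of_real (x \<bullet> b) * p x)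
          = (\<Sum>c\<in>Basis. (\<lambda>x. of_real (b \<bullet> c) * (\<lambda>x. of_real (x \<bullet> c) * p x) x))"
      proof
        fix x
        have "x \<bullet> b = (\<Sum>c\<in>Basis. (b \<bullet> c) * (x \<bullet> c))"
          by (subst euclidean_inner) (simp add: mult.commute)
        then show "of_real (x \<bullet> b) * p x
          = (\<Sum>c\<in>Basis. (\<lambda>x. of_real (b \<bullet> c) * (\<lambda>x. of_real (x \<bullet> c) * p x) x)) x"
          by (simp add: sum_fun_apply sum_distrib_right mult.assoc)
      qed
      also have "\<dots> \<in> vs.span ?G"
        using hpoly_mult G(3) by (intro vs.span_sum vs.span_scale *) auto
      finally show ?case .
    qed
    moreover have "finite ?G" using G(1) by simp
    moreover have "\<forall>g\<in>?G. hpoly (Suc d) g" using G(2) by (auto intro: hpoly_mult)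
    ultimately show ?case by blast
  qed
  then obtain G where G: "finite G" "\<forall>g\<in>G. hpoly d g"
    "\<And>p :: 'a \<Rightarrow> complex. hpoly d p \<Longrightarrow> p \<in> vs.span G" by blast
  have "\<exists>c. p = (\<lambda>x. \<Sum>g\<in>G. c g * g x)" if p: "hpoly d p" for p
  proof -
    obtain c where "p = (\<Sum>g\<in>G. (\<lambda>x. c g * g x))"
      using G(3)[OF p] vs.span_finite[OF G(1)] by auto
    then have "p = (\<lambda>x. \<Sum>g\<in>G. c g * g x)" by (simp add: fun_eq_iff sum_fun_apply)
    then show ?thesis by blast
  qed
  then show ?thesis using G by blast
qed

section \<open>Polynomial approximation\<close>

inductive cpoly :: "('a::euclidean_space \<Rightarrow> complex) \<Rightarrow> bool" where
  cpoly_hpoly: "hpoly d p \<Longrightarrow> cpoly p"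
| cpoly_add: "cpoly p \<Longrightarrow> cpoly q \<Longrightarrow> cpoly (\<lambda>x. p x + q x)"

lemma cpoly_cmult: "cpoly p \<Longrightarrow> cpoly (\<lambda>x. c * p x)"
  by (induction rule: cpoly.induct) (auto simp: ring_distribs intro: cpoly.intros hpoly_cmult)

lemma cpoly_times: "cpoly p \<Longrightarrow> cpoly q \<Longrightarrow> cpoly (\<lambda>x. p x * q x)"
proof (induction rule: cpoly.induct)
  case (cpoly_hpoly d p)
  from cpoly_hpoly(2) show ?case
    by (induction rule: cpoly.induct)
      (use cpoly_hpoly(1) in \<open>auto simp: ring_distribs intro: cpoly.intros hpoly_times\<close>)
qed (auto simp: ring_distribs intro: cpoly.intros)

lemma cpoly_real_polynomial_function:
  "real_polynomial_function p \<Longrightarrow> cpoly (\<lambda>x. of_real (p x))"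
proof (induction rule: real_polynomial_function.induct)
  case (linear f)
  then have "linear (\<lambda>x. complex_of_real (f x))"
    by (auto intro!: linearI simp: bounded_linear.linear linear_add linear_scale scaleR_conv_of_real)
  then show ?case by (rule cpoly_hpoly[OF hpoly_linear])
qed (auto intro: cpoly.intros cpoly_hpoly[OF hpoly_const] cpoly_times)

lemma cpoly_approximation:
  fixes f :: "'a::euclidean_space \<Rightarrow> complex"
  assumes "compact S" "continuous_on S f" "\<epsilon> > 0"
  obtains p where "cpoly p" "\<And>x. x \<in> S \<Longrightarrow> norm (f x - p x) < \<epsilon>"
proof -
  have "continuous_on S (\<lambda>x. Re (f x))" "continuous_on S (\<lambda>x. Im (f x))"
    using assms(2) by (auto intro: continuous_intros)
  then obtain p q where p: "real_polynomial_function p" "\<And>x. x \<in> S \<Longrightarrow> \<bar>Re (f x) - p x\<bar> < \<epsilon>/2"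
    and q: "real_polynomial_function q" "\<And>x. x \<in> S \<Longrightarrow> \<bar>Im (f x) - q x\<bar> < \<epsilon>/2"
    using Stone_Weierstrass_real_polynomial_function[OF assms(1), of _ "\<epsilon>/2"] assms(3)
    by (metis half_gt_zero)
  have "cpoly (\<lambda>x. of_real (p x) + \<i> * of_real (q x))"
    by (intro cpoly_add cpoly_cmult cpoly_real_polynomial_function p q)
  moreover have "norm (f x - (of_real (p x) + \<i> * of_real (q x))) < \<epsilon>" if "x \<in> S" for x
    using cmod_le[of "f x - (of_real (p x) + \<i> * of_real (q x))"] p(2)[OF that] q(2)[OF that] by simp
  ultimately show ?thesis using that by blast
qed

text \<open>Approximates the continuous functions \<open>max 0 (1 - n * infdist x K)\<close>.\<close>

lemma polynomials_tendsto_indicator: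
  fixes S K :: "'a::euclidean_space set"
  assumes "compact S" "compact K" "K \<noteq> {}"
  obtains P :: "nat \<Rightarrow> 'a \<Rightarrow> real" where "\<And>n. real_polynomial_function (P n)"
    "\<And>n x. x \<in> S \<Longrightarrow> \<bar>P n x\<bar> \<le> 2"
    "\<And>x. x \<in> S \<Longrightarrow> (\<lambda>n. P n x) \<longlonglongrightarrow> indicator K x"
proof -
  define f where "f n x = max 0 (1 - real n * infdist x K)" for n x
  have "\<exists>g. real_polynomial_function g \<and> (\<forall>x\<in>S. \<bar>f n x - g x\<bar> < 1 / real (Suc n))" for n
  proof -
    have "continuous_on S (f n)" unfolding f_def by (intro continuous_intros)
    from Stone_Weierstrass_real_polynomial_function[OF assms(1) this, of "1 / real (Suc n)"]
    obtain g where "real_polynomial_function g" "\<And>x. x \<in> S \<Longrightarrow> \<bar>f n x - g x\<bar> < 1 / real (Suc n)"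
      by auto
    then show ?thesis by blast
  qed
  then obtain P where P: "\<And>n. real_polynomial_function (P n)"
    "\<And>n x. x \<in> S \<Longrightarrow> \<bar>f n x - P n x\<bar> < 1 / real (Suc n)" by metis
  have f01: "0 \<le> f n x" "f n x \<le> 1" for n x by (auto simp: f_def infdist_nonneg)
  show ?thesis
  proof (rule that[of P])
    fix n x assume x: "x \<in> S"
    \<comment> \<open>The bound 2 is the bound 1 of \<open>f n\<close> plus an error of at most
      1.\<close>
    have "1 / real (Suc n) \<le> 1" by simp
    then show "\<bar>P n x\<bar> \<le> 2" using P(2)[OF x, of n] f01[of n x] by linarith
  next
    fix x assume x: "x \<in> S"
    have f_lim: "(\<lambda>n. f n x) \<longlonglongrightarrow> indicator K x"
    proof (cases "x \<in> K")
      case True then show ?thesis by (simp add: f_def)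
    next
      case False
      then have pos: "infdist x K > 0"
        using assms(2,3) infdist_pos_not_in_closed compact_imp_closed by blast
      obtain N where N: "1 < real N * infdist x K" using pos reals_Archimedean3 by blast
      have "f n x = 0" if "n \<ge> N" for n
      proof -
        have "real N * infdist x K \<le> real n * infdist x K"
          using that pos by (intro mult_right_mono) auto
        then show ?thesis using N by (simp add: f_def max_def)
      qed
      then have "\<forall>\<^sub>F n in sequentially. f n x = indicator K x"
        using False by (auto simp: eventually_sequentially)
      then show ?thesis by (rule tendsto_eventually)
    qed
    have "(\<lambda>n. f n x - P n x) \<longlonglongrightarrow> 0"
    proof (rule Lim_null_comparison)
      show "\<forall>\<^sub>F n in sequentially. norm (f n x - P n x) \<le> 1 / real (Suc n)"
        using P(2)[OF x] by (auto intro!: always_eventually less_imp_le)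
      show "(\<lambda>n. 1 / real (Suc n)) \<longlonglongrightarrow> 0" by (rule LIMSEQ_Suc[OF lim_1_over_n])
    qed
    from tendsto_diff[OF f_lim this] show "(\<lambda>n. P n x) \<longlonglongrightarrow> indicator K x" by simp
  qed (rule P(1))
qed

section \<open>The Laplace--Beltrami operator\<close>

text \<open>The derivative in direction \<open>w\<close>, expanded in coordinates so that it can be
  differentiated once more along a curve on which \<open>w\<close> varies.\<close>

definition grad :: "('a::euclidean_space \<Rightarrow> complex) \<Rightarrow> 'a \<Rightarrow> 'a \<Rightarrow> complex" where
  "grad g w y = (\<Sum>c\<in>Basis. of_real (w \<bullet> c) * dd c g y)"

definition hessq :: "('a::euclidean_space \<Rightarrow> complex) \<Rightarrow> 'a \<Rightarrow> 'a \<Rightarrow> 'a \<Rightarrow> complex" where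
  "hessq g w v y = (\<Sum>c\<in>Basis. \<Sum>e\<in>Basis. of_real (w \<bullet> c) * of_real (v \<bullet> e) * dd e (dd c g) y)"

lemma has_vector_derivative_compose_dd:
  assumes g: "g differentiable (at (\<gamma> t))" and \<gamma>: "(\<gamma> has_vector_derivative \<gamma>') (at t)"
  shows "((\<lambda>t. g (\<gamma> t)) has_vector_derivative dd \<gamma>' g (\<gamma> t)) (at t)"
    and "dd \<gamma>' g (\<gamma> t) = grad g \<gamma>' (\<gamma> t)"
proof -
  have D: "(g has_derivative (\<lambda>v. dd v g (\<gamma> t))) (at (\<gamma> t))"
    using g by (simp add: dd_def frechet_derivative_works)
  then have lin: "linear (\<lambda>v. dd v g (\<gamma> t))" by (rule has_derivative_linear)
  have "((\<lambda>t. g (\<gamma> t)) has_derivative (\<lambda>h. dd (h *\<^sub>R \<gamma>') g (\<gamma> t))) (at t)"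
    using has_derivative_compose[OF \<gamma>[unfolded has_vector_derivative_def] D] .
  then show "((\<lambda>t. g (\<gamma> t)) has_vector_derivative dd \<gamma>' g (\<gamma> t)) (at t)"
    by (simp add: has_vector_derivative_def linear_scale[OF lin])
  have "dd \<gamma>' g (\<gamma> t) = dd (\<Sum>b\<in>Basis. (\<gamma>' \<bullet> b) *\<^sub>R b) g (\<gamma> t)"
    by (simp add: euclidean_representation)
  also have "\<dots> = grad g \<gamma>' (\<gamma> t)"
    unfolding grad_def linear_sum[OF lin] linear_scale[OF lin] scaleR_conv_of_real ..
  finally show "dd \<gamma>' g (\<gamma> t) = grad g \<gamma>' (\<gamma> t)" .
qed

lemma C2_onD:
  assumes "Ck_on 2 U g" "open U"
  shows "x \<in> U \<Longrightarrow> g differentiable (at x)" "x \<in> U \<Longrightarrow> dd v g differentiable (at x)"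
    "continuous_on U (dd v g)" "continuous_on U (dd w (dd v g))"
proof -
  show d: "x \<in> U \<Longrightarrow> g differentiable (at x)" "x \<in> U \<Longrightarrow> dd v g differentiable (at x)" for x v
    using assms(1) by (auto simp: numeral_2_eq_2 dd_def)
  show "continuous_on U (dd w (dd v g))" for w v
    using assms(1) by (auto simp: numeral_2_eq_2 dd_def)
  show "continuous_on U (dd v g)"
    by (meson continuous_at_imp_continuous_on d(2) differentiable_imp_continuous_within)
qed

lemma C2_continuous_sphere:
  fixes g :: "'a::euclidean_space \<Rightarrow> complex"
  assumes "Ck_on 2 U g" "open U" "sphere 0 1 \<subseteq> U"
  shows "continuous_on (sphere 0 1) g"
  using C2_onD(1)[OF assms(1,2)] assms(3)
  by (intro continuous_at_imp_continuous_on ballI differentiable_imp_continuous_within) auto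

text \<open>The second derivative consists of an acceleration term and a Hessian term. It serves
  great circles as well as the orbits of rotation flows.\<close>

lemma curve_second_derivative:
  fixes g :: "'a::euclidean_space \<Rightarrow> complex"
  assumes g: "Ck_on 2 U g" "open U" and U: "\<gamma> t \<in> U"
    and \<gamma>: "(\<gamma> has_vector_derivative \<gamma>' t) (at t)" "(\<gamma>' has_vector_derivative \<gamma>'') (at t)"
  shows "((\<lambda>t. g (\<gamma> t)) has_vector_derivative grad g (\<gamma>' t) (\<gamma> t)) (at t)"
    and "((\<lambda>t. grad g (\<gamma>' t) (\<gamma> t)) has_vector_derivative
           grad g \<gamma>'' (\<gamma> t) + hessq g (\<gamma>' t) (\<gamma>' t) (\<gamma> t)) (at t)"
proof -
  show "((\<lambda>t. g (\<gamma> t)) has_vector_derivative grad g (\<gamma>' t) (\<gamma> t)) (at t)"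
    using has_vector_derivative_compose_dd[OF C2_onD(1)[OF g U] \<gamma>(1)] by simp
  have 1: "((\<lambda>t. dd c g (\<gamma> t)) has_vector_derivative
      (\<Sum>e\<in>Basis. of_real (\<gamma>' t \<bullet> e) * dd e (dd c g) (\<gamma> t))) (at t)" for c
    using has_vector_derivative_compose_dd[OF C2_onD(2)[OF g U] \<gamma>(1), of c] by (simp add: grad_def)
  have 2: "((\<lambda>t. complex_of_real (\<gamma>' t \<bullet> c)) has_vector_derivative of_real (\<gamma>'' \<bullet> c)) (at t)" for c
  proof -
    have "bounded_linear (\<lambda>x::'a. complex_of_real (x \<bullet> c))"
      by (intro bounded_linear_compose[OF bounded_linear_of_real bounded_linear_inner_left])
    from bounded_linear.has_vector_derivative[OF this \<gamma>(2)] show ?thesis .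
  qed
  have "((\<lambda>t. grad g (\<gamma>' t) (\<gamma> t)) has_vector_derivative
      (\<Sum>c\<in>Basis. of_real (\<gamma>' t \<bullet> c) * (\<Sum>e\<in>Basis. of_real (\<gamma>' t \<bullet> e) * dd e (dd c g) (\<gamma> t))
        + of_real (\<gamma>'' \<bullet> c) * dd c g (\<gamma> t))) (at t)"
    unfolding grad_def by (intro has_vector_derivative_sum has_vector_derivative_mult 1 2)
  then show "((\<lambda>t. grad g (\<gamma>' t) (\<gamma> t)) has_vector_derivative
           grad g \<gamma>'' (\<gamma> t) + hessq g (\<gamma>' t) (\<gamma>' t) (\<gamma> t)) (at t)"
    by (simp add: grad_def hessq_def sum.distrib sum_distrib_left mult.assoc add.commute)
qed

text \<open>A great circle has acceleration \<open>- \<gamma> t\<close>, whence the correction by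
  the radial derivative.\<close>

lemma sphere_hessian_eq:
  fixes g :: "'a::euclidean_space \<Rightarrow> complex"
  assumes g: "Ck_on 2 U g" "open U" "sphere 0 1 \<subseteq> U" and f: "\<And>y. y \<in> sphere 0 1 \<Longrightarrow> f y = g y"
    and x: "norm x = 1" and v: "norm v = 1" "v \<bullet> x = 0"
  shows "sphere_hessian f x v = hessq g v v x - grad g x x"
proof -
  define \<gamma> where "\<gamma> t = cos t *\<^sub>R x + sin t *\<^sub>R v" for t
  define \<gamma>' where "\<gamma>' t = - sin t *\<^sub>R x + cos t *\<^sub>R v" for t
  have S: "\<gamma> t \<in> sphere 0 1" for t
  proof -
    have "\<gamma> t \<bullet> \<gamma> t = (cos t)\<^sup>2 * (x \<bullet> x) + (sin t)\<^sup>2 * (v \<bullet> v)"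
      using v(2) by (simp add: \<gamma>_def inner_add_left inner_add_right inner_commute power2_eq_square)
    then show ?thesis using x v(1) by (simp add: norm_eq_sqrt_inner)
  qed
  have d: "(\<gamma> has_vector_derivative \<gamma>' t) (at t)" "(\<gamma>' has_vector_derivative - \<gamma> t) (at t)" for t
    unfolding \<gamma>_def \<gamma>'_def by (auto intro!: derivative_eq_intros)
  note sec = curve_second_derivative[OF g(1,2) subsetD[OF g(3) S] d]
  have "vector_derivative (\<lambda>s. f (cos s *\<^sub>R x + sin s *\<^sub>R v)) (at t) = grad g (\<gamma>' t) (\<gamma> t)" for t
    using vector_derivative_at[OF sec(1)[of t]] f[OF S] by (simp add: \<gamma>_def)
  then have "sphere_hessian f x v = vector_derivative (\<lambda>t. grad g (\<gamma>' t) (\<gamma> t)) (at 0)"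
    by (simp add: sphere_hessian_def)
  also have "\<dots> = grad g (- \<gamma> 0) (\<gamma> 0) + hessq g (\<gamma>' 0) (\<gamma>' 0) (\<gamma> 0)"
    by (rule vector_derivative_at[OF sec(2)])
  also have "\<dots> = hessq g v v x - grad g x x"
    by (simp add: \<gamma>_def \<gamma>'_def grad_def sum_negf)
  finally show ?thesis .
qed

text \<open>Lets the choice of a basis in \<open>laplace_beltrami\<close> be evaluated.\<close>

lemma tangent_onb_exists:
  fixes x :: "'a::euclidean_space"
  shows "\<exists>B. tangent_onb x B"
proof -
  have "subspace {v. v \<bullet> x = 0}" using subspace_hyperplane[of x] by (simp add: inner_commute)
  from orthonormal_basis_subspace[OF this]
  show ?thesis unfolding tangent_onb_def by metis
qed

lemma orthonormal_Parseval:
  fixes B :: "'a::euclidean_space set"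
  assumes "finite B" "pairwise orthogonal B" "\<And>v. v \<in> B \<Longrightarrow> norm v = 1" "span B = UNIV"
  shows "(\<Sum>v\<in>B. (v \<bullet> b) * (v \<bullet> c)) = b \<bullet> c"
proof -
  have "b = (\<Sum>v\<in>B. (b \<bullet> v) *\<^sub>R v)" using orthonormal_basis_expand[of B b] assms by auto
  then have "b \<bullet> c = (\<Sum>v\<in>B. (b \<bullet> v) *\<^sub>R v) \<bullet> c" by simp
  then show ?thesis by (simp add: inner_sum_left inner_commute[of b])
qed

text \<open>Together with \<open>x\<close> the tangent basis is an orthonormal basis of the whole
  space, on which the Hessian has trace \<open>Lap g\<close>. Each of the \<open>DIM('a) - 1\<close>
  great circles contributes one radial derivative.\<close>

lemma laplace_beltrami_eq:
  fixes g :: "'a::euclidean_space \<Rightarrow> complex"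
  assumes g: "Ck_on 2 U g" "open U" "sphere 0 1 \<subseteq> U" and f: "\<And>y. y \<in> sphere 0 1 \<Longrightarrow> f y = g y"
    and x: "x \<in> sphere 0 1"
  shows "laplace_beltrami f x = hessq g x x x + of_nat (DIM('a) - 1) * grad g x x - Lap g x"
proof -
  define B where "B = (SOME B. tangent_onb x B)"
  have B: "tangent_onb x B" unfolding B_def by (rule someI_ex[OF tangent_onb_exists])
  have nx: "norm x = 1" using x by simp
  have vx: "v \<bullet> x = 0" "norm v = 1" if "v \<in> B" for v
    using B that span_base[OF that] by (auto simp: tangent_onb_def)
  have fin: "finite B"
  proof -
    have "independent B"
      using B by (intro pairwise_orthogonal_independent) (auto simp: tangent_onb_def)
    then show ?thesis by (rule finiteI_independent)
  qed
  have xB: "x \<notin> B" using vx(1)[of x] nx by (auto simp: norm_eq_sqrt_inner)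
  let ?O = "insert x B"
  have orth: "pairwise orthogonal ?O"
    using B vx by (auto simp: tangent_onb_def pairwise_insert orthogonal_def inner_commute)
  have "y \<in> span ?O" for y
  proof -
    have "y - (y \<bullet> x) *\<^sub>R x \<in> span B"
      using B nx by (simp add: tangent_onb_def inner_diff_left norm_eq_sqrt_inner)
    then have "y - (y \<bullet> x) *\<^sub>R x \<in> span ?O" using span_mono[of B ?O] by blast
    moreover have "(y \<bullet> x) *\<^sub>R x \<in> span ?O" by (intro span_scale span_base) simp
    ultimately have "y - (y \<bullet> x) *\<^sub>R x + (y \<bullet> x) *\<^sub>R x \<in> span ?O" by (rule span_add)
    then show ?thesis by simp
  qed
  then have P: "(\<Sum>v\<in>?O. (v \<bullet> b) * (v \<bullet> c)) = b \<bullet> c" for b c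
    using fin orth vx nx by (intro orthonormal_Parseval) auto
  have card: "card ?O = DIM('a)"
  proof -
    \<comment> \<open>The cardinality is counted as a trace: the squared norms are expanded in
      \<open>Basis\<close>, the sums are swapped and \<open>P\<close> is applied.\<close>
    have "(\<Sum>v\<in>?O. v \<bullet> v) = (\<Sum>v\<in>?O. 1)"
      by (rule sum.cong) (auto simp: dot_square_norm vx nx)
    then have "real (card ?O) = (\<Sum>v\<in>?O. v \<bullet> v)"
      by (simp only: sum_constant mult_1_right)
    also have "\<dots> = (\<Sum>v\<in>?O. \<Sum>b\<in>Basis. (v \<bullet> b) * (v \<bullet> b))"
      by (intro sum.cong refl euclidean_inner)
    also have "\<dots> = (\<Sum>b\<in>Basis. b \<bullet> (b::'a))"
      by (subst sum.swap) (intro sum.cong refl P)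
    also have "\<dots> = real DIM('a)" by (simp add: inner_Basis)
    finally show ?thesis by simp
  qed
  have tr: "(\<Sum>v\<in>?O. hessq g v v x) = Lap g x"
  proof -
    have "(\<Sum>v\<in>?O. hessq g v v x)
        = (\<Sum>c\<in>Basis. \<Sum>e\<in>Basis. \<Sum>v\<in>?O. of_real (v \<bullet> c) * of_real (v \<bullet> e) * dd e (dd c g) x)"
      unfolding hessq_def
      by (rule trans[OF sum.swap], rule sum.cong[OF refl], rule sum.swap)
    also have "\<dots> = (\<Sum>c\<in>Basis. \<Sum>e\<in>Basis. of_real (\<Sum>v\<in>?O. (v \<bullet> c) * (v \<bullet> e)) * dd e (dd c g) x)"
      by (simp add: sum_distrib_right del: sum.insert)
    also have "\<dots> = (\<Sum>c\<in>Basis. \<Sum>e\<in>Basis. of_real (c \<bullet> e) * dd e (dd c g) x)"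
      by (simp only: P)
    also have "\<dots> = (\<Sum>c\<in>Basis. \<Sum>e\<in>Basis. if c = e then dd e (dd c g) x else 0)"
      by (intro sum.cong refl) (simp add: inner_Basis)
    also have "\<dots> = Lap g x" by (simp add: Lap_def)
    finally show ?thesis .
  qed
  have "laplace_beltrami f x = - (\<Sum>v\<in>B. hessq g v v x - grad g x x)"
    unfolding laplace_beltrami_def B_def[symmetric]
    using sphere_hessian_eq[OF g f nx vx(2,1)] by simp
  also have "\<dots> = of_nat (card B) * grad g x x - (\<Sum>v\<in>B. hessq g v v x)"
    by (simp add: sum_subtractf)
  also have "card B = DIM('a) - 1" using card fin xB by simp
  also have "(\<Sum>v\<in>B. hessq g v v x) = Lap g x - hessq g x x x"
    using tr fin xB by (simp add: algebra_simps)
  finally show ?thesis by simp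
qed

section \<open>Rotations of coordinate planes and the Laplace--Beltrami operator as a sum of
  squares\<close>

definition rot :: "'a::euclidean_space \<Rightarrow> 'a \<Rightarrow> real \<Rightarrow> 'a \<Rightarrow> 'a" where
  "rot a b t x = x + (cos t - 1) *\<^sub>R ((x \<bullet> a) *\<^sub>R a + (x \<bullet> b) *\<^sub>R b)
     + sin t *\<^sub>R ((x \<bullet> a) *\<^sub>R b - (x \<bullet> b) *\<^sub>R a)"

definition rotgen :: "'a::euclidean_space \<Rightarrow> 'a \<Rightarrow> 'a \<Rightarrow> 'a" where
  "rotgen a b x = (x \<bullet> a) *\<^sub>R b - (x \<bullet> b) *\<^sub>R a"

lemma linear_rotgen: "linear (rotgen a b)"
  by (rule linearI) (simp_all add: rotgen_def inner_add_left algebra_simps)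

lemma rot_isometry:
  assumes "a \<in> Basis" "b \<in> Basis" "a \<noteq> b"
  shows "isometry_lin (rot a b t)" "rot a b 0 x = x"
    "((\<lambda>t. rot a b t x) has_vector_derivative rotgen a b (rot a b t x)) (at t)"
proof -
  have ab: "a \<bullet> a = 1" "b \<bullet> b = 1" "a \<bullet> b = 0" "b \<bullet> a = 0"
    using assms by (auto simp: inner_Basis)
  have "norm (rot a b t x) = norm x" for x
  proof -
    have s: "sin t * (sin t * y) = y - cos t * (cos t * y)" for y
    proof -
      have "sin t * (sin t * y) = (sin t)\<^sup>2 * y" by (simp add: power2_eq_square)
      also have "\<dots> = y - cos t * (cos t * y)"
        unfolding sin_squared_eq by (simp add: power2_eq_square algebra_simps)
      finally show ?thesis .
    qed
    have "rot a b t x \<bullet> rot a b t x = x \<bullet> x"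
      by (simp add: rot_def inner_add_left inner_add_right inner_diff_left inner_diff_right
          inner_commute[of a x] inner_commute[of b x] ab s algebra_simps)
    then show ?thesis by (simp add: norm_eq_sqrt_inner)
  qed
  moreover have "linear (rot a b t)"
    by (rule linearI) (simp_all add: rot_def inner_add_left algebra_simps)
  ultimately show "isometry_lin (rot a b t)" by (simp add: isometry_lin_def)
  show "rot a b 0 x = x" by (simp add: rot_def)
  have "rotgen a b (rot a b t x) = - sin t *\<^sub>R ((x \<bullet> a) *\<^sub>R a + (x \<bullet> b) *\<^sub>R b)
     + cos t *\<^sub>R ((x \<bullet> a) *\<^sub>R b - (x \<bullet> b) *\<^sub>R a)"
    by (simp add: rot_def rotgen_def inner_add_left inner_diff_left ab algebra_simps)
  then show "((\<lambda>t. rot a b t x) has_vector_derivative rotgen a b (rot a b t x)) (at t)"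
    unfolding rot_def by (auto intro!: derivative_eq_intros)
qed

text \<open>An orbit has velocity \<open>A x\<close> and acceleration \<open>A (A x)\<close>, which
  are inserted into \<open>curve_second_derivative\<close>.\<close>

lemma flow_second_derivative:
  fixes g :: "'a::euclidean_space \<Rightarrow> complex"
  assumes g: "Ck_on 2 U g" "open U" "sphere 0 1 \<subseteq> U"
    and R: "\<And>t. isometry_lin (R t)"
      "\<And>x t. ((\<lambda>t. R t x) has_vector_derivative A (R t x)) (at t)" and A: "linear A"
  shows "flow_deriv R (restr g) (restr (\<lambda>y. grad g (A y) y))"
    "flow_deriv R (restr (\<lambda>y. grad g (A y) y))
      (restr (\<lambda>y. grad g (A (A y)) y + hessq g (A y) (A y) y))"
    "sphere_cont (restr g)" "sphere_cont (restr (\<lambda>y. grad g (A y) y))"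
    "sphere_cont (restr (\<lambda>y. grad g (A (A y)) y + hessq g (A y) (A y) y))"
proof -
  have S: "R t x \<in> sphere 0 1" if "x \<in> sphere 0 1" for x t
    using that isometry_linD(2)[OF R(1)] by simp
  have A2: "((\<lambda>t. A (R t x)) has_vector_derivative A (A (R t x))) (at t)" for x t
    using bounded_linear.has_vector_derivative[OF _ R(2)] A by (simp add: linear_conv_bounded_linear)
  have sec: "((\<lambda>t. g (R t x)) has_vector_derivative grad g (A (R t x)) (R t x)) (at t)"
    "((\<lambda>t. grad g (A (R t x)) (R t x)) has_vector_derivative
           grad g (A (A (R t x))) (R t x) + hessq g (A (R t x)) (A (R t x)) (R t x)) (at t)"
    if "x \<in> sphere 0 1" for x t
    using curve_second_derivative[OF g(1,2), of "\<lambda>t. R t x" t "\<lambda>t. A (R t x)"] S[OF that] g(3) R(2) A2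
    by blast+
  show "flow_deriv R (restr g) (restr (\<lambda>y. grad g (A y) y))"
    "flow_deriv R (restr (\<lambda>y. grad g (A y) y))
      (restr (\<lambda>y. grad g (A (A y)) y + hessq g (A y) (A y) y))"
    unfolding flow_deriv_def using sec S by (simp_all add: restr_def)
  have cA: "continuous_on (sphere 0 1) A"
    using A by (simp add: linear_conv_bounded_linear linear_continuous_on)
  then have cAA: "continuous_on (sphere 0 1) (\<lambda>x. A (A x))"
    using A by (intro continuous_on_compose2[OF linear_continuous_on[of A UNIV] cA])
      (auto simp: linear_conv_bounded_linear)
  note cg = C2_continuous_sphere[OF g]
  have c1: "continuous_on (sphere 0 1) (dd v g)" for v
    using C2_onD(3)[OF g(1,2)] g(3) continuous_on_subset by blast
  have c2: "continuous_on (sphere 0 1) (dd w (dd v g))" for v w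
    using C2_onD(4)[OF g(1,2)] g(3) continuous_on_subset by blast
  show "sphere_cont (restr g)" by (rule sphere_cont_restr[OF cg])
  show "sphere_cont (restr (\<lambda>y. grad g (A y) y))"
    unfolding grad_def by (intro sphere_cont_restr continuous_intros cA c1)
  show "sphere_cont (restr (\<lambda>y. grad g (A (A y)) y + hessq g (A y) (A y) y))"
    unfolding grad_def hessq_def by (intro sphere_cont_restr continuous_intros cA cAA c1 c2)
qed

text \<open>The right-hand side is twice the form of the projection onto the tangent space at
  \<open>x\<close>; ordered pairs count every plane twice.\<close>

lemma sum_rotgen_moment:
  fixes x :: "'a::euclidean_space"
  assumes "norm x = 1"
  shows "(\<Sum>a\<in>Basis. \<Sum>b\<in>Basis. (rotgen a b x \<bullet> c) * (rotgen a b x \<bullet> e)) = 2 * (c \<bullet> e) - 2 * (x \<bullet> c) * (x \<bullet> e)"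
proof -
  have E: "(\<Sum>a\<in>Basis. (a \<bullet> u) * (a \<bullet> v)) = u \<bullet> v" for u v :: 'a
    by (subst euclidean_inner[of u v]) (simp add: inner_commute)
  have 1: "(\<Sum>a\<in>Basis. (x \<bullet> a) * (x \<bullet> a)) = 1"
    using assms euclidean_inner[of x x] by (simp add: dot_square_norm)
  have "(\<Sum>a\<in>Basis. \<Sum>b\<in>Basis. (rotgen a b x \<bullet> c) * (rotgen a b x \<bullet> e))
     = (\<Sum>a\<in>Basis. \<Sum>b\<in>Basis. ((x \<bullet> a) * (x \<bullet> a)) * ((b \<bullet> c) * (b \<bullet> e)))
     - (\<Sum>a\<in>Basis. \<Sum>b\<in>Basis. ((a \<bullet> x) * (a \<bullet> e)) * ((b \<bullet> x) * (b \<bullet> c)))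
     - (\<Sum>a\<in>Basis. \<Sum>b\<in>Basis. ((a \<bullet> x) * (a \<bullet> c)) * ((b \<bullet> x) * (b \<bullet> e)))
     + (\<Sum>a\<in>Basis. \<Sum>b\<in>Basis. ((a \<bullet> c) * (a \<bullet> e)) * ((x \<bullet> b) * (x \<bullet> b)))"
    unfolding sum_subtractf[symmetric] sum.distrib[symmetric]
    by (intro sum.cong refl) (simp add: rotgen_def inner_diff_left inner_commute[of _ x] algebra_simps)
  also have "\<dots> = 2 * (c \<bullet> e) - 2 * (x \<bullet> c) * (x \<bullet> e)"
    unfolding sum_product[symmetric] E 1 by simp
  finally show ?thesis .
qed

text \<open>The square of a generator is minus the projection onto its plane. Every coordinate axis
  lies in \<open>DIM('a) - 1\<close> planes, each counted twice.\<close>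

lemma sum_rotgen_rotgen:
  fixes x :: "'a::euclidean_space"
  shows "(\<Sum>a\<in>Basis. \<Sum>b\<in>Basis. rotgen a b (rotgen a b x) \<bullet> c) = - 2 * (real DIM('a) - 1) * (x \<bullet> c)"
proof -
  have E: "(\<Sum>a\<in>Basis. (a \<bullet> u) * (a \<bullet> v)) = u \<bullet> v" for u v :: 'a
    by (subst euclidean_inner[of u v]) (simp add: inner_commute)
  have "(\<Sum>a\<in>Basis. \<Sum>b\<in>Basis. rotgen a b (rotgen a b x) \<bullet> c)
     = (\<Sum>b\<in>Basis. (\<Sum>a\<in>Basis. (a \<bullet> x) * (a \<bullet> b)) * (b \<bullet> c))
     - (\<Sum>a\<in>(Basis::'a set). \<Sum>b\<in>Basis. (b \<bullet> x) * (b \<bullet> c))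
     - (\<Sum>a\<in>Basis. \<Sum>b\<in>(Basis::'a set). (a \<bullet> x) * (a \<bullet> c))
     + (\<Sum>a\<in>Basis. (\<Sum>b\<in>Basis. (b \<bullet> x) * (b \<bullet> a)) * (a \<bullet> c))"
  proof -
    have t: "rotgen a b (rotgen a b x) \<bullet> c = (a \<bullet> x) * (a \<bullet> b) * (b \<bullet> c) - (b \<bullet> x) * (b \<bullet> c)
        - (a \<bullet> x) * (a \<bullet> c) + (b \<bullet> x) * (b \<bullet> a) * (a \<bullet> c)"
      if "a \<in> Basis" "b \<in> Basis" for a b
    proof -
      have "a \<bullet> a = 1" "b \<bullet> b = 1" using that by (auto simp: inner_Basis)
      then show ?thesis
        by (simp add: rotgen_def inner_diff_left inner_commute[of x a] inner_commute[of x b]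
            inner_commute[of b a] algebra_simps)
    qed
    have "(\<Sum>a\<in>Basis. \<Sum>b\<in>Basis. rotgen a b (rotgen a b x) \<bullet> c)
       = (\<Sum>a\<in>Basis. \<Sum>b\<in>Basis. (a \<bullet> x) * (a \<bullet> b) * (b \<bullet> c) - (b \<bullet> x) * (b \<bullet> c)
        - (a \<bullet> x) * (a \<bullet> c) + (b \<bullet> x) * (b \<bullet> a) * (a \<bullet> c))"
      by (intro sum.cong refl t)
    also have "\<dots> = (\<Sum>a\<in>Basis. \<Sum>b\<in>Basis. (a \<bullet> x) * (a \<bullet> b) * (b \<bullet> c))
      - (\<Sum>a\<in>(Basis::'a set). \<Sum>b\<in>Basis. (b \<bullet> x) * (b \<bullet> c))
      - (\<Sum>a\<in>Basis. \<Sum>b\<in>(Basis::'a set). (a \<bullet> x) * (a \<bullet> c))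
      + (\<Sum>a\<in>Basis. \<Sum>b\<in>Basis. (b \<bullet> x) * (b \<bullet> a) * (a \<bullet> c))"
      by (simp only: sum.distrib sum_subtractf)
    also have "(\<Sum>a\<in>Basis. \<Sum>b\<in>Basis. (a \<bullet> x) * (a \<bullet> b) * (b \<bullet> c))
        = (\<Sum>b\<in>Basis. (\<Sum>a\<in>Basis. (a \<bullet> x) * (a \<bullet> b)) * (b \<bullet> c))"
      unfolding sum_distrib_right by (rule sum.swap)
    also have "(\<Sum>a\<in>Basis. \<Sum>b\<in>Basis. (b \<bullet> x) * (b \<bullet> a) * (a \<bullet> c))
        = (\<Sum>a\<in>Basis. (\<Sum>b\<in>Basis. (b \<bullet> x) * (b \<bullet> a)) * (a \<bullet> c))"
      unfolding sum_distrib_right ..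
    finally show ?thesis .
  qed
  also have "\<dots> = - 2 * (real DIM('a) - 1) * (x \<bullet> c)"
  proof -
    have E': "(\<Sum>b\<in>Basis. (x \<bullet> b) * (b \<bullet> c)) = x \<bullet> c"
      using E[of x c] by (simp add: inner_commute)
    show ?thesis unfolding E E' sum_constant sum_distrib_left[symmetric] by (simp add: algebra_simps)
  qed
  finally show ?thesis .
qed

lemma sum_swap4:
  fixes T :: "'a \<Rightarrow> 'b \<Rightarrow> 'c \<Rightarrow> 'd \<Rightarrow> 'e::comm_monoid_add"
  shows "(\<Sum>a\<in>A. \<Sum>b\<in>B. \<Sum>c\<in>C. \<Sum>d\<in>D. T a b c d) = (\<Sum>c\<in>C. \<Sum>d\<in>D. \<Sum>a\<in>A. \<Sum>b\<in>B. T a b c d)"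
proof -
  have "(\<Sum>a\<in>A. \<Sum>b\<in>B. \<Sum>c\<in>C. \<Sum>d\<in>D. T a b c d) = (\<Sum>a\<in>A. \<Sum>c\<in>C. \<Sum>b\<in>B. \<Sum>d\<in>D. T a b c d)"
    by (rule sum.cong[OF refl], rule sum.swap)
  also have "\<dots> = (\<Sum>c\<in>C. \<Sum>a\<in>A. \<Sum>b\<in>B. \<Sum>d\<in>D. T a b c d)" by (rule sum.swap)
  also have "\<dots> = (\<Sum>c\<in>C. \<Sum>a\<in>A. \<Sum>d\<in>D. \<Sum>b\<in>B. T a b c d)"
    by (rule sum.cong[OF refl], rule sum.cong[OF refl], rule sum.swap)
  also have "\<dots> = (\<Sum>c\<in>C. \<Sum>d\<in>D. \<Sum>a\<in>A. \<Sum>b\<in>B. T a b c d)"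
    by (rule sum.cong[OF refl], rule sum.swap)
  finally show ?thesis .
qed

text \<open>The moments of the generators reproduce the formula of
  \<open>laplace_beltrami_eq\<close>, with 1/2 compensating for the double count of planes. In this
  form the operator is accessible to integration by parts.\<close>

lemma laplace_beltrami_rotations:
  fixes g :: "'a::euclidean_space \<Rightarrow> complex"
  assumes g: "Ck_on 2 U g" "open U" "sphere 0 1 \<subseteq> U" and f: "\<And>y. y \<in> sphere 0 1 \<Longrightarrow> f y = g y"
    and x: "x \<in> sphere 0 1"
  shows "laplace_beltrami f x = - (1 / 2) * (\<Sum>(a, b)\<in>{(a, b) \<in> Basis \<times> Basis. a \<noteq> b}.
     grad g (rotgen a b (rotgen a b x)) x + hessq g (rotgen a b x) (rotgen a b x) x)"
proof -
  let ?G = "\<lambda>a b. grad g (rotgen a b (rotgen a b x)) x"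
  let ?H = "\<lambda>a b. hessq g (rotgen a b x) (rotgen a b x) x"
  have nx: "norm x = 1" using x by simp
  \<comment> \<open>The generator of a diagonal pair is zero, so the sum extends to all
    pairs.\<close>
  have "(\<Sum>(a, b)\<in>{(a, b) \<in> Basis \<times> Basis. a \<noteq> b}. ?G a b + ?H a b)
      = (\<Sum>(a, b)\<in>Basis \<times> Basis. ?G a b + ?H a b)"
    by (rule sum.mono_neutral_left) (auto simp: rotgen_def grad_def hessq_def)
  also have "\<dots> = (\<Sum>a\<in>Basis. \<Sum>b\<in>Basis. ?G a b) + (\<Sum>a\<in>Basis. \<Sum>b\<in>Basis. ?H a b)"
    by (simp add: sum.cartesian_product[symmetric] sum.distrib)
  also have "(\<Sum>a\<in>Basis. \<Sum>b\<in>Basis. ?G a b)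
      = (\<Sum>c\<in>Basis. of_real (\<Sum>a\<in>Basis. \<Sum>b\<in>Basis. rotgen a b (rotgen a b x) \<bullet> c) * dd c g x)"
  proof -
    have "(\<Sum>a\<in>Basis. \<Sum>b\<in>Basis. ?G a b) = (\<Sum>a\<in>Basis. \<Sum>c\<in>Basis. \<Sum>b\<in>Basis.
        of_real (rotgen a b (rotgen a b x) \<bullet> c) * dd c g x)"
      unfolding grad_def by (intro sum.cong refl sum.swap)
    also have "\<dots> = (\<Sum>c\<in>Basis. \<Sum>a\<in>Basis. \<Sum>b\<in>Basis.
        of_real (rotgen a b (rotgen a b x) \<bullet> c) * dd c g x)" by (rule sum.swap)
    finally show ?thesis by (simp add: sum_distrib_right)
  qed
  also have "\<dots> = (\<Sum>c\<in>Basis. of_real (- 2 * (real DIM('a) - 1) * (x \<bullet> c)) * dd c g x)"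
    by (simp only: sum_rotgen_rotgen)
  also have "\<dots> = - 2 * of_real (real DIM('a) - 1) * grad g x x"
    by (simp add: grad_def sum_distrib_left mult.assoc sum_negf[symmetric])
  also have "(\<Sum>a\<in>Basis. \<Sum>b\<in>Basis. ?H a b) = (\<Sum>c\<in>Basis. \<Sum>e\<in>Basis.
      of_real (\<Sum>a\<in>Basis. \<Sum>b\<in>Basis. (rotgen a b x \<bullet> c) * (rotgen a b x \<bullet> e)) * dd e (dd c g) x)"
  proof -
    let ?T = "\<lambda>a b c e. complex_of_real (rotgen a b x \<bullet> c) * of_real (rotgen a b x \<bullet> e) * dd e (dd c g) x"
    have "(\<Sum>a\<in>Basis. \<Sum>b\<in>Basis. ?H a b)
        = (\<Sum>c\<in>Basis. \<Sum>e\<in>Basis. \<Sum>a\<in>Basis. \<Sum>b\<in>Basis. ?T a b c e)"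
      unfolding hessq_def by (rule sum_swap4)
    then show ?thesis by (simp add: sum_distrib_right)
  qed
  also have "\<dots> = (\<Sum>c\<in>Basis. \<Sum>e\<in>Basis. of_real (2 * (c \<bullet> e) - 2 * (x \<bullet> c) * (x \<bullet> e)) * dd e (dd c g) x)"
    by (simp only: sum_rotgen_moment[OF nx])
  also have "\<dots> = 2 * (\<Sum>c\<in>Basis. \<Sum>e\<in>Basis. of_real (c \<bullet> e) * dd e (dd c g) x) - 2 * hessq g x x x"
    by (simp add: hessq_def sum_subtractf sum_distrib_left algebra_simps)
  also have "(\<Sum>c\<in>Basis. \<Sum>e\<in>Basis. of_real (c \<bullet> e) * dd e (dd c g) x)
      = (\<Sum>c\<in>Basis. \<Sum>e\<in>Basis. if c = e then dd e (dd c g) x else 0)"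
    by (intro sum.cong refl) (simp add: inner_Basis)
  also have "\<dots> = Lap g x" by (simp add: Lap_def)
  finally have eq: "(\<Sum>(a, b)\<in>{(a, b) \<in> Basis \<times> Basis. a \<noteq> b}. ?G a b + ?H a b)
      = - 2 * of_real (real DIM('a) - 1) * grad g x x + (2 * Lap g x - 2 * hessq g x x x)" .
  have "complex_of_nat (DIM('a) - 1) = of_real (real DIM('a) - 1)"
    using DIM_positive[where 'a='a] by (simp add: of_nat_diff Suc_leI)
  note k = this
  have alg: "H + k * G - L = - (1 / 2) * (- 2 * k * G + (2 * L - 2 * H))" for H k G L :: complex
    by (simp add: algebra_simps)
  have "laplace_beltrami f x = hessq g x x x + of_nat (DIM('a) - 1) * grad g x x - Lap g x"
    by (rule laplace_beltrami_eq[OF g f x])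
  then show ?thesis
    by (simp only: eq k alg)
qed

text \<open>Every summand is a second derivative along an isometric flow and moves to the other
  factor by two integrations by parts. The pairing is bilinear, without conjugation.\<close>

lemma laplace_beltrami_symmetric:
  fixes g w :: "'a::euclidean_space \<Rightarrow> complex"
  assumes g: "Ck_on 2 U g" "open U" "sphere 0 1 \<subseteq> U" and f: "f = restr g"
    and w: "Ck_on 2 W w" "open W" "sphere 0 1 \<subseteq> W" and v: "v = restr w"
  shows "(\<integral>x. restr (laplace_beltrami f) x * v x \<partial>sphere_measure)
       = (\<integral>x. f x * restr (laplace_beltrami v) x \<partial>sphere_measure)"
proof -
  let ?P = "{(a::'a, b::'a) \<in> Basis \<times> Basis. a \<noteq> b}"
  define D1 where "D1 g ab = restr (\<lambda>y. grad g (rotgen (fst ab) (snd ab) y) y)" for g :: "'a \<Rightarrow> complex" and ab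
  define D2 where "D2 g ab = restr (\<lambda>y. grad g (rotgen (fst ab) (snd ab) (rotgen (fst ab) (snd ab) y)) y
     + hessq g (rotgen (fst ab) (snd ab) y) (rotgen (fst ab) (snd ab) y) y)" for g :: "'a \<Rightarrow> complex" and ab
  have fin: "finite ?P" by (rule finite_subset[of _ "Basis \<times> Basis"]) auto
  have rep: "restr (laplace_beltrami (restr g)) = (\<lambda>x. - (1 / 2) * (\<Sum>ab\<in>?P. D2 g ab x))"
    if "Ck_on 2 U g" "open U" "sphere 0 1 \<subseteq> U" for g :: "'a \<Rightarrow> complex" and U
  proof
    fix x
    show "restr (laplace_beltrami (restr g)) x = - (1 / 2) * (\<Sum>ab\<in>?P. D2 g ab x)"
    proof (cases "x \<in> sphere 0 1")
      case True
      from laplace_beltrami_rotations[OF that _ True, of "restr g"] True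
      show ?thesis by (simp add: restr_def D2_def case_prod_unfold)
    next
      case False then show ?thesis by (simp add: restr_def D2_def)
    qed
  qed
  have cf: "sphere_cont f" "sphere_cont v"
    unfolding f v by (rule sphere_cont_restr[OF C2_continuous_sphere[OF g]],
        rule sphere_cont_restr[OF C2_continuous_sphere[OF w]])
  have flow: "(\<integral>x. D2 g ab x * v x \<partial>sphere_measure) = (\<integral>x. f x * D2 w ab x \<partial>sphere_measure)"
    and cont: "sphere_cont (D2 g ab)" "sphere_cont (D2 w ab)"
    if "ab \<in> ?P" for ab
  proof -
    have ab: "fst ab \<in> Basis" "snd ab \<in> Basis" "fst ab \<noteq> snd ab" using that by auto
    note R = rot_isometry[OF ab]
    note G = flow_second_derivative[OF g R(1,3) linear_rotgen, folded D1_def D2_def]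
    note W = flow_second_derivative[OF w R(1,3) linear_rotgen, folded D1_def D2_def]
    show "sphere_cont (D2 g ab)" "sphere_cont (D2 w ab)"
      using G(5) W(5) by simp_all
    have "(\<integral>x. D2 g ab x * v x \<partial>sphere_measure) = - (\<integral>x. D1 g ab x * D1 w ab x \<partial>sphere_measure)"
      unfolding v by (rule flow_integration_by_parts[OF R(1,2) G(4,5,2) W(3,4,1)])
    also have "\<dots> = (\<integral>x. f x * D2 w ab x \<partial>sphere_measure)"
      unfolding f using flow_integration_by_parts[OF R(1,2) G(3,4,1) W(4,5,2)] by simp
    finally show "(\<integral>x. D2 g ab x * v x \<partial>sphere_measure) = (\<integral>x. f x * D2 w ab x \<partial>sphere_measure)" .
  qed
  define P where "P = ?P"
  note rep = rep[folded P_def] and flow = flow[folded P_def] and cont = cont[folded P_def]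
  have int: "integrable sphere_measure (\<lambda>x. D2 g ab x * v x)"
    "integrable sphere_measure (\<lambda>x. f x * D2 w ab x)" if "ab \<in> P" for ab
    using cont[OF that] cf by (auto intro!: integrable_sphere_cont sphere_cont_mult)
  have "(\<integral>x. restr (laplace_beltrami f) x * v x \<partial>sphere_measure)
      = (\<integral>x. - (1 / 2) * (\<Sum>ab\<in>P. D2 g ab x * v x) \<partial>sphere_measure)"
    unfolding f rep[OF g] by (simp add: sum_distrib_right mult.assoc)
  also have "\<dots> = - (1 / 2) * (\<Sum>ab\<in>P. \<integral>x. D2 g ab x * v x \<partial>sphere_measure)"
    unfolding integral_mult_right_zero by (subst Bochner_Integration.integral_sum) (auto intro: int)
  also have "\<dots> = - (1 / 2) * (\<Sum>ab\<in>P. \<integral>x. f x * D2 w ab x \<partial>sphere_measure)"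
    by (simp add: flow)
  also have "\<dots> = (\<integral>x. - (1 / 2) * (\<Sum>ab\<in>P. f x * D2 w ab x) \<partial>sphere_measure)"
    unfolding integral_mult_right_zero by (subst Bochner_Integration.integral_sum) (auto intro: int)
  also have "\<dots> = (\<integral>x. f x * restr (laplace_beltrami v) x \<partial>sphere_measure)"
    unfolding v rep[OF w] by (simp add: sum_distrib_left algebra_simps)
  finally show ?thesis .
qed

section \<open>Eigenfunctions of the Laplace--Beltrami operator\<close>

lemma grad_hpoly: "hpoly d p \<Longrightarrow> grad p x x = of_nat d * p x"
  unfolding grad_def using dd_basis_expand[of d p x x] Euler_identity[of d p x] by simp

lemma hessq_hpoly:
  assumes h: "hpoly d p" shows "hessq p x x x = of_nat d * of_nat (d - 1) * p x"
proof -
  have "hessq p x x x = (\<Sum>c\<in>Basis. of_real (x \<bullet> c) * grad (dd c p) x x)"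
    by (simp add: hessq_def grad_def sum_distrib_left mult.assoc)
  also have "\<dots> = of_nat (d - 1) * grad p x x"
    unfolding grad_hpoly[OF hpoly_dd[OF h]] by (simp add: grad_def sum_distrib_left mult_ac)
  finally show ?thesis by (simp add: grad_hpoly[OF h])
qed

text \<open>The radial Hessian gives \<open>d (d - 1)\<close> and the radial derivative
  \<open>(N - 1) d\<close>, where \<open>N\<close> is the dimension; they add up to
  \<open>d (d + N - 2)\<close>.\<close>

lemma laplace_beltrami_hpoly:
  fixes p :: "'a::euclidean_space \<Rightarrow> complex"
  assumes h: "hpoly d p" and x: "x \<in> sphere 0 1"
  shows "laplace_beltrami (restr p) x = of_real (real d * (real d + real DIM('a) - 2)) * p x - Lap p x"
proof -
  have "laplace_beltrami (restr p) x = hessq p x x x + of_nat (DIM('a) - 1) * grad p x x - Lap p x"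
    by (rule laplace_beltrami_eq[OF Ck_on_hpoly[OF h] _ _ _ x]) (auto simp: restr_def)
  moreover have "complex_of_nat (DIM('a) - 1) = of_nat DIM('a) - 1"
    using DIM_positive[where 'a='a] by (simp add: of_nat_diff Suc_leI)
  moreover have "complex_of_nat d * of_nat (d - 1) = of_nat d * (of_nat d - 1)"
    by (cases d) auto
  ultimately show ?thesis
    by (simp only: hessq_hpoly[OF h] grad_hpoly[OF h]) (simp add: algebra_simps)
qed

lemma dd_cnj: "hpoly d p \<Longrightarrow> dd v (\<lambda>x. cnj (p x)) = (\<lambda>x. cnj (dd v p x))"
  by (rule ext, rule ddI)
    (intro bounded_linear.has_derivative[OF bounded_linear_cnj] hpoly_has_derivative)

lemma Lap_cnj: "hpoly d p \<Longrightarrow> Lap (\<lambda>x. cnj (p x)) = (\<lambda>x. cnj (Lap p x))"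
  by (simp add: Lap_def dd_cnj dd_cnj[OF hpoly_dd])

lemma LD_cnj: "hpoly d p \<Longrightarrow> LD A (\<lambda>x. cnj (p x)) = (\<lambda>x. cnj (LD A p x))"
  by (simp add: LD_def dd_cnj)

text \<open>The difference factors as \<open>(d - h) (d + h + N - 2)\<close>, and the second factor
  vanishes only if \<open>d = h = 0\<close>.\<close>

lemma eigenvalue_inj:
  assumes "2 \<le> N" "real d * (real d + real N - 2) = real h * (real h + real N - 2)"
  shows "d = h"
proof -
  have "(real d - real h) * (real d + real h + (real N - 2)) = 0"
    using assms(2) by (simp add: algebra_simps)
  then have "real d = real h \<or> real d + real h + (real N - 2) = 0" by auto
  then show ?thesis using assms(1) by auto
qed

lemma smooth_on_sphere_hpoly: "hpoly d p \<Longrightarrow> smooth_on_sphere (restr p)"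
  unfolding smooth_on_sphere_def
  by (intro exI[of _ UNIV] exI[of _ p]) (auto simp: Ck_on_hpoly restr_def)

lemma sphere_cont_hpoly: "hpoly d p \<Longrightarrow> sphere_cont (restr p)"
  by (intro sphere_cont_restr hpoly_continuous)

text \<open>Like \<open>harmonics\<close>, but without the condition on \<open>Gamma_op\<close> and
  on a sphere of any dimension.\<close>

definition laplace_eigen :: "nat \<Rightarrow> ('a::euclidean_space \<Rightarrow> complex) \<Rightarrow> bool" where
  "laplace_eigen h f \<longleftrightarrow> smooth_on_sphere f \<and> (\<forall>x. x \<notin> sphere 0 1 \<longrightarrow> f x = 0) \<and>
     (\<forall>x\<in>sphere 0 1. laplace_beltrami f x = of_real (real h * (real h + real DIM('a) - 2)) * f x)"

lemma laplace_eigen_hpoly: "hpoly h p \<Longrightarrow> Lap p = (\<lambda>x. 0) \<Longrightarrow> laplace_eigen h (restr p)"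
  by (simp add: laplace_eigen_def smooth_on_sphere_hpoly laplace_beltrami_hpoly[of h] restr_on restr_off
      del: mem_sphere_0 mem_sphere)

lemma sphere_cont_laplace_eigen: "laplace_eigen h f \<Longrightarrow> sphere_cont f"
proof -
  assume *: "laplace_eigen h f"
  then obtain U g where "open U" "sphere 0 1 \<subseteq> U" "\<forall>k. Ck_on k U g" "\<forall>x\<in>sphere 0 1. f x = g x"
    unfolding laplace_eigen_def smooth_on_sphere_def by blast
  then show ?thesis
    using * C2_continuous_sphere[of U g] unfolding laplace_eigen_def sphere_cont_def
    by (auto intro: continuous_on_eq)
qed

lemma laplace_eigen_orthogonal:
  fixes f :: "'a::euclidean_space \<Rightarrow> complex"
  assumes N: "DIM('a) \<ge> 2" and f: "laplace_eigen h f"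
    and p: "hpoly d p" "Lap p = (\<lambda>x. 0)" and neq: "d \<noteq> h"
  shows "L2_inner f (restr p) = 0"
proof -
  \<comment> \<open>The symmetry is bilinear whereas \<open>L2_inner\<close> conjugates its second
    argument, so it is applied to the conjugate of \<open>p\<close>.\<close>
  define w where "w = (\<lambda>x. cnj (p x))"
  have w: "hpoly d w" "Lap w = (\<lambda>x. 0)" using p by (simp_all add: w_def hpoly_cnj Lap_cnj)
  obtain U g where g: "open U" "sphere 0 1 \<subseteq> U" "Ck_on 2 U g" "\<And>x. x \<in> sphere 0 1 \<Longrightarrow> f x = g x"
    using f unfolding laplace_eigen_def smooth_on_sphere_def by blast
  have fg: "f = restr g" using g(4) f by (auto simp: restr_def laplace_eigen_def fun_eq_iff)
  let ?lh = "complex_of_real (real h * (real h + real DIM('a) - 2))"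
  let ?ld = "complex_of_real (real d * (real d + real DIM('a) - 2))"
  have "(\<integral>x. restr (laplace_beltrami f) x * restr w x \<partial>sphere_measure)
      = (\<integral>x. f x * restr (laplace_beltrami (restr w)) x \<partial>sphere_measure)"
    by (rule laplace_beltrami_symmetric[OF g(3,1,2) fg Ck_on_hpoly[OF w(1)] open_UNIV subset_UNIV refl])
  moreover have "restr (laplace_beltrami f) = (\<lambda>x. ?lh * f x)"
    using f by (auto simp: restr_def laplace_eigen_def fun_eq_iff)
  moreover have "restr (laplace_beltrami (restr w)) = (\<lambda>x. ?ld * restr w x)"
  proof
    fix x show "restr (laplace_beltrami (restr w)) x = ?ld * restr w x"
      using w by (cases "x \<in> sphere 0 1")
        (simp_all add: restr_on restr_off laplace_beltrami_hpoly[OF w(1)] del: mem_sphere_0 mem_sphere)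
  qed
  moreover have "restr w = (\<lambda>x. cnj (restr p x))" by (auto simp: w_def restr_def)
  ultimately have "(\<integral>x. ?lh * (f x * cnj (restr p x)) \<partial>sphere_measure)
      = (\<integral>x. ?ld * (f x * cnj (restr p x)) \<partial>sphere_measure)"
    by (simp add: mult_ac)
  then have "?lh * L2_inner f (restr p) = ?ld * L2_inner f (restr p)"
    by (simp add: L2_inner_def)
  moreover have "?lh \<noteq> ?ld"
    unfolding of_real_eq_iff using eigenvalue_inj[OF N, of d h] neq by metis
  ultimately show ?thesis by (metis mult_cancel_right)
qed

lemma harmonic_restr_basis:
  "\<exists>B. orthonormal_basis {restr p | p :: 'a::euclidean_space \<Rightarrow> complex. hpoly h p \<and> Lap p = (\<lambda>x. 0)} B"
proof -
  let ?X = "{restr p | p :: 'a \<Rightarrow> complex. hpoly h p \<and> Lap p = (\<lambda>x. 0)}"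
  obtain G where G: "finite G" "\<And>g. g \<in> G \<Longrightarrow> hpoly h g"
    "\<And>p :: 'a \<Rightarrow> complex. hpoly h p \<Longrightarrow> \<exists>c. p = (\<lambda>x. \<Sum>g\<in>G. c g * g x)"
    using hpoly_finite_generators[of h] by metis
  \<comment> \<open>Injectivity lets coefficients indexed by \<open>G\<close> be reindexed by the
    restricted functions.\<close>
  have inj: "inj_on restr G"
  proof (rule inj_onI)
    fix p q assume "p \<in> G" "q \<in> G" "restr p = restr q"
    then show "p = q"
      using G(2) by (intro hpoly_eqI_sphere[of h]) (auto simp: restr_def fun_eq_iff split: if_splits)
  qed
  show ?thesis
  proof (rule orthonormal_basis_exists)
    show "fun_subspace ?X"
      unfolding fun_subspace_def
    proof (intro conjI ballI allI)
      have "(\<lambda>x. 0) = restr (\<lambda>x::'a. 0)" by (simp add: restr_def)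
      then show "(\<lambda>x. 0) \<in> ?X" using hpoly_0[of h] Lap_const[of 0] by blast
    next
      fix f g assume "f \<in> ?X" "g \<in> ?X"
      then obtain p q where pq: "f = restr p" "g = restr q" "hpoly h p" "hpoly h q"
        "Lap p = (\<lambda>x. 0)" "Lap q = (\<lambda>x. 0)" by blast
      have "(\<lambda>x. f x + g x) = restr (\<lambda>x. p x + q x)" using pq by (auto simp: restr_def)
      moreover have "hpoly h (\<lambda>x. p x + q x)" "Lap (\<lambda>x. p x + q x) = (\<lambda>x. 0)"
        using pq by (simp_all add: hpoly_add Lap_add)
      ultimately show "(\<lambda>x. f x + g x) \<in> ?X" by blast
    next
      fix f c assume "f \<in> ?X"
      then obtain p where p: "f = restr p" "hpoly h p" "Lap p = (\<lambda>x. 0)" by blast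
      have "(\<lambda>x. c * f x) = restr (\<lambda>x. c * p x)" using p by (auto simp: restr_def)
      moreover have "hpoly h (\<lambda>x. c * p x)" "Lap (\<lambda>x. c * p x) = (\<lambda>x. 0)"
        using p by (simp_all add: hpoly_cmult Lap_cmult)
      ultimately show "(\<lambda>x. c * f x) \<in> ?X" by blast
    qed
    show "sphere_cont f" if "f \<in> ?X" for f using that sphere_cont_hpoly by auto
    show "finite (restr ` G)" using G(1) by simp
    fix f assume "f \<in> ?X"
    then obtain p where p: "f = restr p" "hpoly h p" by blast
    then obtain c where c: "p = (\<lambda>x. \<Sum>g\<in>G. c g * g x)" using G(3) by blast
    have "f = (\<lambda>x. \<Sum>g\<in>G. c g * restr g x)"
      unfolding p(1) by (rule ext, subst c) (simp add: restr_def)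
    also have "\<dots> = (\<lambda>x. \<Sum>g\<in>restr ` G. c (the_inv_into G restr g) * g x)"
      by (simp add: sum.reindex[OF inj] the_inv_into_f_f[OF inj])
    finally have "f = (\<lambda>x. \<Sum>g\<in>restr ` G. c (the_inv_into G restr g) * g x)" .
    then show "\<exists>c. f = (\<lambda>x. \<Sum>g\<in>restr ` G. c g * g x)"
      by (intro exI[of _ "\<lambda>g. c (the_inv_into G restr g)"])
  qed
qed

text \<open>Subtracting a polynomial \<open>p\<close> from the first argument does not change the
  inner product of \<open>f\<close> with itself, and \<open>p\<close> may be uniformly close to
  \<open>f\<close>.\<close>

lemma orthogonal_to_hpoly_imp_0:
  fixes f :: "'a::euclidean_space \<Rightarrow> complex"
  assumes f: "sphere_cont f" and orth: "\<And>d p. hpoly d p \<Longrightarrow> L2_inner f (restr p) = 0"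
  shows "f x = 0"
proof -
  interpret finite_measure "sphere_measure :: 'a measure" by (rule finite_measure_sphere_measure)
  have restr_cpoly: "sphere_cont (restr p) \<and> L2_inner f (restr p) = 0" if "cpoly p" for p
    using that
  proof (induction rule: cpoly.induct)
    case (cpoly_hpoly d p) then show ?case using orth sphere_cont_hpoly by blast
  next
    case (cpoly_add p q)
    have eq: "restr (\<lambda>x. p x + q x) = (\<lambda>x. restr p x + restr q x)" by (auto simp: restr_def)
    have "L2_inner (restr p) f = 0" "L2_inner (restr q) f = 0"
      using cpoly_add L2_inner_cnj[of "restr p" f] L2_inner_cnj[of "restr q" f] by simp_all
    then have "L2_inner (\<lambda>x. restr p x + restr q x) f = 0"
      using cpoly_add f by (simp add: L2_inner_add_left)
    then have "L2_inner f (\<lambda>x. restr p x + restr q x) = 0"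
      using L2_inner_cnj[of f "\<lambda>x. restr p x + restr q x"] by simp
    then show ?case unfolding eq using cpoly_add by (auto intro: sphere_cont_add)
  qed
  obtain C where C: "C \<ge> 0" "\<And>x. norm (f x) \<le> C" using sphere_cont_bounded[OF f] by blast
  have bound: "norm (L2_inner f f) \<le> C * \<epsilon> * measure sphere_measure (UNIV :: 'a set)" if e: "\<epsilon> > 0" for \<epsilon>
  proof -
    obtain p where p: "cpoly p" "\<And>x. x \<in> sphere 0 1 \<Longrightarrow> norm (f x - p x) < \<epsilon>"
      using cpoly_approximation[OF compact_sphere _ e, of 0 1 f] f unfolding sphere_cont_def by metis
    let ?d = "\<lambda>x. f x - restr p x"
    have d: "sphere_cont ?d" using f restr_cpoly[OF p(1)] by (simp add: sphere_cont_diff)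
    have nd: "norm (?d x) \<le> \<epsilon>" for x
      using p(2)[of x] f e by (auto simp: restr_def sphere_cont_def less_imp_le)
    have "L2_inner (restr p) f = 0" using restr_cpoly[OF p(1)] L2_inner_cnj[of "restr p" f] by simp
    then have "L2_inner f f = L2_inner ?d f"
      using f restr_cpoly[OF p(1)] by (simp add: L2_inner_diff_left)
    also have "norm \<dots> \<le> (\<integral>x. norm (?d x * cnj (f x)) \<partial>sphere_measure)"
      unfolding L2_inner_def by (rule integral_norm_bound)
    also have "\<dots> \<le> (\<integral>x. C * \<epsilon> \<partial>(sphere_measure :: 'a measure))"
    proof (rule integral_mono)
      show "integrable sphere_measure (\<lambda>x. norm (?d x * cnj (f x)))"
        using L2_inner_integrable[OF d f] by (rule integrable_norm)
      show "norm (?d x * cnj (f x)) \<le> C * \<epsilon>" for x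
        using mult_mono[OF C(2)[of x] nd[of x]] C(1) by (simp add: norm_mult mult.commute)
    qed simp
    finally show ?thesis by (simp add: mult_ac)
  qed
  have "norm (L2_inner f f) \<le> 0"
  proof (rule field_le_epsilon)
    fix e :: real assume e: "e > 0"
    \<comment> \<open>The summand 1 keeps the denominator positive when \<open>C\<close> is
      zero.\<close>
    let ?K = "C * measure sphere_measure (UNIV :: 'a set) + 1"
    have K: "?K > 0" using C(1) by (simp add: add_nonneg_pos)
    have "norm (L2_inner f f) \<le> C * (e / ?K) * measure sphere_measure (UNIV :: 'a set)"
      using e K by (intro bound) simp
    also have "\<dots> = (?K - 1) / ?K * e" by simp
    also have "\<dots> \<le> 1 * e" using K e by (intro mult_right_mono) (auto simp: field_simps)
    finally show "norm (L2_inner f f) \<le> 0 + e" by simp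
  qed
  then show ?thesis using L2_inner_self_eq_0[OF f] by simp
qed

text \<open>Let \<open>r\<close> be \<open>f\<close> minus its projection onto harmonic polynomials
  of degree \<open>h\<close>. Orthogonality of \<open>r\<close> to harmonic polynomials holds in
  degree \<open>h\<close> by construction and in other degrees by symmetry of the operator. On the
  sphere these span all polynomials, so \<open>r = 0\<close>.\<close>

theorem laplace_eigen_imp_harmonic:
  fixes f :: "'a::euclidean_space \<Rightarrow> complex"
  assumes N: "DIM('a) \<ge> 2" and f: "laplace_eigen h f"
  shows "\<exists>p. hpoly h p \<and> Lap p = (\<lambda>x. 0) \<and> f = restr p"
proof -
  let ?X = "{restr p | p :: 'a \<Rightarrow> complex. hpoly h p \<and> Lap p = (\<lambda>x. 0)}"
  obtain B where B: "orthonormal_basis ?X B" using harmonic_restr_basis by blast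
  then have fin: "finite B" and BX: "B \<subseteq> ?X" and on: "orthonormal_on B"
    and gen: "\<And>f. f \<in> ?X \<Longrightarrow> \<exists>c. \<forall>x. f x = (\<Sum>e\<in>B. c e * e x)"
    by (auto simp: orthonormal_basis_def orthonormal_on_def)
  have cB: "sphere_cont e" if "e \<in> B" for e using that BX sphere_cont_hpoly by auto
  have cf: "sphere_cont f" by (rule sphere_cont_laplace_eigen[OF f])
  define c where "c e = L2_inner f e" for e
  define r where "r = (\<lambda>x. f x - (\<Sum>e\<in>B. c e * e x))"
  have cs: "sphere_cont (\<lambda>x. \<Sum>e\<in>B. c e * e x)"
    using cB by (intro sphere_cont_sum sphere_cont_cmult)
  have cr: "sphere_cont r" unfolding r_def by (rule sphere_cont_diff[OF cf cs])
  have rB: "L2_inner r e = 0" if "e \<in> B" for e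
    using L2_inner_orthonormal_sum[OF fin on cB that, of c] cf cs cB[OF that]
    by (simp add: r_def L2_inner_diff_left c_def)
  have harm: "L2_inner r (restr p) = 0" if p: "hpoly d p" "Lap p = (\<lambda>x. 0)" for d p
  proof (cases "d = h")
    case True
    then obtain b where b: "restr p = (\<lambda>x. \<Sum>e\<in>B. b e * e x)" using gen[of "restr p"] p by blast
    have "L2_inner (restr p) r = (\<Sum>e\<in>B. b e * L2_inner e r)"
      unfolding b using cB cr
      by (subst L2_inner_sum_left) (auto intro: sphere_cont_cmult simp: L2_inner_cmult_left)
    also have "\<dots> = 0" using rB L2_inner_cnj[of _ r] by (simp add: sum.neutral)
    finally show ?thesis using L2_inner_cnj[of r "restr p"] by simp
  next
    case False
    have "L2_inner e (restr p) = 0" if e: "e \<in> B" for e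
    proof -
      obtain q where "e = restr q" "hpoly h q" "Lap q = (\<lambda>x. 0)" using BX e by auto
      then show ?thesis using laplace_eigen_orthogonal[OF N laplace_eigen_hpoly p False] by simp
    qed
    then have "L2_inner (\<lambda>x. \<Sum>e\<in>B. c e * e x) (restr p) = 0"
      using cB sphere_cont_hpoly[OF p(1)]
      by (subst L2_inner_sum_left) (auto intro: sphere_cont_cmult simp: L2_inner_cmult_left)
    then show ?thesis
      unfolding r_def using cf cs sphere_cont_hpoly[OF p(1)] laplace_eigen_orthogonal[OF N f p False]
      by (simp add: L2_inner_diff_left)
  qed
  have "L2_inner r (restr p) = 0" if p: "hpoly d p" for d p
  proof -
    obtain \<psi> where \<psi>: "\<And>i. i \<le> d div 2 \<Longrightarrow> hpoly (d - 2 * i) (\<psi> i)"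
      "\<And>i. i \<le> d div 2 \<Longrightarrow> Lap (\<psi> i) = (\<lambda>x. 0)" "p = (\<lambda>x. \<Sum>i\<le>d div 2. nx2 x ^ i * \<psi> i x)"
      using harmonic_decomposition[of "\<lambda>_. True" d p] p by auto
    \<comment> \<open>The factors \<open>nx2 x ^ i\<close> are 1 on the sphere.\<close>
    have eq: "restr p = (\<lambda>x. \<Sum>i\<le>d div 2. restr (\<psi> i) x)"
      by (auto simp: restr_def \<psi>(3) nx2_def dot_square_norm)
    have "L2_inner (restr p) r = (\<Sum>i\<le>d div 2. L2_inner (restr (\<psi> i)) r)"
      unfolding eq using \<psi>(1) cr by (intro L2_inner_sum_left) (auto intro: sphere_cont_hpoly)
    also have "\<dots> = 0"
      using harm[OF \<psi>(1,2)] L2_inner_cnj[of _ r] by (simp add: sum.neutral)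
    finally show ?thesis using L2_inner_cnj[of r "restr p"] by simp
  qed
  then have "r x = 0" for x by (rule orthogonal_to_hpoly_imp_0[OF cr])
  then have fB: "f = (\<lambda>x. \<Sum>e\<in>B. c e * e x)" by (auto simp: r_def fun_eq_iff)
  have "\<forall>e\<in>B. \<exists>p. hpoly h p \<and> Lap p = (\<lambda>x. 0) \<and> e = restr p" using BX by auto
  then obtain P where P: "\<And>e. e \<in> B \<Longrightarrow> hpoly h (P e) \<and> Lap (P e) = (\<lambda>x. 0) \<and> e = restr (P e)"
    by metis
  have "f = restr (\<lambda>x. \<Sum>e\<in>B. c e * P e x)"
  proof
    fix x
    have "f x = (\<Sum>e\<in>B. c e * e x)" by (simp add: fB)
    also have "\<dots> = (\<Sum>e\<in>B. c e * restr (P e) x)" using P by (intro sum.cong) auto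
    finally show "f x = restr (\<lambda>x. \<Sum>e\<in>B. c e * P e x) x" by (simp add: restr_def)
  qed
  moreover have "hpoly h (\<lambda>x. \<Sum>e\<in>B. c e * P e x)" using P by (auto intro!: hpoly_sum hpoly_cmult)
  moreover have "Lap (\<lambda>x. \<Sum>e\<in>B. c e * P e x) = (\<lambda>x. 0)"
    using P by (subst Lap_sum[of _ h]) (auto intro!: hpoly_cmult simp: Lap_cmult[of h])
  ultimately show ?thesis by blast
qed

section \<open>Quaternionic spherical harmonics\<close>

lemma norm_quat_mult: "norm (x * y :: quat) = norm x * norm y"
  unfolding norm_quat_def times_quat_def real_sqrt_mult [symmetric] quat.sel
  by (rule arg_cong [where f = sqrt]) (simp add: power2_eq_square algebra_simps)

lemma norm_smult_vec: "norm (u *s (x :: quat ^ 'n)) = norm u * norm x"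
proof -
  have "(norm (u *s x))\<^sup>2 = (norm u * norm x)\<^sup>2"
    by (simp add: norm_vec_def L2_set_def sum_nonneg norm_quat_mult power_mult_distrib
        sum_distrib_left)
  then show ?thesis by (simp add: power2_eq_iff_nonneg)
qed

lemma bounded_linear_smult_vec_left: "bounded_linear (\<lambda>u. u *s (x :: quat ^ 'n))"
  by (rule bounded_linear_intro[where K = "norm x"])
    (auto simp: vec_eq_iff ring_distribs norm_smult_vec)

lemma linear_smult_vec: "linear (\<lambda>x :: quat ^ 'n. u *s x)"
  by (rule linearI) (auto simp: vec_eq_iff ring_distribs)

definition quat_units :: "quat set" where "quat_units = {quat_i, quat_j, quat_k}"

text \<open>The sign comes from \<open>exp (- (t *\<^sub>R u))\<close> in
  \<open>T_op\<close>.\<close>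

definition left_gen :: "quat \<Rightarrow> quat ^ 'n \<Rightarrow> quat ^ 'n" where "left_gen u x = - u *s x"

lemma inner_quat_unit_mult: "u \<in> quat_units \<Longrightarrow> (u * x) \<bullet> y = - (x \<bullet> (u * y))"
  by (auto simp: quat_units_def quat_i_def quat_j_def quat_k_def times_quat_def inner_quat_def
      algebra_simps)

lemma skew_gen: "u \<in> quat_units \<Longrightarrow> skew (left_gen u :: quat ^ 'n \<Rightarrow> quat ^ 'n)"
  unfolding skew_def left_gen_def
  by (auto simp: linear_smult_vec inner_vec_def inner_quat_unit_mult sum_negf)

lemma linear_gen: "linear (left_gen u)"
  unfolding left_gen_def by (rule linear_smult_vec)

definition qflow :: "quat \<Rightarrow> real \<Rightarrow> quat ^ 'n \<Rightarrow> quat ^ 'n" where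
  "qflow u t x = exp (- (t *\<^sub>R u)) *s x"

lemma qflow_0: "qflow u 0 x = x"
  by (simp add: qflow_def)

lemma exp_quat_deriv: "((\<lambda>t. exp (- (t *\<^sub>R u))) has_vector_derivative - u * exp (- (t *\<^sub>R u))) (at t)"
  for u :: quat
  using exp_scaleR_has_vector_derivative_left[of "- u" t] by simp

lemma qflow_deriv: "((\<lambda>t. qflow u t x) has_vector_derivative left_gen u (qflow u t x)) (at t)"
proof -
  have "- u * q *s x = - u *s (q *s x)" for q by (simp add: vec_eq_iff mult.assoc)
  with bounded_linear.has_vector_derivative[OF bounded_linear_smult_vec_left[of x] exp_quat_deriv[of u t]]
  show ?thesis by (simp add: qflow_def left_gen_def)
qed

text \<open>Multiplication by an imaginary unit is skew, so the squared norm has derivative zero in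
  \<open>t\<close>.\<close>

lemma norm_exp_quat_unit:
  assumes "u \<in> quat_units" shows "norm (exp (- (t *\<^sub>R u)) :: quat) = 1"
proof -
  let ?E = "\<lambda>t. exp (- (t *\<^sub>R u)) :: quat"
  have "((\<lambda>t. ?E t \<bullet> ?E t) has_real_derivative 0) (at t)" for t
  proof -
    have "((\<lambda>t. ?E t \<bullet> ?E t) has_vector_derivative ?E t \<bullet> (- u * ?E t) + (- u * ?E t) \<bullet> ?E t) (at t)"
      by (rule bounded_bilinear.has_vector_derivative[OF bounded_bilinear_inner exp_quat_deriv exp_quat_deriv])
    moreover have "?E t \<bullet> (- u * ?E t) + (- u * ?E t) \<bullet> ?E t = 0"
      using inner_quat_unit_mult[OF assms, of "?E t" "?E t"] by (simp add: inner_commute)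
    ultimately show ?thesis by (simp add: has_real_derivative_iff_has_vector_derivative)
  qed
  then have "?E t \<bullet> ?E t = ?E 0 \<bullet> ?E 0" using DERIV_isconst_all by blast
  also have "\<dots> = 1" by (simp add: dot_square_norm)
  finally show ?thesis by (simp add: norm_eq_sqrt_inner)
qed

lemma isometry_qflow: "u \<in> quat_units \<Longrightarrow> isometry_lin (qflow u t)"
  by (simp add: isometry_lin_def qflow_def[abs_def] linear_smult_vec norm_smult_vec norm_exp_quat_unit)

lemma flow_deriv_hpoly:
  fixes p :: "quat ^ 'n \<Rightarrow> complex"
  assumes u: "u \<in> quat_units" and p: "hpoly d p"
  shows "flow_deriv (qflow u) (restr p) (restr (LD (left_gen u) p))"
proof -
  have "((\<lambda>t. restr p (qflow u t x)) has_vector_derivative restr (LD (left_gen u) p) (qflow u t x)) (at t)"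
    if x: "x \<in> sphere 0 1" for x t
  proof -
    have S: "qflow u t x \<in> sphere 0 1" for t
      using x isometry_linD(2)[OF isometry_qflow[OF u], of t x] by simp
    have "((\<lambda>t. p (qflow u t x)) has_vector_derivative dd (left_gen u (qflow u t x)) p (qflow u t x)) (at t)"
      by (rule has_vector_derivative_compose_dd(1)[OF hpoly_differentiable[OF p] qflow_deriv])
    then show ?thesis by (simp only: restr_on[OF S] LD_def)
  qed
  then show ?thesis by (simp add: flow_deriv_def)
qed

text \<open>The flow preserves the norm, so both sides vanish off the sphere. As an equation of
  functions on the whole space it can be iterated, which \<open>Gamma_op\<close> requires.\<close>

lemma T_op_hpoly:
  fixes p :: "quat ^ 'n \<Rightarrow> complex"
  assumes u: "u \<in> quat_units" and p: "hpoly d p"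
  shows "T_op u (restr p) = restr (LD (left_gen u) p)"
proof
  fix x :: "quat ^ 'n"
  show "T_op u (restr p) x = restr (LD (left_gen u) p) x"
  proof (cases "x \<in> sphere 0 1")
    case True
    then have "((\<lambda>t. restr p (qflow u t x)) has_vector_derivative restr (LD (left_gen u) p) (qflow u 0 x)) (at 0)"
      using flow_deriv_hpoly[OF assms] by (simp add: flow_deriv_def)
    from vector_derivative_at[OF this] show ?thesis
      by (simp add: T_op_def qflow_0) (simp add: qflow_def)
  next
    case False
    then have "qflow u t x \<notin> sphere 0 1" for t
      using isometry_linD(2)[OF isometry_qflow[OF u], of t x] by simp
    then have "(\<lambda>t. restr p (exp (- (t *\<^sub>R u)) *s x)) = (\<lambda>t. 0)"
      by (simp add: restr_off qflow_def[symmetric] del: mem_sphere mem_sphere_0)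
    then show ?thesis using False by (simp add: T_op_def restr_off)
  qed
qed

section \<open>The operator \<Gamma> on polynomials: positivity and centrality\<close>

abbreviation LI :: "(quat ^ 'n \<Rightarrow> complex) \<Rightarrow> quat ^ 'n \<Rightarrow> complex" where "LI \<equiv> LD (left_gen quat_i)"
abbreviation LJ :: "(quat ^ 'n \<Rightarrow> complex) \<Rightarrow> quat ^ 'n \<Rightarrow> complex" where "LJ \<equiv> LD (left_gen quat_j)"
abbreviation LK :: "(quat ^ 'n \<Rightarrow> complex) \<Rightarrow> quat ^ 'n \<Rightarrow> complex" where "LK \<equiv> LD (left_gen quat_k)"

text \<open>The Casimir operator of the left action, defined on the ambient space in order to be
  compared with \<open>Lap\<close> and multiplication by \<open>nx2\<close>.\<close>

definition Gam :: "(quat ^ 'n \<Rightarrow> complex) \<Rightarrow> quat ^ 'n \<Rightarrow> complex" where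
  "Gam p = (\<lambda>x. - (LI (LI p) x + LJ (LJ p) x + LK (LK p) x))"

lemma quat_units_mem: "quat_i \<in> quat_units" "quat_j \<in> quat_units" "quat_k \<in> quat_units"
  by (simp_all add: quat_units_def)

lemma hpoly_L: "hpoly d p \<Longrightarrow> hpoly d (LD (left_gen u) p)"
  by (rule hpoly_LD[OF _ linear_gen])

lemma Gamma_op_hpoly:
  assumes "hpoly d p" shows "Gamma_op (restr p) = restr (Gam p)"
  by (rule ext)
    (simp add: Gamma_op_def Gam_def T_op_hpoly[OF _ assms] T_op_hpoly[OF _ hpoly_L[OF assms]]
      quat_units_mem, simp add: restr_def)

lemma hpoly_Gam: "hpoly d p \<Longrightarrow> hpoly d (Gam p)"
  unfolding Gam_def
  using hpoly_cmult[of d "\<lambda>x. LI (LI p) x + LJ (LJ p) x + LK (LK p) x" "-1"]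
  by (simp add: hpoly_add hpoly_L)

lemma Gam_const: "Gam (\<lambda>x. c) = (\<lambda>x. 0)"
  by (simp add: Gam_def)

lemma Gam_add: "hpoly d p \<Longrightarrow> hpoly e q \<Longrightarrow> Gam (\<lambda>x. p x + q x) = (\<lambda>x. Gam p x + Gam q x)"
  by (simp add: Gam_def LD_add LD_add[OF hpoly_L hpoly_L] algebra_simps)

lemma Gam_cmult: "hpoly d p \<Longrightarrow> Gam (\<lambda>x. c * p x) = (\<lambda>x. c * Gam p x)"
  by (simp add: Gam_def LD_cmult LD_cmult[OF hpoly_L] algebra_simps)

lemma Gam_nx2: "hpoly d p \<Longrightarrow> Gam (\<lambda>x. nx2 x * p x) = (\<lambda>x. nx2 x * Gam p x)"
  by (simp add: Gam_def LD_nx2_mult[OF skew_gen] LD_nx2_mult[OF skew_gen hpoly_L] quat_units_mem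
      algebra_simps)

lemma Gam_Lap:
  assumes h: "hpoly d p" shows "Gam (Lap p) = Lap (Gam p)"
proof -
  have c: "LD (left_gen u) (LD (left_gen u) (Lap p)) = Lap (LD (left_gen u) (LD (left_gen u) p))" if "u \<in> quat_units" for u
    by (simp add: Lap_LD[OF skew_gen[OF that] h, symmetric]
        Lap_LD[OF skew_gen[OF that] hpoly_L[OF h], symmetric])
  have "Lap (Gam p) = Lap (\<lambda>x. (-1) * (LI (LI p) x + LJ (LJ p) x + LK (LK p) x))"
    by (simp add: Gam_def)
  also have "\<dots> = (\<lambda>x. (-1) * (Lap (LI (LI p)) x + Lap (LJ (LJ p)) x + Lap (LK (LK p)) x))"
    using h by (subst Lap_cmult[of d], intro hpoly_add hpoly_L, assumption+)
      (subst Lap_add[of d _ d], intro hpoly_add hpoly_L, assumption+, intro hpoly_L, assumption,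
        subst Lap_add[of d _ d], intro hpoly_L, assumption, intro hpoly_L, assumption, simp)
  finally show ?thesis by (simp add: Gam_def c quat_units_mem)
qed

lemma Gam_cnj: "hpoly d p \<Longrightarrow> Gam (\<lambda>x. cnj (p x)) = (\<lambda>x. cnj (Gam p x))"
  by (simp add: Gam_def LD_cnj LD_cnj[OF hpoly_L])

lemma Gam_times:
  assumes p: "hpoly d p" and q: "hpoly e q"
  shows "Gam (\<lambda>x. p x * q x) = (\<lambda>x. Gam p x * q x + p x * Gam q x
    - 2 * (LI p x * LI q x + LJ p x * LJ q x + LK p x * LK q x))"
proof -
  have "LD (left_gen u) (LD (left_gen u) (\<lambda>x. p x * q x)) = (\<lambda>x. (p x * LD (left_gen u) (LD (left_gen u) q) x
      + LD (left_gen u) p x * LD (left_gen u) q x) + (LD (left_gen u) p x * LD (left_gen u) q x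
      + LD (left_gen u) (LD (left_gen u) p) x * q x))" for u
    unfolding LD_times[OF p q]
    by (subst LD_add[OF hpoly_times[OF p hpoly_L[OF q]] hpoly_times[OF hpoly_L[OF p] q]])
      (simp add: LD_times[OF p hpoly_L[OF q]] LD_times[OF hpoly_L[OF p] q])
  then show ?thesis by (simp add: Gam_def algebra_simps)
qed

text \<open>Positivity of \<open>\<Gamma>\<close>; it excludes the eigenvalue \<open>(k - 1) * (k + 1)\<close> for \<open>k = 0\<close>.\<close>

lemma Gam_eigenvalue_nonneg:
  fixes p :: "quat ^ 'n \<Rightarrow> complex"
  assumes h: "hpoly d p" and neg: "Gam p = (\<lambda>x. - p x)"
  shows "p = (\<lambda>x. 0)"
proof -
  let ?q = "\<lambda>x. cnj (p x)"
  have q: "hpoly d ?q" by (rule hpoly_cnj[OF h])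
  define I where "I u = (\<integral>x. restr (LD (left_gen u) (LD (left_gen u) p)) x * restr ?q x \<partial>sphere_measure)" for u
  define A where "A u = (\<integral>x. (norm (restr (LD (left_gen u) p) x))\<^sup>2 \<partial>sphere_measure)" for u
  have I: "I u = - of_real (A u)" if u: "u \<in> quat_units" for u
  proof -
    note c = sphere_cont_hpoly
    have "I u = - (\<integral>x. restr (LD (left_gen u) p) x * restr (LD (left_gen u) ?q) x \<partial>sphere_measure)"
      unfolding I_def
      by (rule flow_integration_by_parts[OF isometry_qflow[OF u] qflow_0
            c[OF hpoly_L[OF h]] c[OF hpoly_L[OF hpoly_L[OF h]]] flow_deriv_hpoly[OF u hpoly_L[OF h]]
            c[OF q] c[OF hpoly_L[OF q]] flow_deriv_hpoly[OF u q]])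
    also have "restr (LD (left_gen u) ?q) = (\<lambda>x. cnj (restr (LD (left_gen u) p) x))"
      by (auto simp: LD_cnj[OF h] restr_def)
    also have "(\<integral>x. restr (LD (left_gen u) p) x * cnj (restr (LD (left_gen u) p) x) \<partial>sphere_measure) = of_real (A u)"
      using L2_inner_self[of "restr (LD (left_gen u) p)"] by (simp add: L2_inner_def A_def)
    finally show ?thesis .
  qed
  have int: "integrable sphere_measure (\<lambda>x. restr (LD (left_gen u) (LD (left_gen u) p)) x * restr ?q x)" for u
    by (rule integrable_sphere_cont[OF sphere_cont_mult[OF sphere_cont_hpoly[OF hpoly_L[OF hpoly_L[OF h]]]
          sphere_cont_hpoly[OF q]]])
  \<comment> \<open>The equation makes \<open>p\<close> the sum of its second derivatives along the
    three fields. Integration by parts therefore equates its squared norm with minus a sum of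
    squared norms.\<close>
  have "restr p x * cnj (restr p x) = restr (LI (LI p)) x * restr ?q x
      + (restr (LJ (LJ p)) x * restr ?q x + restr (LK (LK p)) x * restr ?q x)" for x
  proof -
    have "p x = LI (LI p) x + LJ (LJ p) x + LK (LK p) x"
      using fun_cong[OF neg, of x, symmetric] unfolding Gam_def by (simp only: neg_equal_iff_equal)
    then show ?thesis unfolding restr_def by (simp add: ring_distribs)
  qed
  then have "L2_inner (restr p) (restr p) = I quat_i + (I quat_j + I quat_k)"
    unfolding L2_inner_def I_def by (simp add: int)
  also have "\<dots> = of_real (- (A quat_i + A quat_j + A quat_k))"
    by (simp add: I quat_units_mem)
  finally have "(\<integral>x. (norm (restr p x))\<^sup>2 \<partial>sphere_measure) = - (A quat_i + A quat_j + A quat_k)"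
    unfolding L2_inner_self of_real_eq_iff .
  moreover have "A u \<ge> 0" for u by (simp add: A_def)
  moreover have "(\<integral>x. (norm (restr p x))\<^sup>2 \<partial>sphere_measure) \<ge> 0" by simp
  ultimately have "(\<integral>x. (norm (restr p x))\<^sup>2 \<partial>sphere_measure) = 0"
    by (smt (verit))
  then have "L2_inner (restr p) (restr p) = 0" by (simp add: L2_inner_self)
  then have "restr p x = 0" for x using L2_inner_self_eq_0[OF sphere_cont_hpoly[OF h]] by blast
  then show ?thesis
    by (intro hpoly_eqI_sphere[OF h hpoly_0]) (metis restr_on)
qed

lemma LD_LD:
  assumes B: "skew B" and h: "hpoly d p"
  shows "LD A (LD B p) x = dd (B x) (dd (A x) p) x + dd (B (A x)) p x"
  unfolding LD_def[of A] dd_LD[OF B h] by (simp add: LD_def)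

lemma gen_gen: "left_gen v (left_gen u x) = (v * u) *s x"
  by (simp add: left_gen_def vec_eq_iff mult.assoc)

text \<open>The second-order parts agree since directional derivatives commute; the first-order
  parts are derivatives along \<open>left_gen w x\<close> with opposite signs.\<close>

lemma LD_gen_commutator:
  assumes u: "u \<in> quat_units" "v \<in> quat_units" and w: "v * u = - w" "u * v = w" and h: "hpoly d p"
  shows "LD (left_gen u) (LD (left_gen v) p) x = LD (left_gen v) (LD (left_gen u) p) x + 2 * LD (left_gen w) p x"
proof -
  have "left_gen v (left_gen u x) = left_gen w x" by (simp add: gen_gen w left_gen_def)
  moreover have "left_gen u (left_gen v x) = - left_gen w x"
    by (simp add: gen_gen w left_gen_def vec_eq_iff)
  ultimately show ?thesis
    unfolding LD_LD[OF skew_gen[OF u(1)] h] LD_LD[OF skew_gen[OF u(2)] h]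
    using linear_neg[OF linear_dd[OF h, of x], of "left_gen w x"]
    by (simp add: dd_commute[OF h, of "left_gen u x"] LD_def)
qed

lemma quat_mult_table:
  "quat_i * quat_j = quat_k" "quat_j * quat_i = - quat_k"
  "quat_j * quat_k = quat_i" "quat_k * quat_j = - quat_i"
  "quat_k * quat_i = quat_j" "quat_i * quat_k = - quat_j"
  "quat_i * quat_i = - 1" "quat_j * quat_j = - 1" "quat_k * quat_k = - 1"
  by (simp_all add: quat_i_def quat_j_def quat_k_def times_quat_def uminus_quat_def one_quat_def)

text \<open>The relations of su(2), for a basis scaled by two.\<close>

lemma L_commutators:
  assumes h: "hpoly d p"
  shows "LI (LJ p) x = LJ (LI p) x + 2 * LK p x"
    "LJ (LK p) x = LK (LJ p) x + 2 * LI p x"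
    "LK (LI p) x = LI (LK p) x + 2 * LJ p x"
  by (rule LD_gen_commutator[OF quat_units_mem(1,2) _ _ h] LD_gen_commutator[OF quat_units_mem(2,3) _ _ h]
      LD_gen_commutator[OF quat_units_mem(3,1) _ _ h]; simp add: quat_mult_table)+

lemma LD_add_double:
  "hpoly d p \<Longrightarrow> hpoly e q \<Longrightarrow> LD A (\<lambda>x. p x + 2 * q x) = (\<lambda>x. LD A p x + 2 * LD A q x)"
  by (simp add: LD_add[OF _ hpoly_cmult] LD_cmult)

text \<open>Moving the field of \<open>u\<close> past the squares for \<open>v\<close> and for
  \<open>w\<close> produces the same mixed terms with opposite signs. This yields centrality of
  \<Gamma> in \<open>Gam_L\<close>.\<close>

lemma L_square_commute:
  assumes u: "u \<in> quat_units" "v \<in> quat_units" "w \<in> quat_units"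
    and m: "u * v = w" "v * u = - w" "w * u = v" "u * w = - v"
    and h: "hpoly d p"
  shows "LD (left_gen v) (LD (left_gen v) (LD (left_gen u) p)) x + LD (left_gen w) (LD (left_gen w) (LD (left_gen u) p)) x
       = LD (left_gen u) (LD (left_gen v) (LD (left_gen v) p)) x + LD (left_gen u) (LD (left_gen w) (LD (left_gen w) p)) x"
proof -
  have 1: "LD (left_gen u) (LD (left_gen v) q) = (\<lambda>x. LD (left_gen v) (LD (left_gen u) q) x + 2 * LD (left_gen w) q x)"
    if "hpoly d q" for q
    using LD_gen_commutator[OF u(1,2) m(2,1) that] by (simp add: fun_eq_iff)
  have 2: "LD (left_gen w) (LD (left_gen u) q) = (\<lambda>x. LD (left_gen u) (LD (left_gen w) q) x + 2 * LD (left_gen v) q x)"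
    if "hpoly d q" for q
    using LD_gen_commutator[OF u(3,1) m(4,3) that] by (simp add: fun_eq_iff)
  have "LD (left_gen u) (LD (left_gen v) (LD (left_gen v) p)) x
      = LD (left_gen v) (LD (left_gen v) (LD (left_gen u) p)) x + 2 * LD (left_gen v) (LD (left_gen w) p) x
        + 2 * LD (left_gen w) (LD (left_gen v) p) x"
    unfolding 1[OF hpoly_L[OF h]] 1[OF h]
    by (simp add: LD_add_double[OF hpoly_L[OF hpoly_L[OF h]] hpoly_L[OF h]])
  moreover have "LD (left_gen w) (LD (left_gen w) (LD (left_gen u) p)) x
      = LD (left_gen u) (LD (left_gen w) (LD (left_gen w) p)) x + 2 * LD (left_gen v) (LD (left_gen w) p) x
        + 2 * LD (left_gen w) (LD (left_gen v) p) x"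
    unfolding 2[OF h]
    by (simp add: LD_add_double[OF hpoly_L[OF hpoly_L[OF h]] hpoly_L[OF h]] 2[OF hpoly_L[OF h]])
  ultimately show ?thesis by simp
qed

lemma LD_Gam:
  assumes h: "hpoly d p"
  shows "LD A (Gam p) x = - (LD A (LI (LI p)) x + LD A (LJ (LJ p)) x + LD A (LK (LK p)) x)"
proof -
  have "LD A (Gam p) = LD A (\<lambda>x. (-1) * (LI (LI p) x + (LJ (LJ p) x + LK (LK p) x)))"
    by (simp add: Gam_def add.assoc)
  also have "\<dots> = (\<lambda>x. (-1) * (LD A (LI (LI p)) x + (LD A (LJ (LJ p)) x + LD A (LK (LK p)) x)))"
    using h by (simp only: LD_cmult[of d] LD_add[of d _ d] hpoly_add hpoly_L)
  finally show ?thesis by simp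
qed

lemma Gam_L:
  assumes u: "u \<in> quat_units" and h: "hpoly d p"
  shows "Gam (LD (left_gen u) p) = LD (left_gen u) (Gam p)"
proof
  fix x
  consider "u = quat_i" | "u = quat_j" | "u = quat_k" using u by (auto simp: quat_units_def)
  then show "Gam (LD (left_gen u) p) x = LD (left_gen u) (Gam p) x"
  proof cases
    case 1
    have r: "a + b = a' + b' \<Longrightarrow> - (t + a + b) = - (t + a' + b')" for a b a' b' t :: complex
      by (simp only: add.assoc)
    show ?thesis
      unfolding 1 LD_Gam[OF h] Gam_def[of "LI p"]
      by (rule r[OF L_square_commute[OF quat_units_mem(1,2,3) _ _ _ _ h]]) (simp_all add: quat_mult_table)
  next
    case 2
    have r: "b + a = b' + a' \<Longrightarrow> - (a + t + b) = - (a' + t + b')" for a b a' b' t :: complex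
      by (metis add.assoc add.commute)
    show ?thesis
      unfolding 2 LD_Gam[OF h] Gam_def[of "LJ p"]
      by (rule r[OF L_square_commute[OF quat_units_mem(2,3,1) _ _ _ _ h]]) (simp_all add: quat_mult_table)
  next
    case 3
    have r: "a + b = a' + b' \<Longrightarrow> - (a + b + t) = - (a' + b' + t)" for a b a' b' t :: complex
      by simp
    show ?thesis
      unfolding 3 LD_Gam[OF h] Gam_def[of "LK p"]
      by (rule r[OF L_square_commute[OF quat_units_mem(3,1,2) _ _ _ _ h]]) (simp_all add: quat_mult_table)
  qed
qed

section \<open>Clebsch--Gordan decomposition of products with linear forms\<close>

definition linear_form :: "quat ^ 'n \<Rightarrow> quat ^ 'n \<Rightarrow> complex" where "linear_form c x = of_real (x \<bullet> c)"

lemma hpoly_lin: "hpoly (Suc 0) (linear_form c)"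
  using hpoly_inner[of c] by (simp add: linear_form_def[abs_def])

lemma L_lin: "u \<in> quat_units \<Longrightarrow> LD (left_gen u) (linear_form c) = linear_form (u *s c)"
  using LD_inner[OF skew_gen[of u], of c] by (simp add: linear_form_def[abs_def] left_gen_def vec_eq_iff
      inner_vec_def)

lemma lin_uminus: "linear_form (- c) = (\<lambda>x. - linear_form c x)"
  by (simp add: linear_form_def fun_eq_iff)

lemma smult_smult_vec: "u *s (v *s (x :: quat ^ 'n)) = (u * v) *s x"
  by (simp add: vec_eq_iff mult.assoc)

lemma uminus_smult_vec: "(- u) *s (x :: quat ^ 'n) = - (u *s x)"
  by (simp add: vec_eq_iff)

lemma one_smult_vec: "(1::quat) *s x = (x :: quat ^ 'n)"
  by (simp add: vec_eq_iff)

text \<open>Here \<open>3 = 1 * (1 + 2)\<close>: linear forms belong to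
  \<open>k = 1\<close>.\<close>

lemma Gam_lin: "Gam (linear_form c) = (\<lambda>x. 3 * linear_form c x)"
  by (simp add: Gam_def L_lin quat_units_mem smult_smult_vec quat_mult_table uminus_smult_vec
      one_smult_vec lin_uminus)

text \<open>With \<open>X\<close> the sum of \<open>T\<^sub>u \<otimes> T\<^sub>u\<close> over the three units \<open>u\<close>, the two identities for \<open>Gam\<close> read
  \<open>\<Gamma> = 3 + \<kappa> - 2 X\<close> and \<open>X\<^sup>2 = \<kappa> + 2 X\<close> on the product of a linear form and \<open>p\<close>.\<close>

lemma Gam_lin_times:
  assumes h: "hpoly d p" and ev: "Gam p = (\<lambda>x. \<kappa> * p x)"
    and C: "C = (\<lambda>x. linear_form (quat_i *s b) x * LI p x + linear_form (quat_j *s b) x * LJ p x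
      + linear_form (quat_k *s b) x * LK p x)"
  shows "Gam (\<lambda>x. linear_form b x * p x) = (\<lambda>x. (3 + \<kappa>) * (linear_form b x * p x) - 2 * C x)"
    and "Gam C = (\<lambda>x. (3 + \<kappa>) * C x - 2 * (\<kappa> * (linear_form b x * p x) + 2 * C x))"
    and "hpoly (Suc d) C"
proof -
  show "Gam (\<lambda>x. linear_form b x * p x) = (\<lambda>x. (3 + \<kappa>) * (linear_form b x * p x) - 2 * C x)"
    unfolding Gam_times[OF hpoly_lin h]
    by (simp add: ev Gam_lin C L_lin quat_units_mem algebra_simps)
  have hp: "hpoly (Suc d) (\<lambda>x. linear_form c x * LD (left_gen u) p x)" for c u
    using hpoly_times[OF hpoly_lin hpoly_L[OF h]] by simp
  then show "hpoly (Suc d) C" unfolding C by (intro hpoly_add)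
  have GL: "Gam (LD (left_gen u) p) = (\<lambda>x. \<kappa> * LD (left_gen u) p x)" if "u \<in> quat_units" for u
    using Gam_L[OF that h] by (simp add: ev LD_cmult[OF h])
  have one: "Gam (\<lambda>x. linear_form c x * LD (left_gen u) p x) = (\<lambda>x. (3 + \<kappa>) * (linear_form c x * LD (left_gen u) p x)
      - 2 * (linear_form (quat_i *s c) x * LI (LD (left_gen u) p) x + linear_form (quat_j *s c) x * LJ (LD (left_gen u) p) x
      + linear_form (quat_k *s c) x * LK (LD (left_gen u) p) x))" if "u \<in> quat_units" for c u
    unfolding Gam_times[OF hpoly_lin hpoly_L[OF h]]
    by (simp add: GL[OF that] Gam_lin L_lin quat_units_mem algebra_simps)
  have "Gam C x = (3 + \<kappa>) * C x - 2 * (\<kappa> * (linear_form b x * p x) + 2 * C x)" for x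
  proof -
    \<comment> \<open>Solved for one square, the eigenvalue equation evaluates the diagonal terms of
      \<open>X\<^sup>2\<close>; the off-diagonal terms combine to commutators and give
      \<open>2 X\<close>.\<close>
    have ev': "LI (LI p) x = - (\<kappa> * p x) - LJ (LJ p) x - LK (LK p) x"
      using fun_cong[OF ev, of x, symmetric] by (simp add: Gam_def)
    have "Gam C x = Gam (\<lambda>x. linear_form (quat_i *s b) x * LI p x) x + Gam (\<lambda>x. linear_form (quat_j *s b) x * LJ p x) x
      + Gam (\<lambda>x. linear_form (quat_k *s b) x * LK p x) x"
      unfolding C by (simp only: Gam_add[OF hpoly_add[OF hp hp] hp] Gam_add[OF hp hp])
    also have "\<dots> = (3 + \<kappa>) * C x - 2 * (\<kappa> * (linear_form b x * p x) + 2 * C x)"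
      unfolding one[OF quat_units_mem(1)] one[OF quat_units_mem(2)] one[OF quat_units_mem(3)]
      by (simp add: C smult_smult_vec quat_mult_table uminus_smult_vec one_smult_vec lin_uminus
          L_commutators[OF h] ev' algebra_simps)
    finally show ?thesis .
  qed
  then show "Gam C = (\<lambda>x. (3 + \<kappa>) * C x - 2 * (\<kappa> * (linear_form b x * p x) + 2 * C x))" by blast
qed

text \<open>The eigenvalue of \<Gamma> on \<open>harmonics h m\<close> for
  \<open>k = h - 2 m\<close>.\<close>

definition gamma_eigenvalue :: "nat \<Rightarrow> complex" where "gamma_eigenvalue k = of_nat k * (of_nat k + 2)"

text \<open>The parity condition is carried along because \<open>h - k\<close> has to be even for
  \<open>m = (h - k) div 2\<close> to satisfy \<open>h = 2 m + k\<close>.\<close>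

inductive gamma_sum :: "nat \<Rightarrow> (quat ^ 'n \<Rightarrow> complex) \<Rightarrow> bool" where
  gamma_sum_eigen: "hpoly d p \<Longrightarrow> Gam p = (\<lambda>x. gamma_eigenvalue k * p x) \<Longrightarrow> even (d + k) \<Longrightarrow> gamma_sum d p"
| gamma_sum_add: "gamma_sum d p \<Longrightarrow> gamma_sum d q \<Longrightarrow> gamma_sum d (\<lambda>x. p x + q x)"

text \<open>The two summands are eigenvectors for \<open>k + 1\<close> and \<open>k - 1\<close>, as in the Clebsch--Gordan rule.\<close>

lemma gamma_sum_lin_times_eigen:
  assumes h: "hpoly d p" and ev: "Gam p = (\<lambda>x. gamma_eigenvalue k * p x)" and k: "even (d + k)"
  shows "gamma_sum (Suc d) (\<lambda>x. linear_form b x * p x)"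
proof -
  define C where "C = (\<lambda>x. linear_form (quat_i *s b) x * LI p x + linear_form (quat_j *s b) x * LJ p x
      + linear_form (quat_k *s b) x * LK p x)"
  define q where "q = (\<lambda>x. linear_form b x * p x)"
  have G: "Gam q = (\<lambda>x. (3 + gamma_eigenvalue k) * q x - 2 * C x)"
    "Gam C = (\<lambda>x. (3 + gamma_eigenvalue k) * C x - 2 * (gamma_eigenvalue k * q x + 2 * C x))" "hpoly (Suc d) C"
    using Gam_lin_times[OF h ev C_def] by (simp_all add: q_def)
  have q: "hpoly (Suc d) q" using hpoly_times[OF hpoly_lin h] by (simp add: q_def)
  define \<kappa> where "\<kappa> = (of_nat k :: complex)"
  have nz: "2 * \<kappa> + 2 \<noteq> 0"
  proof -
    have "2 * \<kappa> + 2 = of_nat (2 * k + 2)" by (simp add: \<kappa>_def)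
    then show ?thesis by (simp only: of_nat_eq_0_iff)
  qed
  have lc: "hpoly (Suc d) (\<lambda>x. s * q x + t * C x)"
    "Gam (\<lambda>x. s * q x + t * C x)
      = (\<lambda>x. s * ((3 + gamma_eigenvalue k) * q x - 2 * C x) + t * ((3 + gamma_eigenvalue k) * C x - 2 * (gamma_eigenvalue k * q x + 2 * C x)))" for s t
    using q G(3) by (auto intro!: hpoly_add hpoly_cmult
        simp: Gam_add[OF hpoly_cmult hpoly_cmult] Gam_cmult G(1,2))
  \<comment> \<open>The relation for \<open>X\<close> has the roots \<open>- k\<close> and
    \<open>k + 2\<close>. The functions \<open>a\<close> and \<open>c\<close> are the corresponding
    spectral projections of \<open>q\<close>, and \<delta> is the inverse of the difference of the
    roots.\<close>
  define \<delta> where "\<delta> = 1 / (2 * \<kappa> + 2)"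
  have \<delta>: "(2 * \<kappa> + 2) * \<delta> = 1" using nz by (simp add: \<delta>_def)
  define a where "a = (\<lambda>x. ((\<kappa> + 2) * \<delta>) * q x + (- \<delta>) * C x)"
  define c where "c = (\<lambda>x. (\<kappa> * \<delta>) * q x + \<delta> * C x)"
  have "gamma_sum (Suc d) a"
  proof (rule gamma_sum_eigen)
    show "hpoly (Suc d) a" unfolding a_def by (rule lc(1))
    show "Gam a = (\<lambda>x. gamma_eigenvalue (Suc k) * a x)"
      unfolding a_def lc(2) gamma_eigenvalue_def of_nat_Suc \<kappa>_def[symmetric]
      by (simp add: fun_eq_iff algebra_simps)
  qed (use k in auto)
  moreover have "gamma_sum (Suc d) c"
  proof -
    have hc: "hpoly (Suc d) c" unfolding c_def by (rule lc(1))
    have Gc: "Gam c = (\<lambda>x. ((\<kappa> - 1) * (\<kappa> + 1)) * c x)"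
      unfolding c_def lc(2) gamma_eigenvalue_def \<kappa>_def[symmetric]
      by (simp add: fun_eq_iff algebra_simps)
    show ?thesis
    proof (cases k)
      case 0
      then have "Gam c = (\<lambda>x. - c x)" using Gc by (simp add: \<kappa>_def)
      then have c0: "c = (\<lambda>x. 0)" by (rule Gam_eigenvalue_nonneg[OF hc])
      \<comment> \<open>The zero function satisfies the eigenvalue equation for every index;
        \<open>Suc 0\<close> is the one that fits the parity.\<close>
      have "gamma_sum (Suc d) (\<lambda>x :: quat ^ 'n. 0)"
        using k 0 by (intro gamma_sum_eigen[of _ _ "Suc 0"]) (auto simp: hpoly_0 Gam_const)
      then show ?thesis by (simp add: c0)
    next
      case (Suc j)
      have "(\<kappa> - 1) * (\<kappa> + 1) = gamma_eigenvalue j" by (simp add: \<kappa>_def Suc gamma_eigenvalue_def algebra_simps)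
      then show ?thesis using hc Gc Suc k by (intro gamma_sum_eigen[of _ _ j]) auto
    qed
  qed
  moreover have "(\<lambda>x. a x + c x) = (\<lambda>x. ((2 * \<kappa> + 2) * \<delta>) * q x)"
    by (simp add: a_def c_def fun_eq_iff algebra_simps)
  ultimately have "gamma_sum (Suc d) q"
    using gamma_sum_add[of "Suc d" a c] by (simp add: \<delta>)
  then show ?thesis by (simp add: q_def)
qed

text \<open>A factor that is a linear form raises the degree by one and shifts \<open>k\<close> by
  one up or down, so the parity of their sum is kept.\<close>

lemma gamma_sum_hpoly: "hpoly d p \<Longrightarrow> gamma_sum d p"
proof (induction rule: hpoly.induct)
  case (hpoly_const c)
  then show ?case by (intro gamma_sum_eigen[of _ _ 0]) (auto intro: hpoly.hpoly_const simp: Gam_const gamma_eigenvalue_def)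
next
  case (hpoly_add d p q) then show ?case by (intro gamma_sum_add)
next
  case (hpoly_mult d p b)
  from hpoly_mult.IH have "gamma_sum (Suc d) (\<lambda>x. linear_form b x * p x)"
  proof (induction rule: gamma_sum.induct)
    case (gamma_sum_add d p q)
    from gamma_sum.gamma_sum_add[OF gamma_sum_add.IH] show ?case by (simp add: ring_distribs)
  qed (rule gamma_sum_lin_times_eigen)
  then show ?case by (simp add: linear_form_def)
qed

section \<open>The spaces of quaternionic spherical harmonics as spaces of polynomials\<close>

lemma harmonics_iff:
  fixes f :: "quat ^ 'n \<Rightarrow> complex"
  shows "f \<in> harmonics h m \<longleftrightarrow> (\<exists>p. hpoly h p \<and> Lap p = (\<lambda>x. 0) \<and> f = restr p \<and>
    Gam p = (\<lambda>x. of_real ((real h - 2 * real m) * (real h - 2 * real m + 2)) * p x))" (is "?L \<longleftrightarrow> ?R")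
proof
  let ?c = "complex_of_real ((real h - 2 * real m) * (real h - 2 * real m + 2))"
  assume f: ?L
  then have "laplace_eigen h f"
    unfolding harmonics_def laplace_eigen_def DIM_quat_vec by auto
  then obtain p where p: "hpoly h p" "Lap p = (\<lambda>x. 0)" "f = restr p"
  proof -
    have "CARD('n) > 0" by simp
    then have "2 \<le> DIM(quat ^ 'n)" unfolding DIM_quat_vec by linarith
    with that \<open>laplace_eigen h f\<close> show ?thesis using laplace_eigen_imp_harmonic[of h f] by blast
  qed
  have "Gam p x = ?c * p x" if "x \<in> sphere 0 1" for x
    using f that p(3) Gamma_op_hpoly[OF p(1)] by (auto simp: harmonics_def restr_def)
  then have "Gam p = (\<lambda>x. ?c * p x)"
    by (intro hpoly_eqI_sphere[OF hpoly_Gam[OF p(1)] hpoly_cmult[OF p(1)]])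
  with p show ?R by blast
next
  let ?c = "complex_of_real ((real h - 2 * real m) * (real h - 2 * real m + 2))"
  assume ?R
  then obtain p where p: "hpoly h p" "Lap p = (\<lambda>x. 0)" "f = restr p" "Gam p = (\<lambda>x. ?c * p x)" by blast
  have "laplace_eigen h f" using laplace_eigen_hpoly[OF p(1,2)] p(3) by simp
  moreover have "Gamma_op f x = ?c * f x" if "x \<in> sphere 0 1" for x
    using that Gamma_op_hpoly[OF p(1)] by (simp add: p(3,4) restr_def)
  ultimately show ?L unfolding harmonics_def laplace_eigen_def DIM_quat_vec by auto
qed

lemma fun_subspace_harmonics: "fun_subspace (harmonics h m :: (quat ^ 'n \<Rightarrow> complex) set)"
proof -
  define \<kappa> where "\<kappa> = complex_of_real ((real h - 2 * real m) * (real h - 2 * real m + 2))"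
  note harmonics_iff = harmonics_iff[of _ h m, folded \<kappa>_def]
  show ?thesis
    unfolding fun_subspace_def
  proof (intro conjI ballI allI)
    show "(\<lambda>x. 0) \<in> harmonics h m"
      unfolding harmonics_iff
      by (intro exI[of _ "\<lambda>x. 0"]) (auto simp: hpoly_0 Gam_const restr_def)
  next
    fix f g :: "quat ^ 'n \<Rightarrow> complex" assume "f \<in> harmonics h m" "g \<in> harmonics h m"
    then obtain p q where "hpoly h p" "Lap p = (\<lambda>x. 0)" "f = restr p" "Gam p = (\<lambda>x. \<kappa> * p x)"
      "hpoly h q" "Lap q = (\<lambda>x. 0)" "g = restr q" "Gam q = (\<lambda>x. \<kappa> * q x)"
      unfolding harmonics_iff by blast
    then show "(\<lambda>x. f x + g x) \<in> harmonics h m"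
      unfolding harmonics_iff
      by (intro exI[of _ "\<lambda>x. p x + q x"])
        (auto simp: hpoly_add Lap_add Gam_add restr_def fun_eq_iff ring_distribs)
  next
    fix f :: "quat ^ 'n \<Rightarrow> complex" and c assume "f \<in> harmonics h m"
    then obtain p where "hpoly h p" "Lap p = (\<lambda>x. 0)" "f = restr p" "Gam p = (\<lambda>x. \<kappa> * p x)"
      unfolding harmonics_iff by blast
    then show "(\<lambda>x. c * f x) \<in> harmonics h m"
      unfolding harmonics_iff
      by (intro exI[of _ "\<lambda>x. c * p x"])
        (auto simp: hpoly_cmult Lap_cmult Gam_cmult restr_def fun_eq_iff)
  qed
qed

text \<open>The eigenvalues are real. Conjugates occur since the kernel is integrated in its
  conjugated variable.\<close>

lemma harmonics_cnj: "f \<in> harmonics h m \<Longrightarrow> (\<lambda>x. cnj (f x)) \<in> harmonics h m"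
  unfolding harmonics_iff
  by (elim exE conjE, rule_tac x = "\<lambda>x. cnj (p x)" in exI)
    (auto simp: hpoly_cnj Lap_cnj Gam_cnj restr_def)

lemma sphere_cont_harmonics: "f \<in> harmonics h m \<Longrightarrow> sphere_cont f"
  unfolding harmonics_iff using sphere_cont_hpoly by auto

text \<open>Evaluates the choice in \<open>proj_kernel\<close>; a basis of all harmonic polynomials
  of degree \<open>h\<close> serves as generating set.\<close>

lemma harmonics_orthonormal_basis:
  "\<exists>B. orthonormal_basis (harmonics h m :: (quat ^ 'n \<Rightarrow> complex) set) B"
proof -
  let ?X = "{restr p | p :: quat ^ 'n \<Rightarrow> complex. hpoly h p \<and> Lap p = (\<lambda>x. 0)}"
  obtain B where B: "orthonormal_basis ?X B" using harmonic_restr_basis by blast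
  show ?thesis
  proof (rule orthonormal_basis_exists[OF fun_subspace_harmonics sphere_cont_harmonics])
    show "finite B" using B by (simp add: orthonormal_basis_def)
    fix f :: "quat ^ 'n \<Rightarrow> complex" assume "f \<in> harmonics h m"
    then have "f \<in> ?X" unfolding harmonics_iff by blast
    then show "\<exists>c. f = (\<lambda>x. \<Sum>g\<in>B. c g * g x)"
      using B unfolding orthonormal_basis_def fun_eq_iff by blast
  qed
qed

section \<open>Hausdorff null sets and quaternionic orbits\<close>

text \<open>A cubic lattice of mesh \<open>d\<close> with at most \<open>5 / d\<close> values per
  coordinate, whence \<open>625 = 5 ^ 4\<close>. Rounding errors of at most \<open>d\<close> in four
  coordinates give distance \<open>sqrt (4 * d\<^sup>2) = 2 * d\<close>.\<close>

lemma quat_grid: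
  assumes d: "0 < d" "d \<le> 1"
  shows "\<exists>G :: quat set. finite G \<and> real (card G) \<le> 625 / d ^ 4 \<and>
    (\<forall>q. norm q \<le> 1 \<longrightarrow> (\<exists>p\<in>G. norm (q - p) \<le> 2 * d))"
proof -
  define M where "M = \<lceil>1 / d\<rceil>"
  define J where "J = {- M..M}"
  define f where "f = (\<lambda>(a, b, c, e). Quat (d * real_of_int a) (d * real_of_int b) (d * real_of_int c) (d * real_of_int e))"
  define G where "G = f ` (J \<times> J \<times> J \<times> J)"
  have M: "real_of_int M \<le> 1 / d + 1" "1 / d \<le> real_of_int M"
    unfolding M_def by (rule of_int_ceiling_le_add_one, rule le_of_int_ceiling)
  have Mpos: "M \<ge> 0" using M(2) d by (smt (verit) divide_nonneg_pos of_int_0_le_iff)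
  have "real (card J) = 2 * real_of_int M + 1" using Mpos by (simp add: J_def)
  also have "\<dots> \<le> 2 / d + 3" using M(1) by simp
  also have "\<dots> \<le> 5 / d" using d by (simp add: field_simps)
  finally have cJ: "real (card J) \<le> 5 / d" .
  have "card G \<le> card (J \<times> J \<times> J \<times> J)" unfolding G_def by (rule card_image_le) (simp add: J_def)
  then have "real (card G) \<le> real (card J) ^ 4"
    by (simp add: card_cartesian_product power4_eq_xxxx mult.assoc flip: of_nat_mult)
  also have "\<dots> \<le> (5 / d) ^ 4" using cJ by (intro power_mono) auto
  finally have card: "real (card G) \<le> 625 / d ^ 4" by (simp add: power_divide)
  have rnd: "\<exists>z\<in>J. \<bar>t - d * real_of_int z\<bar> \<le> d" if t: "\<bar>t\<bar> \<le> 1" for t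
  proof
    have "real_of_int \<lfloor>t / d\<rfloor> \<le> t / d" "t / d < real_of_int \<lfloor>t / d\<rfloor> + 1" by linarith+
    then have "d * real_of_int \<lfloor>t / d\<rfloor> \<le> d * (t / d)" "d * (t / d) < d * (real_of_int \<lfloor>t / d\<rfloor> + 1)"
      using d by (intro mult_left_mono mult_strict_left_mono; simp)+
    then have "d * real_of_int \<lfloor>t / d\<rfloor> \<le> t" "t < d * real_of_int \<lfloor>t / d\<rfloor> + d"
      using d by (simp_all add: ring_distribs)
    then show "\<bar>t - d * real_of_int \<lfloor>t / d\<rfloor>\<bar> \<le> d" by linarith
    have "t / d \<le> 1 / d" "- (1 / d) \<le> t / d" using t d by (auto simp: divide_simps)
    then have "t / d \<le> real_of_int M" "real_of_int (- M) \<le> t / d" using M(2) by auto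
    then show "\<lfloor>t / d\<rfloor> \<in> J" unfolding J_def by (simp add: le_floor_iff floor_le_iff)
  qed
  have "\<exists>p\<in>G. norm (q - p) \<le> 2 * d" if q: "norm q \<le> 1" for q :: quat
  proof -
    have sq: "(qRe q)\<^sup>2 + (qI q)\<^sup>2 + (qJ q)\<^sup>2 + (qK q)\<^sup>2 \<le> 1"
      using q unfolding norm_quat_def by simp
    have "(qRe q)\<^sup>2 \<le> 1" "(qI q)\<^sup>2 \<le> 1" "(qJ q)\<^sup>2 \<le> 1" "(qK q)\<^sup>2 \<le> 1"
      using sq zero_le_power2[of "qRe q"] zero_le_power2[of "qI q"] zero_le_power2[of "qJ q"]
        zero_le_power2[of "qK q"] by linarith+
    then have "\<bar>qRe q\<bar> \<le> 1" "\<bar>qI q\<bar> \<le> 1" "\<bar>qJ q\<bar> \<le> 1" "\<bar>qK q\<bar> \<le> 1"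
      by (simp_all add: abs_square_le_1)
    then obtain a b c e where J: "a \<in> J" "b \<in> J" "c \<in> J" "e \<in> J"
      and le: "\<bar>qRe q - d * real_of_int a\<bar> \<le> d" "\<bar>qI q - d * real_of_int b\<bar> \<le> d"
        "\<bar>qJ q - d * real_of_int c\<bar> \<le> d" "\<bar>qK q - d * real_of_int e\<bar> \<le> d"
      using rnd by metis
    have "(qRe q - d * real_of_int a)\<^sup>2 \<le> d\<^sup>2" "(qI q - d * real_of_int b)\<^sup>2 \<le> d\<^sup>2"
      "(qJ q - d * real_of_int c)\<^sup>2 \<le> d\<^sup>2" "(qK q - d * real_of_int e)\<^sup>2 \<le> d\<^sup>2"
      using le d(1) by (auto intro!: abs_le_square_iff[THEN iffD1])
    then have "norm (q - f (a, b, c, e)) \<le> sqrt (4 * d\<^sup>2)"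
      unfolding norm_quat_def f_def minus_quat_def by (intro real_sqrt_le_mono) simp
    also have "\<dots> = 2 * d" using d by (simp add: real_sqrt_mult)
    finally show ?thesis using J unfolding G_def by blast
  qed
  then show ?thesis using card by (intro exI[of _ G]) (auto simp: G_def J_def)
qed

lemma smult_vec_diff_left: "(p - q) *s (x :: quat ^ 'n) = p *s x - q *s x"
  and smult_vec_diff_right: "q *s (x - y :: quat ^ 'n) = q *s x - q *s y"
  by (simp_all add: vec_eq_iff algebra_simps)

text \<open>A net of \<open>O(d\<^sup>-\<^sup>4)\<close> quaternions \<open>p\<close> in the unit ball yields the balls around \<open>p *s x\<close> of
  radius \<open>4 * d\<close>, for any \<open>x \<in> A\<close>.\<close>

lemma orbit_cone_cover:
  fixes A :: "(quat ^ 'n) set"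
  assumes A: "A \<subseteq> sphere 0 1" "\<And>a b. a \<in> A \<Longrightarrow> b \<in> A \<Longrightarrow> dist a b \<le> d" and d: "0 < d" "d \<le> 1"
  shows "\<exists>U\<in>sets borel. {q *s a | q a. norm q \<le> 1 \<and> a \<in> A} \<subseteq> U \<and>
    emeasure lborel U \<le> ennreal (625 * 4 ^ DIM(quat ^ 'n) * measure lborel (ball (0 :: quat ^ 'n) 1)
      * d ^ (DIM(quat ^ 'n) - 4))"
proof (cases "A = {}")
  case True
  then show ?thesis by (intro bexI[of _ "{}"]) auto
next
  case False
  then obtain x where x: "x \<in> A" by blast
  obtain G :: "quat set" where G: "finite G" "real (card G) \<le> 625 / d ^ 4"
    "\<And>q. norm q \<le> 1 \<Longrightarrow> \<exists>p\<in>G. norm (q - p) \<le> 2 * d" using quat_grid[OF d] by blast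
  let ?\<omega> = "measure lborel (ball (0 :: quat ^ 'n) 1)"
  let ?N = "DIM(quat ^ 'n)"
  define U where "U = (\<Union>p\<in>G. ball (p *s x) (4 * d))"
  have "{q *s a | q a. norm q \<le> 1 \<and> a \<in> A} \<subseteq> U"
  proof clarify
    fix q :: quat and a assume q: "norm q \<le> 1" and a: "a \<in> A"
    obtain p where p: "p \<in> G" "norm (q - p) \<le> 2 * d" using G(3)[OF q] by blast
    \<comment> \<open>The two terms contribute at most \<open>d\<close> and \<open>2 * d\<close>,
      which is less than the radius \<open>4 * d\<close>.\<close>
    have "q *s a - p *s x = q *s (a - x) + (q - p) *s x"
      by (simp add: smult_vec_diff_left smult_vec_diff_right)
    then have "norm (q *s a - p *s x) \<le> norm q * norm (a - x) + norm (q - p) * norm x"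
      using norm_triangle_ineq[of "q *s (a - x)" "(q - p) *s x"] by (simp only: norm_smult_vec)
    also have "norm q * norm (a - x) \<le> 1 * d"
      using q A(2)[OF a x] by (intro mult_mono) (auto simp: dist_norm)
    also have "norm x = 1" using A(1) x by auto
    finally have "norm (q *s a - p *s x) < 4 * d" using p(2) d by simp
    then show "q *s a \<in> U" using p(1) by (auto simp: U_def dist_norm norm_minus_commute)
  qed
  moreover have "emeasure lborel U \<le> ennreal (625 * 4 ^ ?N * ?\<omega> * d ^ (?N - 4))"
  proof -
    have "emeasure lborel U \<le> (\<Sum>p\<in>G. emeasure lborel (ball (p *s x) (4 * d)))"
      unfolding U_def by (rule emeasure_subadditive_finite) (use G(1) in auto)
    also have "\<dots> = (\<Sum>p\<in>G. ennreal ((4 * d) ^ ?N * ?\<omega>))"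
    proof (rule sum.cong[OF refl])
      fix p
      have "emeasure lborel (ball (p *s x) (4 * d)) = ennreal (measure lborel (ball (p *s x) (4 * d)))"
        using emeasure_lborel_ball_finite[of "p *s x" "4 * d"] by (subst emeasure_eq_ennreal_measure) auto
      then show "emeasure lborel (ball (p *s x) (4 * d)) = ennreal ((4 * d) ^ ?N * ?\<omega>)"
        using content_ball_conv_unit_ball[of "4 * d" "p *s x"] d by simp
    qed
    also have "\<dots> = ennreal (real (card G) * ((4 * d) ^ ?N * ?\<omega>))"
      by (simp only: sum_constant ennreal_of_nat_eq_real_of_nat) (rule ennreal_mult'[symmetric], simp)
    also have "\<dots> \<le> ennreal (625 / d ^ 4 * ((4 * d) ^ ?N * ?\<omega>))"
      using G(2) d by (intro ennreal_leI mult_right_mono) auto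
    \<comment> \<open>The four dimensions of \<open>q\<close>, three of the orbit and one radial,
      cost \<open>d ^ 4\<close>; the remaining exponent is 4n - 4.\<close>
    also have "625 / d ^ 4 * ((4 * d) ^ ?N * ?\<omega>) = 625 * 4 ^ ?N * ?\<omega> * d ^ (?N - 4)"
    proof -
      have "CARD('n) > 0" by simp
      then have "?N = 4 + (?N - 4)" unfolding DIM_quat_vec by linarith
      then have "d ^ ?N = d ^ 4 * d ^ (?N - 4)" by (metis power_add)
      then show ?thesis using d by (simp only: power_mult_distrib) (simp add: field_simps)
    qed
    finally show ?thesis .
  qed
  moreover have "U \<in> sets borel" unfolding U_def by (intro borel_open open_UN) auto
  ultimately show ?thesis by blast
qed

text \<open>The measure of \<open>E\<close> is a multiple of the volume of the cone over
  \<open>E\<close>, which consists of products of quaternions in the unit ball with points of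
  \<open>K\<close>. A piece of \<open>K\<close> of diameter \<open>d\<close> accounts for volume
  \<open>O(d ^ (4 n - 4))\<close>, and a fine cover of \<open>K\<close> makes the sum of these
  small.\<close>

lemma sphere_measure_orbits_null:
  fixes K E :: "(quat ^ 'n) set"
  assumes n: "CARD('n) \<ge> 2" and K: "K \<subseteq> sphere 0 1" and E: "E \<in> sets borel" "E \<subseteq> sphere 0 1"
    and orb: "\<And>y. y \<in> E \<Longrightarrow> \<exists>u a. norm u = 1 \<and> a \<in> K \<and> y = u *s a"
    and s: "0 < s" "s \<le> 4 * real CARD('n) - 4" "hausdorff_measure s K = 0"
  shows "emeasure sphere_measure E = 0"
proof -
  let ?N = "DIM(quat ^ 'n)"
  define C where "C = 625 * 4 ^ ?N * measure lborel (ball (0 :: quat ^ 'n) 1)"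
  have C: "C > 0" using content_ball_pos[of 1 "0 :: quat ^ 'n"] by (simp add: C_def)
  have N: "real (?N - 4) = 4 * real CARD('n) - 4" "?N - 4 \<noteq> 0"
    using n unfolding DIM_quat_vec by auto
  define Z where "Z = ball 0 1 \<inter> sgn -` E"
  have Zm: "Z \<in> sets lborel"
    using measurable_sets[OF borel_measurable_sgn_euclidean E(1)] by (auto simp: Z_def)
  have Zsub: "Z \<subseteq> {q *s a | q a. norm q \<le> 1 \<and> a \<in> K}"
  proof
    fix z assume z: "z \<in> Z"
    then have "sgn z \<in> E" by (simp add: Z_def)
    from orb[OF this] obtain u a where u: "norm u = 1" "a \<in> K" "sgn z = u *s a" by blast
    have "z = norm z *\<^sub>R sgn z" by (cases "z = 0") (auto simp: sgn_div_norm)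
    also have "\<dots> = (norm z *\<^sub>R u) *s a" by (simp add: u(3) vec_eq_iff)
    finally have "z = (norm z *\<^sub>R u) *s a" .
    moreover have "norm (norm z *\<^sub>R u) \<le> 1" using z u(1) by (simp add: Z_def)
    ultimately show "z \<in> {q *s a | q a. norm q \<le> 1 \<and> a \<in> K}" using u(2) by blast
  qed
  have small: "emeasure lborel Z \<le> ennreal (C * (2 * \<eta>))" if \<eta>: "\<eta> > 0" for \<eta>
  proof -
    \<comment> \<open>The scale 1 suffices: the premeasure vanishes with the measure, and diameters
      of at most 1 allow the exponent to be lowered to \<open>s\<close>.\<close>
    have "hausdorff_premeasure s 1 K \<le> hausdorff_measure s K"
      unfolding hausdorff_measure_def by (rule SUP_upper) simp
    then have "hausdorff_premeasure s 1 K < ennreal \<eta>" using s(3) \<eta> by simp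
    then obtain A where A: "K \<subseteq> (\<Union>i. A i)" "\<And>i::nat. bounded (A i) \<and> diameter (A i) \<le> 1"
      "(\<Sum>i. ennreal (diameter (A i) powr s)) < ennreal \<eta>"
      unfolding hausdorff_premeasure_def INF_less_iff by blast
    \<comment> \<open>Sets of diameter zero receive a positive substitute, as
      \<open>orbit_cone_cover\<close> asks for; the substitutes sum to at most \<eta>.\<close>
    define d where "d i = (if diameter (A i) = 0 then min 1 (\<eta> * (1 / 2) ^ Suc i) else diameter (A i))" for i
    have dpos: "0 < d i" "d i \<le> 1" "diameter (A i) \<le> d i" for i
      using A(2)[of i] diameter_ge_0[of "A i"] \<eta> by (auto simp: d_def)
    have dle: "d i ^ (?N - 4) \<le> diameter (A i) powr s + \<eta> * (1 / 2) ^ Suc i" for i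
    proof (cases "diameter (A i) = 0")
      case True
      \<comment> \<open>The exponent is at least one because
        \<open>CARD('n) \<ge> 2\<close>.\<close>
      have "d i ^ (?N - 4) \<le> d i ^ 1"
        using dpos[of i] N(2) by (intro power_decreasing) auto
      also have "\<dots> \<le> \<eta> * (1 / 2) ^ Suc i" using True by (simp add: d_def)
      finally show ?thesis using True by simp
    next
      case False
      have "d i ^ (?N - 4) = d i powr real (?N - 4)" using dpos[of i] by (simp add: powr_realpow)
      also have "\<dots> \<le> d i powr s" using dpos[of i] s(2) N(1) by (intro powr_mono') auto
      finally have "d i ^ (?N - 4) \<le> diameter (A i) powr s" using False by (simp add: d_def)
      moreover have "0 \<le> \<eta> * (1 / 2) ^ Suc i" using \<eta> by simp
      ultimately show ?thesis by linarith
    qed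
    define T where "T i = {q *s a | q a. norm q \<le> 1 \<and> a \<in> A i \<inter> K}" for i
    have "\<exists>U\<in>sets borel. T i \<subseteq> U \<and> emeasure lborel U \<le> ennreal (C * d i ^ (?N - 4))" for i
      unfolding C_def T_def
    proof (rule orbit_cone_cover)
      fix a b assume "a \<in> A i \<inter> K" "b \<in> A i \<inter> K"
      then show "dist a b \<le> d i"
        using diameter_bounded_bound[of "A i" a b] A(2)[of i] dpos(3)[of i] by auto
    qed (use K dpos in auto)
    then obtain U where U: "\<And>i. U i \<in> sets borel" "\<And>i. T i \<subseteq> U i"
      "\<And>i. emeasure lborel (U i) \<le> ennreal (C * d i ^ (?N - 4))" by metis
    have "Z \<subseteq> (\<Union>i. U i)"
    proof
      fix z assume "z \<in> Z"
      then obtain q a where qa: "z = q *s a" "norm q \<le> 1" "a \<in> K" using Zsub by blast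
      then obtain i where "a \<in> A i" using A(1) by blast
      then have "z \<in> T i" using qa unfolding T_def by blast
      then show "z \<in> (\<Union>i. U i)" using U(2)[of i] by blast
    qed
    then have "emeasure lborel Z \<le> emeasure lborel (\<Union>i. U i)"
      using U(1) by (intro emeasure_mono) auto
    also have "\<dots> \<le> (\<Sum>i. emeasure lborel (U i))"
      using U(1) by (intro emeasure_subadditive_countably) auto
    also have "\<dots> \<le> (\<Sum>i. ennreal C * (ennreal (diameter (A i) powr s) + ennreal (\<eta> * (1 / 2) ^ Suc i)))"
    proof (intro suminf_le summableI)
      fix i
      have "emeasure lborel (U i) \<le> ennreal (C * (diameter (A i) powr s + \<eta> * (1 / 2) ^ Suc i))"
        using U(3)[of i] by (rule order_trans) (use dle[of i] C in \<open>intro ennreal_leI mult_left_mono; simp\<close>)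
      also have "\<dots> = ennreal C * (ennreal (diameter (A i) powr s) + ennreal (\<eta> * (1 / 2) ^ Suc i))"
        using C \<eta> by (simp add: ennreal_mult ennreal_plus)
      finally show "emeasure lborel (U i) \<le> \<dots>" .
    qed
    also have "\<dots> = ennreal C * ((\<Sum>i. ennreal (diameter (A i) powr s)) + (\<Sum>i. ennreal (\<eta> * (1 / 2) ^ Suc i)))"
      by (simp add: suminf_add[symmetric] del: power_Suc)
    also have "(\<Sum>i. ennreal (\<eta> * (1 / 2) ^ Suc i)) = ennreal \<eta>"
    proof -
      have "(\<lambda>i. \<eta> * (1 / 2) ^ Suc i) sums (\<eta> * 1)" by (intro sums_mult power_half_series)
      then show ?thesis using \<eta> by (subst suminf_ennreal2) (auto simp: sums_iff)
    qed
    also have "ennreal C * ((\<Sum>i. ennreal (diameter (A i) powr s)) + ennreal \<eta>)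
        \<le> ennreal C * (ennreal \<eta> + ennreal \<eta>)"
      using A(3) by (intro mult_left_mono add_right_mono) auto
    also have "\<dots> = ennreal (C * (2 * \<eta>))" using C \<eta> by (simp flip: ennreal_plus ennreal_mult)
    finally show ?thesis .
  qed
  have "emeasure lborel Z \<le> 0"
  proof (rule ennreal_le_epsilon)
    fix e :: real assume "0 < e"
    then show "emeasure lborel Z \<le> 0 + ennreal e" using small[of "e / (2 * C)"] C by simp
  qed
  then show ?thesis using E(1) by (simp add: emeasure_sphere_measure Z_def)
qed

section \<open>Orbits of the unit quaternions and their invariants\<close>

definition orbit_map :: "quat ^ 'n \<Rightarrow> quat ^ 'n ^ 'n" where
  "orbit_map x = (\<chi> i j. quat_cnj (x $ i) * x $ j)"

lemma quat_cnj_mult: "quat_cnj (x * y) = quat_cnj y * quat_cnj x"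
  by (simp add: quat_cnj_def times_quat_def algebra_simps)

lemma quat_cnj_times_self: "quat_cnj x * x = of_real ((norm x)\<^sup>2)" "x * quat_cnj x = of_real ((norm x)\<^sup>2)"
  by (simp_all add: of_real_def quat_eq_iff times_quat_def quat_cnj_def scaleR_quat_def
        one_quat_def norm_quat_def power2_eq_square)

lemma norm_quat_cnj: "norm (quat_cnj x) = norm x"
  by (simp add: norm_quat_def quat_cnj_def)

lemma orbit_map_smult: "norm u = 1 \<Longrightarrow> orbit_map (u *s x) = orbit_map x"
proof -
  assume u: "norm u = 1"
  have "quat_cnj (u * a) * (u * b) = quat_cnj a * b" for a b
  proof -
    have "quat_cnj (u * a) * (u * b) = quat_cnj a * (quat_cnj u * u) * b"
      by (simp add: quat_cnj_mult mult.assoc)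
    then show ?thesis using u by (simp add: quat_cnj_times_self)
  qed
  then show ?thesis by (simp add: orbit_map_def)
qed

text \<open>At a coordinate with \<open>a $ i \<noteq> 0\<close> the diagonal entries give equal
  norms, and the entries of row \<open>i\<close> then carry the same factor \<open>u\<close> to all
  other coordinates.\<close>

lemma orbit_map_eqD:
  assumes eq: "orbit_map y = orbit_map a" and a: "norm a = 1"
  shows "\<exists>u. norm u = 1 \<and> y = u *s a"
proof -
  have e: "quat_cnj (y $ i) * y $ j = quat_cnj (a $ i) * a $ j" for i j
    using arg_cong[OF eq, of "\<lambda>z. z $ i $ j"] by (simp add: orbit_map_def)
  have "a \<noteq> 0" using a by auto
  then obtain i where i: "a $ i \<noteq> 0" by (auto simp: vec_eq_iff)
  let ?r = "(norm (a $ i))\<^sup>2"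
  have r: "?r \<noteq> 0" using i by simp
  have "(of_real ((norm (y $ i))\<^sup>2) :: quat) = of_real ?r"
    using e[of i i] by (simp add: quat_cnj_times_self)
  then have nn: "(norm (y $ i))\<^sup>2 = ?r" by (simp only: of_real_eq_iff)
  \<comment> \<open>This is \<open>y $ i\<close> times the inverse of \<open>a $ i\<close>.\<close>
  define u where "u = (1 / ?r) *\<^sub>R (y $ i * quat_cnj (a $ i))"
  have "norm (y $ i) = norm (a $ i)" using nn by (simp add: power2_eq_iff_nonneg)
  then have "norm u = 1" using r by (simp add: u_def norm_quat_mult norm_quat_cnj power2_eq_square)
  moreover have "y $ j = u * a $ j" for j
  proof -
    have "?r *\<^sub>R y $ j = y $ i * (quat_cnj (y $ i) * y $ j)"
      by (simp add: mult.assoc[symmetric] quat_cnj_times_self nn scaleR_conv_of_real)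
    also have "\<dots> = y $ i * quat_cnj (a $ i) * a $ j" by (simp add: e mult.assoc)
    finally have "(1 / ?r) *\<^sub>R (?r *\<^sub>R y $ j) = u * a $ j" by (simp add: u_def)
    then show ?thesis using r by simp
  qed
  ultimately show ?thesis by (intro exI[of _ u]) (simp add: vec_eq_iff)
qed

lemma linear_quat_cnj: "linear quat_cnj"
  by (rule linearI) (simp_all add: quat_cnj_def plus_quat_def scaleR_quat_def)

lemma continuous_orbit_map: "continuous_on S orbit_map"
proof -
  have "continuous_on S (\<lambda>x. quat_cnj (x $ i))" for i
    by (intro continuous_on_compose2[OF linear_continuous_on[of quat_cnj UNIV]])
      (auto simp: linear_quat_cnj linear_conv_bounded_linear[symmetric] intro: continuous_intros)
  then show ?thesis
    unfolding orbit_map_def[abs_def] by (intro continuous_intros)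
qed

text \<open>Invariance under the action in infinitesimal form. Even degrees keep the parity of
  \<open>d + k\<close> when a polynomial is multiplied by an invariant one.\<close>

inductive ipoly :: "(quat ^ 'n \<Rightarrow> complex) \<Rightarrow> bool" where
  ipoly_hpoly: "hpoly d p \<Longrightarrow> even d \<Longrightarrow> (\<And>u. u \<in> quat_units \<Longrightarrow> LD (left_gen u) p = (\<lambda>x. 0)) \<Longrightarrow> ipoly p"
| ipoly_add: "ipoly p \<Longrightarrow> ipoly q \<Longrightarrow> ipoly (\<lambda>x. p x + q x)"

lemma ipoly_times: "ipoly p \<Longrightarrow> ipoly q \<Longrightarrow> ipoly (\<lambda>x. p x * q x)"
proof (induction rule: ipoly.induct)
  case p: (ipoly_hpoly d p)
  from p(4) show ?case
  proof (induction rule: ipoly.induct)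
    case q: (ipoly_hpoly e q)
    show ?case
      using p q by (intro ipoly_hpoly[OF hpoly_times[OF p(1) q(1)]]) (auto simp: LD_times)
  qed (auto simp: ring_distribs intro: ipoly.intros)
qed (auto simp: ring_distribs intro: ipoly.intros)

text \<open>A linear function of \<open>orbit_map\<close> is a quadratic form that is constant along
  \<open>qflow\<close>, so its derivatives along the flow vanish; sums and products stay
  invariant.\<close>

lemma ipoly_orbit_map:
  assumes "real_polynomial_function P"
  shows "ipoly (\<lambda>x :: quat ^ 'n. complex_of_real (P (orbit_map x)))"
  using assms
proof (induction rule: real_polynomial_function.induct)
  case (linear f)
  interpret bounded_linear f by fact
  let ?B = "\<lambda>x y :: quat ^ 'n. complex_of_real (f (\<chi> i j. quat_cnj (x $ i) * y $ j))"
  let ?p = "\<lambda>x :: quat ^ 'n. complex_of_real (f (orbit_map x))"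
  have lin: "linear (\<lambda>z. complex_of_real (f z))"
    using bounded_linear_compose[OF bounded_linear_of_real bounded_linear_axioms]
    by (rule bounded_linear.linear)
  have 1: "linear (?B x)" for x
  proof -
    have "linear (\<lambda>y :: quat ^ 'n. \<chi> i j. quat_cnj (x $ i) * y $ j)"
      by (rule linearI) (simp_all add: vec_eq_iff ring_distribs)
    from linear_compose[OF this lin] show ?thesis by (simp add: o_def)
  qed
  have 2: "linear (\<lambda>x. ?B x y)" for y
  proof -
    have "linear (\<lambda>x :: quat ^ 'n. \<chi> i j. quat_cnj (x $ i) * y $ j)"
      by (rule linearI) (simp_all add: vec_eq_iff ring_distribs linear_add[OF linear_quat_cnj]
          linear_scale[OF linear_quat_cnj])
    from linear_compose[OF this lin] show ?thesis by (simp add: o_def)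
  qed
  have h: "hpoly (Suc (Suc 0)) ?p"
    using hpoly_bilinear[of ?B, OF 1 2] by (simp add: orbit_map_def)
  show ?case
  proof (rule ipoly_hpoly[OF h])
    fix u assume u: "u \<in> quat_units"
    show "LD (left_gen u) ?p = (\<lambda>x. 0)"
    proof
      fix x :: "quat ^ 'n"
      have "((\<lambda>t. ?p (qflow u t x)) has_vector_derivative dd (left_gen u (qflow u 0 x)) ?p (qflow u 0 x)) (at 0)"
        by (rule has_vector_derivative_compose_dd(1)[OF hpoly_differentiable[OF h] qflow_deriv])
      moreover have "(\<lambda>t. ?p (qflow u t x)) = (\<lambda>t. ?p x)"
        by (simp add: qflow_def orbit_map_smult norm_exp_quat_unit[OF u])
      ultimately have "((\<lambda>t::real. ?p x) has_vector_derivative LD (left_gen u) ?p x) (at 0)"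
        by (simp add: qflow_0 LD_def)
      then show "LD (left_gen u) ?p x = 0"
        using vector_derivative_unique_at has_vector_derivative_const by blast
    qed
  qed simp
next
  case (const c)
  show ?case by (rule ipoly_hpoly[OF hpoly_const]) simp_all
qed (auto intro: ipoly_add ipoly_times)

section \<open>Integration against a complex measure on the sphere\<close>

definition bounded_borel :: "('a::euclidean_space \<Rightarrow> complex) \<Rightarrow> bool" where
  "bounded_borel f \<longleftrightarrow> f \<in> borel_measurable borel \<and> (\<exists>C. \<forall>x. norm (f x) \<le> C)"

lemma bounded_borel_sphere_cont:
  assumes "sphere_cont f" shows "bounded_borel f"
proof -
  obtain C where "\<And>x. norm (f x) \<le> C" using sphere_cont_bounded[OF assms] by blast
  then show ?thesis using sphere_cont_measurable[OF assms] by (auto simp: bounded_borel_def)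
qed

lemma bounded_borel_add:
  assumes "bounded_borel f" "bounded_borel g" shows "bounded_borel (\<lambda>x. f x + g x)"
proof -
  obtain C D where CD: "\<And>x. norm (f x) \<le> C" "\<And>x. norm (g x) \<le> D"
    using assms by (auto simp: bounded_borel_def)
  have "norm (f x + g x) \<le> C + D" for x
    by (rule norm_triangle_le[OF add_mono[OF CD]])
  then show ?thesis using assms by (auto simp: bounded_borel_def)
qed

lemma bounded_borel_cmult:
  assumes "bounded_borel f" shows "bounded_borel (\<lambda>x. c * f x)"
proof -
  obtain C where "\<And>x. norm (f x) \<le> C" using assms by (auto simp: bounded_borel_def)
  then have "norm (c * f x) \<le> norm c * C" for x by (simp add: norm_mult mult_left_mono)
  then show ?thesis using assms by (auto simp: bounded_borel_def)
qed

lemma bounded_borel_mult: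
  assumes "bounded_borel f" "bounded_borel g" shows "bounded_borel (\<lambda>x. f x * g x)"
proof -
  obtain C D where CD: "\<And>x. norm (f x) \<le> C" "\<And>x. norm (g x) \<le> D"
    using assms by (auto simp: bounded_borel_def)
  have "norm (f x * g x) \<le> C * D" for x
    using mult_mono[OF CD(1)[of x] CD(2)[of x]] norm_ge_zero[of "f x"] CD(1)[of x]
    by (simp add: norm_mult order_trans[OF norm_ge_zero])
  then show ?thesis using assms by (auto simp: bounded_borel_def)
qed

lemma bounded_borel_indicator: "A \<in> sets borel \<Longrightarrow> bounded_borel (indicator A)"
  unfolding bounded_borel_def by (auto intro!: exI[of _ 1] simp: indicator_def)

lemma bounded_borel_0: "bounded_borel (\<lambda>x. 0)"
  by (auto simp: bounded_borel_def)

lemma bounded_borel_sum: "(\<And>i. i \<in> I \<Longrightarrow> bounded_borel (f i)) \<Longrightarrow> bounded_borel (\<lambda>x. \<Sum>i\<in>I. f i x)"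
  by (induction I rule: infinite_finite_induct) (auto intro: bounded_borel_0 bounded_borel_add)

lemma sets_sphere_borel: "A \<in> sets (sphere_borel :: 'a::euclidean_space measure) \<longleftrightarrow> A \<in> sets borel \<and> A \<subseteq> sphere 0 1"
  unfolding sphere_borel_def by (subst sets_restrict_space_iff) auto

locale sphere_complex_measure =
  fixes \<mu> :: "'a::euclidean_space set \<Rightarrow> complex"
  assumes complex_measure: "complex_measure sphere_borel \<mu>"
begin

definition I :: "('a \<Rightarrow> complex) \<Rightarrow> complex" where "I f = complex_integral sphere_borel \<mu> f"

text \<open>The four Jordan parts, numbered so that statements about them are proved once.\<close>

definition part :: "nat \<Rightarrow> 'a measure" where
  "part k = upper_variation sphere_borel
    (if k = 0 then (\<lambda>A. Re (\<mu> A)) else if k = 1 then (\<lambda>A. - Re (\<mu> A))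
     else if k = 2 then (\<lambda>A. Im (\<mu> A)) else (\<lambda>A. - Im (\<mu> A)))"

lemma finite_measure_part: "finite_measure (part k)"
  and sets_part: "sets (part k) = sets sphere_borel"
  using complex_measure_parts[OF complex_measure]
  by (auto simp: part_def finite_measure_upper_variation signed_measure_uminus)

lemma I_eq: "I f = (integral\<^sup>L (part 0) f - integral\<^sup>L (part 1) f)
    + \<i> * (integral\<^sup>L (part 2) f - integral\<^sup>L (part 3) f)"
  by (simp add: I_def complex_integral_def signed_integral_def part_def)

lemma measure_eq: "A \<in> sets sphere_borel \<Longrightarrow> \<mu> A = of_real (measure (part 0) A - measure (part 1) A)
    + \<i> * of_real (measure (part 2) A - measure (part 3) A)"
  using Jordan_decomposition[OF complex_measure_parts(1)[OF complex_measure], of A]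
    Jordan_decomposition[OF complex_measure_parts(2)[OF complex_measure], of A]
  by (simp add: complex_eq_iff part_def)

lemma
  fixes M :: "'a measure"
  assumes M: "finite_measure M" "sets M = sets sphere_borel"
  shows measurable_sphere_borel: "f \<in> borel_measurable borel \<Longrightarrow> f \<in> borel_measurable M"
    and integrable_bounded_borel: "bounded_borel g \<Longrightarrow> integrable M g"
proof -
  show *: "f \<in> borel_measurable borel \<Longrightarrow> f \<in> borel_measurable M" for f :: "'a \<Rightarrow> 'b::topological_space"
    unfolding measurable_cong_sets[OF M(2) refl] sphere_borel_def by (rule measurable_restrict_space1)
  interpret finite_measure M by fact
  have "g \<in> borel_measurable borel \<Longrightarrow> g \<in> borel_measurable M"
    unfolding measurable_cong_sets[OF M(2) refl] sphere_borel_def by (rule measurable_restrict_space1)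
  note m = this
  assume g: "bounded_borel g"
  then obtain C where C: "\<And>x. norm (g x) \<le> C" by (auto simp: bounded_borel_def)
  show "integrable M g"
  proof (rule integrable_const_bound)
    show "AE x in M. norm (g x) \<le> C" by (rule AE_I2) (rule C)
    show "g \<in> borel_measurable M" by (rule m) (use g in \<open>simp add: bounded_borel_def\<close>)
  qed
qed

lemma I_add:
  assumes "bounded_borel f" "bounded_borel g" shows "I (\<lambda>x. f x + g x) = I f + I g"
proof -
  have "(\<integral>x. f x + g x \<partial>part k) = integral\<^sup>L (part k) f + integral\<^sup>L (part k) g" for k
    by (rule Bochner_Integration.integral_add;
        rule integrable_bounded_borel[OF finite_measure_part sets_part]; fact)
  then show ?thesis unfolding I_eq by (simp add: algebra_simps)
qed

lemma I_cmult: "I (\<lambda>x. c * f x) = c * I f"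
  unfolding I_eq integral_mult_right_zero
  by (simp only: right_diff_distrib distrib_left mult.left_commute)

lemma I_0: "I (\<lambda>x. 0) = 0"
  using I_cmult[of 0 "\<lambda>x. 0"] by simp

lemma I_sum: "(\<And>i. i \<in> S \<Longrightarrow> bounded_borel (f i)) \<Longrightarrow> I (\<lambda>x. \<Sum>i\<in>S. f i x) = (\<Sum>i\<in>S. I (f i))"
proof (induction S rule: infinite_finite_induct)
  case (insert i S)
  have "I (\<lambda>x. \<Sum>i\<in>insert i S. f i x) = I (\<lambda>x. f i x + (\<Sum>i\<in>S. f i x))"
    using insert.hyps by simp
  also have "\<dots> = I (f i) + I (\<lambda>x. \<Sum>i\<in>S. f i x)"
    by (rule I_add[OF _ bounded_borel_sum]) (use insert.prems in blast)+
  also have "\<dots> = (\<Sum>i\<in>insert i S. I (f i))"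
    using insert by simp
  finally show ?case .
qed (simp_all add: I_0)

lemma I_indicator: "A \<in> sets sphere_borel \<Longrightarrow> I (indicator A) = \<mu> A"
proof -
  assume A: "A \<in> sets sphere_borel"
  have "integral\<^sup>L M (indicator A :: 'a \<Rightarrow> complex) = of_real (measure M A)"
    if "finite_measure M" "sets M = sets sphere_borel" for M :: "'a measure"
  proof -
    interpret finite_measure M by fact
    have "integral\<^sup>L M (indicator A :: 'a \<Rightarrow> complex) = (\<integral>x. complex_of_real (indicator A x) \<partial>M)"
      by (intro Bochner_Integration.integral_cong) (auto simp: indicator_def)
    also have "\<dots> = of_real (measure M A)"
      using A that(2) sets.sets_into_space[of A M]
      by (simp add: Int_absorb2)
    finally show ?thesis .
  qed
  note int = this
  show ?thesis by (simp add: I_eq int finite_measure_part sets_part measure_eq[OF A])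
qed

lemma I_limit:
  assumes f: "\<And>n. f n \<in> borel_measurable borel" and C: "\<And>n x. norm (f n x) \<le> C"
    and lim: "\<And>x. (\<lambda>n. f n x) \<longlonglongrightarrow> g x"
  shows "(\<lambda>n. I (f n)) \<longlonglongrightarrow> I g"
proof -
  have g: "g \<in> borel_measurable borel" by (rule borel_measurable_LIMSEQ_metric[OF f lim])
  have "(\<lambda>n. integral\<^sup>L M (f n)) \<longlonglongrightarrow> integral\<^sup>L M g"
    if "finite_measure M" "sets M = sets sphere_borel" for M :: "'a measure"
  proof (rule integral_dominated_convergence[where w = "\<lambda>_. C"])
    interpret finite_measure M by fact
    show "integrable M (\<lambda>_. C)" by simp
    show "f n \<in> borel_measurable M" for n by (rule measurable_sphere_borel[OF that f])
    show "g \<in> borel_measurable M" by (rule measurable_sphere_borel[OF that g])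
  qed (use C lim in auto)
  note int = this
  show ?thesis unfolding I_eq by (intro tendsto_intros int finite_measure_part sets_part)
qed

text \<open>\<open>M\<close> lives on \<open>sphere_borel\<close>; its image on the Borel sets of
  the ambient space is the measure to which \<open>inner_regular\<close> applies.\<close>

lemma finite_measure_inner_regularity:
  fixes M :: "'a measure"
  assumes M: "finite_measure M" "sets M = sets sphere_borel" and F: "F \<in> sets sphere_borel" and e: "e > 0"
  shows "\<exists>K. compact K \<and> K \<subseteq> F \<and> measure M F < measure M K + e"
\<comment> \<open>Otherwise \<open>measure M F - e\<close> is nonnegative and may be compared in
  \<open>ennreal\<close>.\<close>
proof (cases "measure M F < e")
  case True
  then show ?thesis by (intro exI[of _ "{}"]) simp
next
  case False
  interpret finite_measure M by fact
  have id: "(\<lambda>x. x) \<in> measurable M borel" by (rule measurable_sphere_borel[OF M]) simp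
  define M' where "M' = distr M borel (\<lambda>x. x)"
  interpret M': finite_measure M' unfolding M'_def by (rule finite_measure_distr[OF id])
  have spM: "space M = sphere 0 1"
    using sets_eq_imp_space_eq[OF M(2)] by (simp add: sphere_borel_def space_restrict_space)
  have meas: "emeasure M' A = ennreal (measure M A)" if "A \<in> sets borel" "A \<subseteq> F" for A
  proof -
    have "A \<subseteq> space M" using that(2) F by (auto simp: spM sets_sphere_borel)
    then show ?thesis using that id by (simp add: M'_def emeasure_distr Int_absorb2 emeasure_eq_measure)
  qed
  have FB: "F \<in> sets borel" using F by (simp add: sets_sphere_borel)
  have "emeasure M' F = (SUP K\<in>{K. K \<subseteq> F \<and> compact K}. emeasure M' K)"
    by (rule inner_regular) (use FB M'.emeasure_finite in \<open>auto simp: M'_def\<close>)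
  moreover have "ennreal (measure M F - e) < emeasure M' F"
    unfolding meas[OF FB subset_refl] using e False by (subst ennreal_less_iff) auto
  ultimately obtain K where K: "K \<subseteq> F" "compact K" "ennreal (measure M F - e) < emeasure M' K"
    by (auto simp: less_SUP_iff)
  have "ennreal (measure M F - e) < ennreal (measure M K)"
    using K(3) unfolding meas[OF borel_compact[OF K(2)] K(1)] .
  then have "measure M F - e < measure M K" using False by (subst (asm) ennreal_less_iff) auto
  then show ?thesis using K by (intro exI[of _ K]) auto
qed

text \<open>The union of four compact sets approximates all Jordan parts simultaneously, so no
  cancellation between the parts can spoil the approximation.\<close>

lemma inner_regularity:
  assumes F: "F \<in> sets sphere_borel" "\<mu> F \<noteq> 0"
  obtains K where "compact K" "K \<subseteq> F" "\<mu> K \<noteq> 0"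
proof -
  \<comment> \<open>Real and imaginary part each involve two Jordan parts, so the total error stays
    below \<open>4 * e\<close>.\<close>
  define e where "e = norm (\<mu> F) / 4"
  have e: "e > 0" using F by (simp add: e_def)
  have "\<forall>k. \<exists>K. compact K \<and> K \<subseteq> F \<and> measure (part k) F < measure (part k) K + e"
    using finite_measure_inner_regularity[OF finite_measure_part sets_part F(1) e] by blast
  from choice[OF this] obtain L where
    L: "\<And>k. compact (L k)" "\<And>k. L k \<subseteq> F" "\<And>k. measure (part k) F < measure (part k) (L k) + e" by blast
  define K where "K = (\<Union>k\<le>(3::nat). L k)"
  have cK: "compact K" "K \<subseteq> F" using L by (auto simp: K_def)
  have sb: "A \<in> sets sphere_borel" if "compact A" "A \<subseteq> F" for A
    using that F(1) by (auto simp: sets_sphere_borel borel_compact)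
  have c: "\<bar>measure (part k) F - measure (part k) K\<bar> < e" if k: "k \<le> 3" for k
  proof -
    interpret finite_measure "part k" by (rule finite_measure_part)
    have "L k \<subseteq> K" using k by (auto simp: K_def)
    then have "measure (part k) (L k) \<le> measure (part k) K" "measure (part k) K \<le> measure (part k) F"
      using cK F(1) sets_part sb by (auto intro!: finite_measure_mono)
    then show ?thesis using L(3)[of k] by simp
  qed
  have "\<mu> K \<noteq> 0"
  proof
    assume 0: "\<mu> K = 0"
    have "norm (\<mu> F) = norm (\<mu> F - \<mu> K)" using 0 by simp
    also have "\<dots> \<le> \<bar>Re (\<mu> F - \<mu> K)\<bar> + \<bar>Im (\<mu> F - \<mu> K)\<bar>" by (rule cmod_le)
    also have "\<dots> < 4 * e"
      using c[of 0] c[of 1] c[of 2] c[of 3] by (simp add: measure_eq[OF F(1)] measure_eq[OF sb[OF cK]])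
    also have "\<dots> = norm (\<mu> F)" by (simp add: e_def)
    finally show False by simp
  qed
  then show ?thesis using that cK by blast
qed

end

section \<open>Invariant polynomials and the cone condition\<close>

text \<open>Functions on the sphere whose harmonic components share one \<open>k\<close> but may
  have different degrees.\<close>

inductive harm_sum :: "nat \<Rightarrow> (quat ^ 'n \<Rightarrow> complex) \<Rightarrow> bool" for k where
  harm_sum_restr: "hpoly h \<psi> \<Longrightarrow> Lap \<psi> = (\<lambda>x. 0) \<Longrightarrow> Gam \<psi> = (\<lambda>x. gamma_eigenvalue k * \<psi> x) \<Longrightarrow> even (h + k)
    \<Longrightarrow> harm_sum k (restr \<psi>)"
| harm_sum_add: "harm_sum k p \<Longrightarrow> harm_sum k q \<Longrightarrow> harm_sum k (\<lambda>x. p x + q x)"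

lemma harm_sum_sum:
  "(\<And>i. i \<le> n \<Longrightarrow> harm_sum k (F i)) \<Longrightarrow> harm_sum k (\<lambda>x. \<Sum>i\<le>(n::nat). F i x)"
  by (induction n) (auto intro: harm_sum_add)

lemma sphere_cont_harm_sum: "harm_sum k F \<Longrightarrow> sphere_cont F"
  by (induction rule: harm_sum.induct) (auto intro: sphere_cont_hpoly sphere_cont_add)

lemma restr_nx2_sum:
  "restr (\<lambda>x. \<Sum>i\<in>I. nx2 x ^ i * \<psi> i x) = (\<lambda>x. \<Sum>i\<in>I. restr (\<psi> i) x)"
  by (auto simp: restr_def nx2_def dot_square_norm)

text \<open>The invariant factor is annihilated by the three derivations, which removes the cross
  terms in \<open>Gam_times\<close>; the product keeps the eigenvalue of \<open>g\<close>, and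
  \<open>harmonic_decomposition\<close> passes it to the components.\<close>

lemma harm_sum_ipoly_times:
  assumes f: "ipoly f" and g: "hpoly d g" "Gam g = (\<lambda>x. gamma_eigenvalue k * g x)" "even (d + k)"
  shows "harm_sum k (restr (\<lambda>x. f x * g x))"
  using f
proof (induction rule: ipoly.induct)
  case (ipoly_hpoly e p)
  let ?p = "\<lambda>x. p x * g x"
  have h: "hpoly (e + d) ?p" by (rule hpoly_times[OF ipoly_hpoly(1) g(1)])
  have Lp: "LD (left_gen u) p = (\<lambda>x. 0)" if "u \<in> quat_units" for u using ipoly_hpoly(3) that .
  have "Gam p = (\<lambda>x. 0)"
    by (simp add: Gam_def Lp quat_units_mem)
  then have Gp: "Gam ?p = (\<lambda>x. gamma_eigenvalue k * ?p x)"
    unfolding Gam_times[OF ipoly_hpoly(1) g(1)] by (simp add: Lp quat_units_mem g(2) mult_ac)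
  have "\<exists>\<psi>. (\<forall>i\<le>(e + d) div 2. hpoly (e + d - 2 * i) (\<psi> i) \<and> Lap (\<psi> i) = (\<lambda>x. 0) \<and>
      Gam (\<psi> i) = (\<lambda>x. gamma_eigenvalue k * \<psi> i x)) \<and> ?p = (\<lambda>x. \<Sum>i\<le>(e + d) div 2. nx2 x ^ i * \<psi> i x)"
    by (rule harmonic_decomposition[where Q = "\<lambda>p. Gam p = (\<lambda>x. gamma_eigenvalue k * p x)", OF _ _ _ _ h Gp])
      (simp_all add: Gam_add Gam_cmult Gam_nx2 Gam_Lap Lap_cmult ring_distribs mult.left_commute)
  then obtain \<psi> where \<psi>: "\<And>i. i \<le> (e + d) div 2 \<Longrightarrow> hpoly (e + d - 2 * i) (\<psi> i)"
    "\<And>i. i \<le> (e + d) div 2 \<Longrightarrow> Lap (\<psi> i) = (\<lambda>x. 0)"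
    "\<And>i. i \<le> (e + d) div 2 \<Longrightarrow> Gam (\<psi> i) = (\<lambda>x. gamma_eigenvalue k * \<psi> i x)"
    and p: "?p = (\<lambda>x. \<Sum>i\<le>(e + d) div 2. nx2 x ^ i * \<psi> i x)" by blast
  have "even (e + d - 2 * i + k)" if "i \<le> (e + d) div 2" for i
    using that ipoly_hpoly(2) g(3) by presburger
  then show ?case unfolding p restr_nx2_sum
    by (intro harm_sum_sum harm_sum_restr[OF \<psi>]) auto
next
  case (ipoly_add p q)
  have "restr (\<lambda>x. (p x + q x) * g x) = (\<lambda>x. restr (\<lambda>x. p x * g x) x + restr (\<lambda>x. q x * g x) x)"
    by (auto simp: restr_def ring_distribs)
  then show ?case using ipoly_add.IH by (simp add: harm_sum_add)
qed

lemma gamma_sum_continuous: "gamma_sum d p \<Longrightarrow> continuous_on A p"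
  by (induction rule: gamma_sum.induct) (auto intro: hpoly_continuous continuous_intros)

locale cone_measure = sphere_complex_measure \<mu> for \<mu> :: "(quat ^ 'n) set \<Rightarrow> complex" +
  fixes \<epsilon> :: real
  assumes card: "CARD('n) \<ge> 2" and \<epsilon>: "\<epsilon> > 0"
    and finite_exceptions: "finite (index_cone \<epsilon> \<inter>
      {(h, m) \<in> index_set. \<exists>x\<in>sphere 0 1. proj_measure h m \<mu> x \<noteq> 0})"
begin

text \<open>The projection of \<mu> is the combination of the basis \<open>B\<close> with
  coefficients \<open>I\<close> of the conjugates. If it vanishes, so do the coefficients, and the
  conjugates of \<open>B\<close> span the space as well.\<close>

lemma I_harmonics_eq_0:
  assumes proj: "\<forall>x\<in>sphere 0 1. proj_measure h m \<mu> x = 0" and f: "f \<in> harmonics h m"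
  shows "I f = 0"
proof -
  define B where "B = (SOME B. orthonormal_basis (harmonics h m :: (quat ^ 'n \<Rightarrow> complex) set) B)"
  have "orthonormal_basis (harmonics h m :: (quat ^ 'n \<Rightarrow> complex) set) B"
    unfolding B_def by (rule someI_ex[OF harmonics_orthonormal_basis])
  then have fin: "finite B" and BH: "B \<subseteq> harmonics h m" and on: "orthonormal_on B"
    and span: "\<And>f. f \<in> harmonics h m \<Longrightarrow> \<exists>c. \<forall>x. f x = (\<Sum>e\<in>B. c e * e x)"
    by (auto simp: orthonormal_basis_def orthonormal_on_def)
  have cB: "sphere_cont e" if "e \<in> B" for e using that BH sphere_cont_harmonics by blast
  have bb: "bounded_borel (\<lambda>y. c * cnj (e y))" if "e \<in> B" for e c
    by (intro bounded_borel_sphere_cont sphere_cont_cmult sphere_cont_cnj cB that)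
  have "(\<Sum>e\<in>B. I (\<lambda>y. cnj (e y)) * e x) = 0" for x
  proof (cases "x \<in> sphere 0 1")
    case True
    have "proj_measure h m \<mu> x = I (\<lambda>y. \<Sum>e\<in>B. e x * cnj (e y))"
      by (simp add: proj_measure_def proj_kernel_def I_def B_def)
    also have "\<dots> = (\<Sum>e\<in>B. e x * I (\<lambda>y. cnj (e y)))"
      using bb by (simp add: I_sum I_cmult)
    finally show ?thesis using proj True by (simp add: mult.commute)
  next
    case False
    then have "e x = 0" if "e \<in> B" for e using cB[OF that] by (simp add: sphere_cont_def)
    then show ?thesis by (simp add: sum.neutral)
  qed
  then have eq: "(\<lambda>x. \<Sum>e\<in>B. I (\<lambda>y. cnj (e y)) * e x) = (\<lambda>x. 0)" by blast
  have I0: "I (\<lambda>y. cnj (e y)) = 0" if "e \<in> B" for e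
    using L2_inner_orthonormal_sum[OF fin on cB that, of "\<lambda>e. I (\<lambda>y. cnj (e y))"]
    unfolding eq by (simp add: L2_inner_0_left)
  obtain c where c: "\<And>x. cnj (f x) = (\<Sum>e\<in>B. c e * e x)"
    using span[OF harmonics_cnj[OF f]] by blast
  have "f x = (\<Sum>e\<in>B. cnj (c e) * cnj (e x))" for x
    using arg_cong[OF c[of x], of cnj] by simp
  then have "f = (\<lambda>x. \<Sum>e\<in>B. cnj (c e) * cnj (e x))" by blast
  then have "I f = I (\<lambda>x. \<Sum>e\<in>B. cnj (c e) * cnj (e x))" by simp
  also have "\<dots> = 0" using bb I0 by (simp add: I_sum I_cmult)
  finally show ?thesis .
qed

text \<open>For \<open>h = 2 m + k\<close> the distance of \<open>m / h\<close> from 1/2 is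
  \<open>k / (2 h)\<close>, which is below \<epsilon> once \<open>h\<close> exceeds
  \<open>H1\<close>. Beyond \<open>H0\<close> there are no exceptional indices.\<close>

lemma I_harmonic_high_degree:
  obtains H where "\<And>h \<psi>. h \<ge> H \<Longrightarrow> hpoly h \<psi> \<Longrightarrow> Lap \<psi> = (\<lambda>x. 0) \<Longrightarrow>
    Gam \<psi> = (\<lambda>x. gamma_eigenvalue k * \<psi> x) \<Longrightarrow> even (h + k) \<Longrightarrow> I (restr \<psi>) = 0"
proof -
  define Bad where "Bad = index_cone \<epsilon> \<inter>
      {(h, m) \<in> index_set. \<exists>x\<in>sphere 0 1. proj_measure h m \<mu> x \<noteq> 0}"
  have "finite (fst ` Bad)" using finite_exceptions by (simp add: Bad_def)
  then obtain H0 where H0: "\<And>h. h \<in> fst ` Bad \<Longrightarrow> h < H0"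
    by (auto simp: finite_nat_set_iff_bounded)
  obtain H1 :: nat where H1: "real k / (2 * \<epsilon>) < real H1" using reals_Archimedean2 by blast
  show ?thesis
  proof (rule that)
    fix h and \<psi> :: "quat ^ 'n \<Rightarrow> complex"
    assume h: "max H0 (max H1 (max k 1)) \<le> h" and \<psi>: "hpoly h \<psi>" "Lap \<psi> = (\<lambda>x. 0)"
      "Gam \<psi> = (\<lambda>x. gamma_eigenvalue k * \<psi> x)" and even: "even (h + k)"
    \<comment> \<open>Since \<open>h \<ge> k\<close> and \<open>h + k\<close> is even, the division
      is exact.\<close>
    define m where "m = (h - k) div 2"
    have hm: "h = 2 * m + k" using h even unfolding m_def by presburger
    have hpos: "real h > 0" using h by simp
    have "real m / real h - 1 / 2 = - (real k / (2 * real h))"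
      using hpos by (simp add: field_simps hm)
    moreover have "real k < 2 * \<epsilon> * real h"
    proof -
      have "real k < real H1 * (2 * \<epsilon>)" using H1 \<epsilon> by (simp add: pos_divide_less_eq)
      also have "\<dots> \<le> real h * (2 * \<epsilon>)" using h \<epsilon> by (intro mult_right_mono) auto
      finally show ?thesis by (simp add: mult_ac)
    qed
    then have "real k / (2 * real h) < \<epsilon>" using hpos by (simp add: pos_divide_less_eq mult_ac)
    ultimately have cone: "(h, m) \<in> index_cone \<epsilon>" "(h, m) \<in> index_set"
      using h hm by (auto simp: index_cone_def index_set_def)
    have "(h, m) \<notin> Bad" using H0[of h] h by force
    then have proj: "\<forall>x\<in>sphere 0 1. proj_measure h m \<mu> x = 0" using cone by (auto simp: Bad_def)
    have "gamma_eigenvalue k = of_real ((real h - 2 * real m) * (real h - 2 * real m + 2))"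
      by (simp add: gamma_eigenvalue_def hm)
    then have "restr \<psi> \<in> harmonics h m" unfolding harmonics_iff using \<psi> by auto
    from I_harmonics_eq_0[OF proj this] show "I (restr \<psi>) = 0" .
  qed
qed

definition harm_basis :: "nat \<Rightarrow> (quat ^ 'n \<Rightarrow> complex) set" where
  "harm_basis h = (SOME B. orthonormal_basis {restr p | p. hpoly h p \<and> Lap p = (\<lambda>x. 0)} B)"

lemma harm_basis:
  shows "finite (harm_basis h)" "orthonormal_on (harm_basis h)"
    "e \<in> harm_basis h \<Longrightarrow> \<exists>p. e = restr p \<and> hpoly h p \<and> Lap p = (\<lambda>x. 0)"
    "hpoly h p \<Longrightarrow> Lap p = (\<lambda>x. 0) \<Longrightarrow> \<exists>c. restr p = (\<lambda>x. \<Sum>e\<in>harm_basis h. c e * e x)"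
    "e \<in> harm_basis h \<Longrightarrow> sphere_cont e"
proof -
  have B: "orthonormal_basis {restr p | p. hpoly h p \<and> Lap p = (\<lambda>x. 0)} (harm_basis h)"
    unfolding harm_basis_def by (rule someI_ex[OF harmonic_restr_basis])
  then show "finite (harm_basis h)" "orthonormal_on (harm_basis h)"
    by (auto simp: orthonormal_basis_def orthonormal_on_def)
  show e: "e \<in> harm_basis h \<Longrightarrow> \<exists>p. e = restr p \<and> hpoly h p \<and> Lap p = (\<lambda>x. 0)"
    using B by (auto simp: orthonormal_basis_def)
  then show "e \<in> harm_basis h \<Longrightarrow> sphere_cont e" using sphere_cont_hpoly by auto
  assume p: "hpoly h p" "Lap p = (\<lambda>x. 0)"
  then have "restr p \<in> {restr p | p. hpoly h p \<and> Lap p = (\<lambda>x. 0)}" by blast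
  then obtain c where "\<forall>x. restr p x = (\<Sum>e\<in>harm_basis h. c e * e x)"
    using B unfolding orthonormal_basis_def by blast
  then show "\<exists>c. restr p = (\<lambda>x. \<Sum>e\<in>harm_basis h. c e * e x)" by blast
qed

lemma DIM_ge_2: "2 \<le> DIM(quat ^ 'n)"
  using card unfolding DIM_quat_vec by simp

text \<open>Components of degree at least \<open>H\<close> integrate to zero, so only finitely many
  Fourier coefficients of \<open>F\<close> enter. Both sides are additive, which reduces the claim
  to a single component.\<close>

lemma harm_sum_expansion:
  obtains H where "\<And>F. harm_sum k F \<Longrightarrow> I F = (\<Sum>h<H. \<Sum>e\<in>harm_basis h. L2_inner F e * I e)"
proof -
  obtain H where H: "\<And>h \<psi>. h \<ge> H \<Longrightarrow> hpoly h \<psi> \<Longrightarrow> Lap \<psi> = (\<lambda>x. 0) \<Longrightarrow>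
    Gam \<psi> = (\<lambda>x. gamma_eigenvalue k * \<psi> x) \<Longrightarrow> even (h + k) \<Longrightarrow> I (restr \<psi>) = 0"
    using I_harmonic_high_degree[of k] by blast
  show ?thesis
  proof (rule that)
    fix F :: "quat ^ 'n \<Rightarrow> complex" assume "harm_sum k F"
    then show "I F = (\<Sum>h<H. \<Sum>e\<in>harm_basis h. L2_inner F e * I e)"
    proof (induction rule: harm_sum.induct)
      case (harm_sum_restr h \<psi>)
      have orth: "L2_inner (restr \<psi>) e = 0" if e: "e \<in> harm_basis h'" "h' \<noteq> h" for e h'
      proof -
        obtain p where p: "e = restr p" "hpoly h' p" "Lap p = (\<lambda>x. 0)" using harm_basis(3)[OF e(1)] by blast
        show ?thesis unfolding p(1)
          by (rule laplace_eigen_orthogonal[OF DIM_ge_2 laplace_eigen_hpoly[OF harm_sum_restr(1,2)] p(2,3) e(2)])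
      qed
      show ?case
      proof (cases "h < H")
        case False
        then have "(\<Sum>h<H. \<Sum>e\<in>harm_basis h. L2_inner (restr \<psi>) e * I e) = 0"
          by (intro sum.neutral ballI) (auto simp: orth)
        then show ?thesis using H[OF _ harm_sum_restr] False by simp
      next
        case True
        obtain c where c: "restr \<psi> = (\<lambda>x. \<Sum>e\<in>harm_basis h. c e * e x)"
          using harm_basis(4)[OF harm_sum_restr(1,2)] by blast
        have "(\<Sum>h'<H. \<Sum>e\<in>harm_basis h'. L2_inner (restr \<psi>) e * I e)
            = (\<Sum>h'<H. if h' = h then \<Sum>e\<in>harm_basis h. L2_inner (restr \<psi>) e * I e else 0)"
          by (intro sum.cong refl) (auto simp: orth)
        also have "\<dots> = (\<Sum>e\<in>harm_basis h. L2_inner (restr \<psi>) e * I e)"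
          using True by (subst sum.delta) auto
        also have "\<dots> = (\<Sum>e\<in>harm_basis h. c e * I e)"
          unfolding c
          by (intro sum.cong refl arg_cong2[where f = "(*)"]
              L2_inner_orthonormal_sum[OF harm_basis(1,2) harm_basis(5)])
        also have "\<dots> = I (\<lambda>x. \<Sum>e\<in>harm_basis h. c e * e x)"
          using bounded_borel_cmult[OF bounded_borel_sphere_cont[OF harm_basis(5)]]
          by (simp add: I_sum I_cmult)
        also have "\<dots> = I (restr \<psi>)" by (simp only: c)
        finally show ?thesis by simp
      qed
    next
      case (harm_sum_add p q)
      note cont = harm_sum_add.hyps[THEN sphere_cont_harm_sum]
      have "I (\<lambda>x. p x + q x) = I p + I q"
        using cont by (intro I_add bounded_borel_sphere_cont)
      also have "\<dots> = (\<Sum>h<H. \<Sum>e\<in>harm_basis h. (L2_inner p e + L2_inner q e) * I e)"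
        by (simp only: harm_sum_add.IH ring_distribs sum.distrib)
      also have "\<dots> = (\<Sum>h<H. \<Sum>e\<in>harm_basis h. L2_inner (\<lambda>x. p x + q x) e * I e)"
        by (intro sum.cong refl arg_cong2[where f = "(*)"] L2_inner_add_left[symmetric] cont harm_basis(5))
      finally show ?case .
    qed
  qed
qed

lemma continuous_on_ipoly: "ipoly f \<Longrightarrow> continuous_on S f"
  by (induction rule: ipoly.induct) (auto intro: hpoly_continuous continuous_intros)

text \<open>Each of the finitely many Fourier coefficients of \<open>f g\<close> is at most the
  product of the suprema of \<open>g\<close> and the basis function with the integral of the modulus
  of \<open>f\<close>. The number of coefficients depends on \<open>g\<close> only, hence so does
  \<open>C\<close>.\<close>

lemma I_ipoly_times_bound:
  assumes "hpoly d g"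
  shows "\<exists>C. \<forall>f. ipoly f \<longrightarrow> norm (I (restr (\<lambda>x. f x * g x))) \<le> C * (\<integral>x. norm (restr f x) \<partial>sphere_measure)"
  using gamma_sum_hpoly[OF assms]
proof (induction rule: gamma_sum.induct)
  case (gamma_sum_eigen d g k)
  obtain H where H: "\<And>F. harm_sum k F \<Longrightarrow> I F = (\<Sum>h<H. \<Sum>e\<in>harm_basis h. L2_inner F e * I e)"
    using harm_sum_expansion[of k] by blast
  obtain G where G: "\<And>x. norm (restr g x) \<le> G" "G \<ge> 0"
    using sphere_cont_bounded[OF sphere_cont_hpoly[OF gamma_sum_eigen(1)]] by blast
  define D where "D e = (SOME D. D \<ge> 0 \<and> (\<forall>x. norm (e x) \<le> D))" for e :: "quat ^ 'n \<Rightarrow> complex"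
  have D: "D e \<ge> 0 \<and> (\<forall>x. norm (e x) \<le> D e)" if e: "e \<in> harm_basis h" for e h
  proof -
    have "\<exists>D. D \<ge> 0 \<and> (\<forall>x. norm (e x) \<le> D)"
      using sphere_cont_bounded[OF harm_basis(5)[OF e]] by blast
    then show ?thesis unfolding D_def by (rule someI_ex)
  qed
  define C where "C = (\<Sum>h<H. \<Sum>e\<in>harm_basis h. G * D e * norm (I e))"
  have "norm (I (restr (\<lambda>x. f x * g x))) \<le> C * (\<integral>x. norm (restr f x) \<partial>sphere_measure)" if f: "ipoly f" for f
  proof -
    let ?F = "restr (\<lambda>x. f x * g x)"
    let ?N = "\<integral>x. norm (restr f x) \<partial>sphere_measure"
    have hs: "harm_sum k ?F" by (rule harm_sum_ipoly_times[OF f gamma_sum_eigen])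
    have cf: "sphere_cont (restr f)" by (rule sphere_cont_restr[OF continuous_on_ipoly[OF f]])
    have L: "norm (L2_inner ?F e) \<le> G * D e * ?N" if e: "e \<in> harm_basis h" for e h
    proof -
      have "norm (L2_inner ?F e) \<le> (\<integral>x. norm (?F x * cnj (e x)) \<partial>sphere_measure)"
        unfolding L2_inner_def by (rule integral_norm_bound)
      also have "\<dots> \<le> (\<integral>x. G * D e * norm (restr f x) \<partial>sphere_measure)"
      proof (rule integral_mono)
        show "integrable sphere_measure (\<lambda>x. norm (?F x * cnj (e x)))"
          by (intro integrable_norm L2_inner_integrable sphere_cont_harm_sum[OF hs] harm_basis(5)[OF e])
        show "integrable sphere_measure (\<lambda>x. G * D e * norm (restr f x))"
          using integrable_sphere_cont[OF cf] by simp
        fix x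
        have "?F x = restr f x * restr g x" by (simp add: restr_def)
        then have "norm (?F x * cnj (e x)) = norm (restr f x) * (norm (restr g x) * norm (e x))"
          by (simp add: norm_mult)
        also have "\<dots> \<le> norm (restr f x) * (G * D e)"
          using G D[OF e] by (intro mult_left_mono mult_mono) auto
        finally show "norm (?F x * cnj (e x)) \<le> G * D e * norm (restr f x)" by (simp add: mult.commute)
      qed
      finally show ?thesis by simp
    qed
    have "norm (I ?F) \<le> (\<Sum>h<H. \<Sum>e\<in>harm_basis h. norm (L2_inner ?F e * I e))"
      unfolding H[OF hs] by (intro sum_norm_le) auto
    also have "\<dots> \<le> (\<Sum>h<H. \<Sum>e\<in>harm_basis h. G * D e * norm (I e) * ?N)"
    proof (intro sum_mono)
      fix h e assume "e \<in> harm_basis h"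
      from mult_right_mono[OF L[OF this], of "norm (I e)"]
      show "norm (L2_inner ?F e * I e) \<le> G * D e * norm (I e) * ?N"
        by (simp add: norm_mult mult_ac)
    qed
    also have "\<dots> = C * ?N" by (simp add: C_def sum_distrib_right)
    finally show ?thesis .
  qed
  then show ?case by blast
next
  case (gamma_sum_add d p q)
  obtain C D where C: "\<And>f. ipoly f \<Longrightarrow> norm (I (restr (\<lambda>x. f x * p x))) \<le> C * (\<integral>x. norm (restr f x) \<partial>sphere_measure)"
    and D: "\<And>f. ipoly f \<Longrightarrow> norm (I (restr (\<lambda>x. f x * q x))) \<le> D * (\<integral>x. norm (restr f x) \<partial>sphere_measure)"
    using gamma_sum_add.IH by blast
  have pq: "continuous_on A p" "continuous_on A q" for A
    using gamma_sum_add.hyps gamma_sum_continuous by blast+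
  have "norm (I (restr (\<lambda>x. f x * (p x + q x)))) \<le> (C + D) * (\<integral>x. norm (restr f x) \<partial>sphere_measure)"
    if f: "ipoly f" for f
  proof -
    have eq: "restr (\<lambda>x. f x * (p x + q x)) = (\<lambda>x. restr (\<lambda>x. f x * p x) x + restr (\<lambda>x. f x * q x) x)"
      by (auto simp: restr_def ring_distribs)
    have "I (restr (\<lambda>x. f x * (p x + q x))) = I (restr (\<lambda>x. f x * p x)) + I (restr (\<lambda>x. f x * q x))"
      unfolding eq
      by (intro I_add bounded_borel_sphere_cont sphere_cont_restr continuous_on_mult
          continuous_on_ipoly[OF f] pq)
    also have "norm \<dots> \<le> C * (\<integral>x. norm (restr f x) \<partial>sphere_measure) + D * (\<integral>x. norm (restr f x) \<partial>sphere_measure)"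
      by (rule norm_triangle_le[OF add_mono[OF C[OF f] D[OF f]]])
    finally show ?thesis by (simp add: ring_distribs)
  qed
  then show ?case by blast
qed

section \<open>Passage from polynomials to indicator functions\<close>

lemma I_indicator_orbits_times:
  assumes K: "compact K" "K \<subseteq> sphere 0 1" "K \<noteq> {}"
    and E: "E = {x \<in> sphere 0 1. orbit_map x \<in> orbit_map ` K}" "E \<in> sets borel"
    and null: "emeasure sphere_measure E = 0" and g: "hpoly d g"
  shows "I (\<lambda>x. indicator E x * restr g x) = 0"
proof -
  interpret \<sigma>: finite_measure "sphere_measure :: (quat ^ 'n) measure" by (rule finite_measure_sphere_measure)
  let ?S = "orbit_map ` sphere (0 :: quat ^ 'n) 1"
  have "compact ?S" "compact (orbit_map ` K)"
    using K by (auto intro!: compact_continuous_image continuous_orbit_map)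
  \<comment> \<open>The approximation takes place on the image of \<open>orbit_map\<close>, so that
    pulling back gives invariant polynomials.\<close>
  then obtain P :: "nat \<Rightarrow> quat ^ 'n ^ 'n \<Rightarrow> real" where P: "\<And>n. real_polynomial_function (P n)"
    "\<And>n z. z \<in> ?S \<Longrightarrow> \<bar>P n z\<bar> \<le> 2" "\<And>z. z \<in> ?S \<Longrightarrow> (\<lambda>n. P n z) \<longlonglongrightarrow> indicator (orbit_map ` K) z"
    using polynomials_tendsto_indicator[of ?S "orbit_map ` K"] K(3) by auto
  define f where "f n = (\<lambda>x :: quat ^ 'n. complex_of_real (P n (orbit_map x)))" for n
  have ip: "ipoly (f n)" for n unfolding f_def by (rule ipoly_orbit_map[OF P(1)])
  have cf: "sphere_cont (restr (f n))" for n
    by (rule sphere_cont_restr[OF continuous_on_ipoly[OF ip]])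
  have f2: "norm (restr (f n) x) \<le> 2" for n x
    using P(2)[of "orbit_map x" n] by (auto simp: restr_def f_def)
  have flim: "(\<lambda>n. restr (f n) x) \<longlonglongrightarrow> indicator E x" for x
  proof (cases "x \<in> sphere 0 1")
    case True
    have "(\<lambda>n. complex_of_real (P n (orbit_map x))) \<longlonglongrightarrow> of_real (indicator (orbit_map ` K) (orbit_map x))"
      using True by (intro tendsto_of_real P(3)) simp
    moreover have "complex_of_real (indicator (orbit_map ` K) (orbit_map x)) = indicator E x"
      using True unfolding E(1) indicator_def by simp
    ultimately show ?thesis using True by (simp only: restr_on f_def)
  next
    case False then show ?thesis by (simp add: restr_off E(1) del: mem_sphere mem_sphere_0)
  qed
  have cg: "sphere_cont (restr g)" by (rule sphere_cont_hpoly[OF g])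
  obtain G where G: "\<And>x. norm (restr g x) \<le> G" "G \<ge> 0" using sphere_cont_bounded[OF cg] by blast
  obtain C where C: "\<And>f. ipoly f \<Longrightarrow> norm (I (restr (\<lambda>x. f x * g x))) \<le> C * (\<integral>x. norm (restr f x) \<partial>sphere_measure)"
    using I_ipoly_times_bound[OF g] by blast
  have fg: "restr (\<lambda>x. f n x * g x) = (\<lambda>x. restr (f n) x * restr g x)" for n
    by (auto simp: restr_def)
  have "(\<lambda>n. I (\<lambda>x. restr (f n) x * restr g x)) \<longlonglongrightarrow> I (\<lambda>x. indicator E x * restr g x)"
  proof (rule I_limit)
    show "(\<lambda>x. restr (f n) x * restr g x) \<in> borel_measurable borel" for n
      by (intro sphere_cont_measurable sphere_cont_mult cf cg)
    show "norm (restr (f n) x * restr g x) \<le> 2 * G" for n x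
      unfolding norm_mult using f2 G by (intro mult_mono) auto
    show "(\<lambda>n. restr (f n) x * restr g x) \<longlonglongrightarrow> indicator E x * restr g x" for x
      by (intro tendsto_mult flim tendsto_const)
  qed
  then have lim1: "(\<lambda>n. norm (I (restr (\<lambda>x. f n x * g x)))) \<longlonglongrightarrow> norm (I (\<lambda>x. indicator E x * restr g x))"
    unfolding fg by (rule tendsto_norm)
  have "(\<lambda>n. \<integral>x. norm (restr (f n) x) \<partial>sphere_measure) \<longlonglongrightarrow> (\<integral>x. norm (indicator E x :: complex) \<partial>sphere_measure)"
  proof (rule integral_dominated_convergence[where w = "\<lambda>_. 2"])
    show "AE x in sphere_measure. (\<lambda>n. norm (restr (f n) x)) \<longlonglongrightarrow> norm (indicator E x :: complex)"
      by (intro AE_I2 tendsto_norm flim)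
    show "(\<lambda>x. norm (restr (f n) x)) \<in> borel_measurable sphere_measure" for n
      using sphere_cont_measurable[OF cf[of n]] by simp
    show "AE x in sphere_measure. norm (norm (restr (f n) x)) \<le> 2" for n using f2 by simp
  qed (use E(2) in simp_all)
  moreover have "(\<integral>x. norm (indicator E x :: complex) \<partial>sphere_measure) = 0"
  proof -
    have "(\<integral>x. norm (indicator E x :: complex) \<partial>sphere_measure) = (\<integral>x. indicator E x \<partial>sphere_measure)"
      by (intro Bochner_Integration.integral_cong) (auto simp: indicator_def)
    also have "\<dots> = 0" using E(2) null by (simp add: measure_def)
    finally show ?thesis .
  qed
  ultimately have "(\<lambda>n. C * (\<integral>x. norm (restr (f n) x) \<partial>sphere_measure)) \<longlonglongrightarrow> C * 0"
    by (intro tendsto_mult tendsto_const) simp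
  from LIMSEQ_le[OF lim1 this] C[OF ip] have "norm (I (\<lambda>x. indicator E x * restr g x)) \<le> 0" by auto
  then show ?thesis by simp
qed

text \<open>By linearity the integral over \<open>E\<close> vanishes for all polynomials.
  Polynomials tending to the indicator of \<open>K\<close> then give the value of \<mu> at
  \<open>E \<inter> K = K\<close>.\<close>

lemma measure_eq_0_if_orbits_null:
  assumes K: "compact K" "K \<subseteq> sphere 0 1" "K \<noteq> {}"
    and E: "E = {x \<in> sphere 0 1. orbit_map x \<in> orbit_map ` K}" "E \<in> sets borel"
    and null: "emeasure sphere_measure E = 0"
  shows "\<mu> K = 0"
proof -
  have cp: "sphere_cont (restr p) \<and> I (\<lambda>x. indicator E x * restr p x) = 0" if "cpoly p" for p
    using that
  proof (induction rule: cpoly.induct)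
    case (cpoly_hpoly d p)
    then show ?case using I_indicator_orbits_times[OF K E null] sphere_cont_hpoly by blast
  next
    case (cpoly_add p q)
    have eq: "restr (\<lambda>x. p x + q x) = (\<lambda>x. restr p x + restr q x)" by (auto simp: restr_def)
    note bb = bounded_borel_mult[OF bounded_borel_indicator[OF E(2)] bounded_borel_sphere_cont]
    have "I (\<lambda>x. indicator E x * restr p x + indicator E x * restr q x) = 0"
      using I_add[OF bb bb] cpoly_add.IH by simp
    then show ?case unfolding eq using cpoly_add.IH by (simp add: sphere_cont_add ring_distribs)
  qed
  obtain P :: "nat \<Rightarrow> quat ^ 'n \<Rightarrow> real" where P: "\<And>n. real_polynomial_function (P n)"
    "\<And>n z. z \<in> sphere 0 1 \<Longrightarrow> \<bar>P n z\<bar> \<le> 2" "\<And>z. z \<in> sphere 0 1 \<Longrightarrow> (\<lambda>n. P n z) \<longlonglongrightarrow> indicator K z"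
    using polynomials_tendsto_indicator[OF compact_sphere K(1,3), of 0 1] by auto
  define g where "g n = (\<lambda>x. complex_of_real (P n x))" for n
  have g: "cpoly (g n)" for n unfolding g_def by (rule cpoly_real_polynomial_function[OF P(1)])
  have "(\<lambda>n. I (\<lambda>x. indicator E x * restr (g n) x)) \<longlonglongrightarrow> I (indicator K)"
  proof (rule I_limit)
    show "(\<lambda>x. indicator E x * restr (g n) x) \<in> borel_measurable borel" for n
    proof -
      have "restr (g n) \<in> borel_measurable borel" using cp[OF g[of n]] sphere_cont_measurable by blast
      then show ?thesis using E(2) by (intro borel_measurable_times borel_measurable_indicator) simp_all
    qed
    show "norm (indicator E x * restr (g n) x) \<le> 2" for n x
      using P(2)[of x n] by (auto simp: restr_def g_def indicator_def)
    show "(\<lambda>n. indicator E x * restr (g n) x) \<longlonglongrightarrow> indicator K x" for x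
    proof (cases "x \<in> E")
      case True
      then have x: "x \<in> sphere 0 1" by (simp add: E(1))
      have "(\<lambda>n. complex_of_real (P n x)) \<longlonglongrightarrow> of_real (indicator K x)"
        by (intro tendsto_of_real P(3) x)
      moreover have "complex_of_real (indicator K x) = indicator K x" by (simp add: indicator_def)
      ultimately show ?thesis using True by (simp only: restr_on[OF x] g_def) simp
    next
      case False
      then have "x \<notin> K" using K(2) by (auto simp: E(1))
      with False show ?thesis by simp
    qed
  qed
  then have "I (indicator K) = 0" using cp[OF g] by (simp add: LIMSEQ_const_iff)
  moreover have "K \<in> sets sphere_borel" using K by (simp add: sets_sphere_borel borel_compact)
  ultimately show ?thesis using I_indicator by simp
qed

text \<open>If some \<open>s\<close> below 4n - 4 had Hausdorff measure zero on \<open>F\<close>, a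
  compact \<open>K \<subseteq> F\<close> charged by \<mu> would have a null union of orbits,
  contradicting \<open>measure_eq_0_if_orbits_null\<close>.\<close>

lemma hausdorff_dim_ge:
  assumes F: "F \<in> sets sphere_borel" "\<mu> F \<noteq> 0"
  shows "ereal (4 * real CARD('n) - 4) \<le> hausdorff_dim F"
  unfolding hausdorff_dim_def
proof (rule INF_greatest)
  fix s assume "s \<in> {s. 0 < s \<and> hausdorff_measure s F = 0}"
  then have s: "0 < s" "hausdorff_measure s F = 0" by auto
  show "ereal (4 * real CARD('n) - 4) \<le> ereal s"
  proof (rule ccontr)
    assume "\<not> ?thesis"
    then have s': "s \<le> 4 * real CARD('n) - 4" by simp
    obtain K where K: "compact K" "K \<subseteq> F" "\<mu> K \<noteq> 0" by (rule inner_regularity[OF F])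
    have KS: "K \<subseteq> sphere 0 1" using K(2) F(1) by (auto simp: sets_sphere_borel)
    \<comment> \<open>\<open>infdist\<close> to the empty set is zero, so the approximation of
      indicators asks for a nonempty set.\<close>
    have "K \<noteq> {}"
    proof
      assume "K = {}"
      moreover have "(indicator {} :: quat ^ 'n \<Rightarrow> complex) = (\<lambda>x. 0)" by auto
      ultimately show False using K(3) I_indicator[of "{}"] I_0 by simp
    qed
    have pre: "hausdorff_premeasure s \<delta> K \<le> hausdorff_premeasure s \<delta> F" for \<delta>
      unfolding hausdorff_premeasure_def using K(2) by (intro INF_superset_mono) auto
    have "hausdorff_measure s K \<le> hausdorff_measure s F"
      unfolding hausdorff_measure_def by (intro SUP_mono') (rule pre)
    then have HK: "hausdorff_measure s K = 0" using s(2) by simp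
    define E where "E = {x \<in> sphere 0 1. orbit_map x \<in> orbit_map ` K}"
    \<comment> \<open>The image of \<open>K\<close> under \<open>orbit_map\<close> is compact; this
      is one reason for passing from \<open>F\<close> to a compact subset.\<close>
    have "closed E"
    proof -
      have "closed (orbit_map ` K)"
        using K(1) by (intro compact_imp_closed compact_continuous_image continuous_orbit_map)
      then have "closed (sphere 0 1 \<inter> orbit_map -` (orbit_map ` K))"
        by (intro continuous_closed_preimage continuous_orbit_map) auto
      then show ?thesis by (simp add: E_def Int_def)
    qed
    then have EB: "E \<in> sets borel" by simp
    have "emeasure sphere_measure E = 0"
    proof (rule sphere_measure_orbits_null[OF card KS EB _ _ s(1) s' HK])
      show "E \<subseteq> sphere 0 1" by (auto simp: E_def)
      fix y assume "y \<in> E"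
      then obtain a where "a \<in> K" "orbit_map y = orbit_map a" by (auto simp: E_def)
      then show "\<exists>u a. norm u = 1 \<and> a \<in> K \<and> y = u *s a"
      proof -
        assume a: "a \<in> K" "orbit_map y = orbit_map a"
        then have "norm a = 1" using KS by auto
        from orbit_map_eqD[OF a(2) this] a(1) show ?thesis by blast
      qed
    qed
    from measure_eq_0_if_orbits_null[OF K(1) KS \<open>K \<noteq> {}\<close> E_def EB this] K(3) show False by simp
  qed
qed

end

theorem theorem1p5:
  fixes \<mu> :: "(quat ^ 'n) set \<Rightarrow> complex" and \<epsilon> :: real
  assumes "CARD('n) \<ge> 2"
    and "complex_measure (sphere_borel :: (quat ^ 'n) measure) \<mu>"
    and "\<epsilon> > 0"
    and "finite (index_cone \<epsilon> \<inter>
           {(h, m) \<in> index_set. \<exists>x\<in>sphere 0 1. proj_measure h m \<mu> x \<noteq> 0})"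
  shows "lower_hausdorff_dim sphere_borel \<mu> \<ge> ereal (4 * real CARD('n) - 4)"
proof -
  interpret cone_measure \<mu> \<epsilon> by unfold_locales (fact assms)+
  show ?thesis
    unfolding lower_hausdorff_dim_def by (rule INF_greatest) (auto intro: hausdorff_dim_ge)
qed

end
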